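(* Let $\mathbb{F}$ be an algebraically closed field of characteristic $p=2$. Let $11\leq m<n$ and let $X=\mathsf{A}_m$ be embedded in $\mathsf{A}_n$ via its action on partitions of $\{1,2,\ldots,m\}$ or on $k$-subsets of $\{1,2,\ldots,m\}$ with $2\leq k<m/2$. Let $V$ be any $\mathbb{F}\mathsf{A}_n$-module of dimension greater than $1$. Then $\mathrm{Res}^{\mathsf{A}_n}_X V$ is reducible.
   Context: $\mathsf{A}_k$ denotes the alternating group of degree $k$. The action on $k$-subsets is the natural action of $\mathsf{A}_m$ on the $n=\binom{m}{k}$ subsets of $\{1,\ldots,m\}$ of size $k$. The action on partitions is the natural action of $\mathsf{A}_m$ on the set partitions of $\{1,\ldots,m\}$ into $b$ subsets of size $a$, where $m=ab$ with $a,b\ge 2$; here $n=(ab)!/((a!)^b\cdot b!)$. *)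

theory Defs
  imports
    "HOL-Algebra.Sym_Groups"
    "HOL-Algebra.Group_Action"
    "HOL-Computational_Algebra.Polynomial"
    "HOL-Library.Disjoint_Sets"
begin

text \<open>A module over the group algebra of \<open>G\<close> is a vector space (all of type \<open>'v\<close>, with scalar
  multiplication \<open>scale\<close>) together with an action of \<open>G\<close> on it by linear maps.\<close>

locale group_rep = group_action G UNIV \<rho> + vector_space scale
  for G :: "('g, 'r) monoid_scheme" (structure)
    and scale :: "'f::field \<Rightarrow> 'v::ab_group_add \<Rightarrow> 'v"
    and \<rho> :: "'g \<Rightarrow> 'v \<Rightarrow> 'v" +
  assumes linear: "g \<in> carrier G \<Longrightarrow> Vector_Spaces.linear scale scale (\<rho> g)"
begin

definition invariant_subspace :: "'v set \<Rightarrow> bool"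
  where "invariant_subspace W \<longleftrightarrow> subspace W \<and> (\<forall>g\<in>carrier G. \<forall>w\<in>W. \<rho> g w \<in> W)"

definition reducible :: bool
  where "reducible \<longleftrightarrow> (\<exists>W. invariant_subspace W \<and> W \<noteq> {0} \<and> W \<noteq> UNIV)"

text \<open>The restriction to a subgroup keeps \<open>scale\<close> and \<open>\<rho>\<close>.\<close>

lemma restriction:
  assumes "subgroup H G"
  shows "group_rep (G\<lparr>carrier := H\<rparr>) scale \<rho>"
proof -
  interpret group_hom G "BijGroup UNIV" \<rho> by (rule group_hom)
  have sub: "H \<subseteq> carrier G" using assms by (rule subgroup.subset)
  have "group_hom (G\<lparr>carrier := H\<rparr>) (BijGroup UNIV) \<rho>"
    using assms subsetD[OF sub] homh
    by (auto simp: group_hom_def group_hom_axioms_def hom_def G.subgroup_imp_group group_BijGroup)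
  then show ?thesis
    using subsetD[OF sub] linear
    by (intro group_rep.intro group_rep_axioms.intro group_action.intro vector_space_axioms) simp_all
qed

end

definition k_subsets :: "nat \<Rightarrow> nat \<Rightarrow> nat set set"
  where "k_subsets m k = {S. S \<subseteq> {1..m} \<and> card S = k}"

definition block_partitions :: "nat \<Rightarrow> nat \<Rightarrow> nat set set set"
  where "block_partitions a b =
    {P. partition_on {1..a * b} P \<and> card P = b \<and> (\<forall>B\<in>P. card B = a)}"

definition subset_action :: "nat \<Rightarrow> nat \<Rightarrow> (nat \<Rightarrow> nat) \<Rightarrow> nat set \<Rightarrow> nat set"
  where "subset_action m k g = (\<lambda>S\<in>k_subsets m k. g ` S)"

definition partition_action :: "nat \<Rightarrow> nat \<Rightarrow> (nat \<Rightarrow> nat) \<Rightarrow> nat set set \<Rightarrow> nat set set"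
  where "partition_action a b g = (\<lambda>P\<in>block_partitions a b. (\<lambda>B. g ` B) ` P)"

text \<open>A labelling \<open>f\<close> of \<open>\<Omega>\<close> by \<open>1, \<dots>, n\<close> turns a permutation of \<open>\<Omega>\<close> into one of
  \<open>{1..n}\<close>; being an element of \<open>sym_group n\<close>, the latter fixes everything outside \<open>{1..n}\<close>.\<close>

definition relabel :: "'x set \<Rightarrow> ('x \<Rightarrow> nat) \<Rightarrow> ('x \<Rightarrow> 'x) \<Rightarrow> nat \<Rightarrow> nat"
  where "relabel \<Omega> f \<sigma> i = (if i \<in> f ` \<Omega> then f (\<sigma> (inv_into \<Omega> f i)) else i)"

definition embedded_alt :: "nat \<Rightarrow> 'x set \<Rightarrow> ((nat \<Rightarrow> nat) \<Rightarrow> 'x \<Rightarrow> 'x) \<Rightarrow> ('x \<Rightarrow> nat) \<Rightarrow> (nat \<Rightarrow> nat) set"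
  where "embedded_alt m \<Omega> \<phi> f = (\<lambda>g. relabel \<Omega> f (\<phi> g)) ` carrier (alt_group m)"

lemma group_actionI_alt:
  assumes mem: "\<And>g x. g permutes {1..m} \<Longrightarrow> x \<in> \<Omega> \<Longrightarrow> act g x \<in> \<Omega>"
    and id: "\<And>x. act id x = x"
    and comp: "\<And>g h x. act (g \<circ> h) x = act g (act h x)"
  shows "group_action (alt_group m) \<Omega> (\<lambda>g. \<lambda>x\<in>\<Omega>. act g x)"
proof -
  have bij: "bij_betw (\<lambda>x\<in>\<Omega>. act g x) \<Omega> \<Omega>" if g: "g permutes {1..m}" for g
  proof (rule bij_betw_byWitness[where f' = "act (inv' g)"])
    have "act (inv' g) (act g x) = x" "act g (act (inv' g) x) = x" for x
      using g by (simp_all flip: comp add: permutes_inv_o id)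
    then show "\<forall>x\<in>\<Omega>. act (inv' g) ((\<lambda>x\<in>\<Omega>. act g x) x) = x"
      and "\<forall>x\<in>\<Omega>. (\<lambda>x\<in>\<Omega>. act g x) (act (inv' g) x) = x"
      using mem[OF permutes_inv[OF g]] by auto
  qed (use mem[OF g] mem[OF permutes_inv[OF g]] in auto)
  have "(\<lambda>g. \<lambda>x\<in>\<Omega>. act g x) \<in> hom (alt_group m) (BijGroup \<Omega>)"
    using bij mem
    by (auto simp: hom_def BijGroup_def Bij_def alt_group_carrier alt_group_mult compose_def
        comp fun_eq_iff)
  then show ?thesis
    by (intro group_action.intro group_hom.intro group_hom_axioms.intro alt_group_is_group
        group_BijGroup)
qed

lemma subset_action: "group_action (alt_group m) (k_subsets m k) (subset_action m k)"
  unfolding subset_action_def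
proof (rule group_actionI_alt)
  fix g S assume g: "g permutes {1..m}" and S: "S \<in> k_subsets m k"
  have "card (g ` S) = card S"
    by (rule card_image) (use g in \<open>blast intro: permutes_inj_on\<close>)
  then show "g ` S \<in> k_subsets m k"
    using S permutes_image[OF g] by (auto simp: k_subsets_def)
qed (auto simp: image_image)

lemma partition_action:
  "group_action (alt_group (a * b)) (block_partitions a b) (partition_action a b)"
  unfolding partition_action_def
proof (rule group_actionI_alt)
  fix g P assume g: "g permutes {1..a * b}" and P: "P \<in> block_partitions a b"
  have inj: "inj g" using g by (rule permutes_inj)
  have "card ((`) g ` P) = card P"
    by (rule card_image) (use inj in \<open>auto simp: inj_on_def inj_image_eq_iff\<close>)
  moreover have "card (g ` B) = card B" for B
    by (rule card_image) (use inj in \<open>blast intro: inj_on_subset\<close>)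
  moreover have "partition_on (g ` {1..a * b}) ((`) g ` P)"
    using P inj
    by (auto simp: block_partitions_def partition_on_def disjoint_def inj_image_eq_iff
        simp flip: image_Union image_Int)
  ultimately show "(`) g ` P \<in> block_partitions a b"
    using P permutes_image[OF g] by (auto simp: block_partitions_def)
qed (auto simp: image_image image_comp)

text \<open>The image of such an action consists of even permutations, since \<open>alt_group m\<close> is generated
  by elements of order three.\<close>

lemma subgroup_embedded_alt:
  assumes act: "group_action (alt_group m) \<Omega> \<phi>" and f: "bij_betw f \<Omega> {1..n}"
  shows "subgroup (embedded_alt m \<Omega> \<phi> f) (alt_group n)"
proof -
  interpret group_action "alt_group m" \<Omega> \<phi> by (rule act)
  interpret A: group "alt_group m" by (rule alt_group_is_group)
  let ?t = "\<lambda>g. relabel \<Omega> f (\<phi> g)"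
  have inj: "inj_on f \<Omega>" and im: "f ` \<Omega> = {1..n}" using f by (auto simp: bij_betw_def)
  have bij: "bij_betw (\<phi> g) \<Omega> \<Omega>" if "g \<in> carrier (alt_group m)" for g
    using bij_prop0[OF that] by (simp add: Bij_def)
  have perm: "?t g permutes {1..n}" if g: "g \<in> carrier (alt_group m)" for g
  proof (rule bij_imp_permutes)
    have "bij_betw (f \<circ> \<phi> g \<circ> inv_into \<Omega> f) {1..n} {1..n}"
      using f bij[OF g] bij_betw_inv_into[OF f] by (blast intro: bij_betw_trans)
    then show "bij_betw (?t g) {1..n} {1..n}"
      by (rule bij_betw_cong[THEN iffD1, rotated]) (simp add: relabel_def im)
  qed (auto simp: relabel_def im)
  have mult: "?t (g \<circ> h) = ?t g \<circ> ?t h"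
    if g: "g \<in> carrier (alt_group m)" and h: "h \<in> carrier (alt_group m)" for g h
  proof
    fix i
    have "\<phi> (g \<circ> h) x = \<phi> g (\<phi> h x)" if "x \<in> \<Omega>" for x
      using composition_rule[OF that g h] by (simp add: alt_group_mult)
    moreover have "\<phi> h x \<in> \<Omega>" if "x \<in> \<Omega>" for x
      using bij[OF h] that by (auto simp: bij_betw_def)
    ultimately show "?t (g \<circ> h) i = (?t g \<circ> ?t h) i"
      using inj by (auto simp: relabel_def inv_into_f_f) (metis inv_into_f_f inj)
  qed
  have id: "?t id = id"
    using id_eq_one[symmetric]
    by (auto simp: relabel_def fun_eq_iff alt_group_one inj inv_into_f_f)
  have even_sq: "evenperm (?t (g \<circ> g))" if "g \<in> carrier (alt_group m)" for g
    using perm[OF that] mult[OF that that]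
    by (simp add: evenperm_comp permutation_permutes) (metis evenperm_comp finite_atLeastAtMost permutation_permutes)
  have even3: "evenperm (?t c)" if c: "c \<in> three_cycles m" for c
  proof -
    have cA: "c \<in> carrier (alt_group m)" using c three_cycles_incl by blast
    obtain cs where cs: "c = cycle_of_list cs" "cycle cs" "length cs = 3" using c by auto
    then obtain x y z where "cs = [x, y, z]" by (auto simp: length_Suc_conv numeral_3_eq_3)
    with cs have "c \<circ> c \<circ> (c \<circ> c) = c"
      by (auto simp: fun_eq_iff transpose_def)
    moreover have "c \<circ> c \<in> carrier (alt_group m)"
      using A.m_closed[OF cA cA] by (simp add: alt_group_mult)
    ultimately show ?thesis using even_sq by metis
  qed
  have evn: "g \<in> carrier (alt_group m) \<and> evenperm (?t g)"
    if "g \<in> generate (alt_group m) (three_cycles m)" for g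
    using that
  proof induction
    case one
    then show ?case using A.one_closed by (simp only: alt_group_one id evenperm_id simp_thms)
  next
    case (incl c)
    then show ?case using even3 three_cycles_incl by blast
  next
    case (inv c)
    then have c: "c \<in> carrier (alt_group m)" using three_cycles_incl by blast
    let ?d = "inv\<^bsub>alt_group m\<^esub> c"
    have d: "?d \<in> carrier (alt_group m)" using c by simp
    have "?t c \<circ> ?t ?d = id"
      using mult[OF c d] A.r_inv[OF c] id by (simp add: alt_group_mult alt_group_one)
    moreover have "permutation (?t c)" "permutation (?t ?d)"
      using perm[OF c] perm[OF d] permutation_permutes by blast+
    ultimately show ?case using d even3[OF inv] evenperm_comp evenperm_id by metis
  next
    case (eng g h)
    then have g: "g \<in> carrier (alt_group m)" and h: "h \<in> carrier (alt_group m)" by blast+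
    then have "permutation (?t g)" "permutation (?t h)"
      using perm permutation_permutes by blast+
    then have "evenperm (?t (g \<circ> h))"
      unfolding mult[OF g h] using eng evenperm_comp by blast
    then show ?case
      using A.m_closed[OF g h] unfolding alt_group_mult by blast
  qed
  have "?t g \<in> carrier (alt_group n)" if "g \<in> carrier (alt_group m)" for g
    using that evn[of g] perm[OF that] by (simp add: alt_group_carrier_as_three_cycles[of m] alt_group_carrier[of _ n])
  then have "?t \<in> hom (alt_group m) (alt_group n)"
    by (simp add: hom_def alt_group_mult mult)
  then have "group_hom (alt_group m) (alt_group n) ?t"
    by (simp add: group_hom_def group_hom_axioms_def alt_group_is_group)
  then show ?thesis
    unfolding embedded_alt_def by (rule group_hom.img_is_subgroup)
qed

end

theory Submission
  imports Defs
begin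

text \<open>
  The idea is to replace all representation theory of the big group \<open>alt_group n\<close> by a little algebra
  with sums of three-cycles. Suppose that the restriction to the subgroup \<open>X\<close> is irreducible. By
  Schur's lemma every operator that commutes with \<open>X\<close> is a scalar, and a scalar commutes with the
  whole of \<open>alt_group n\<close>. So each \<open>X\<close>-invariant sum of three-cycles yields relations between the
  operators of three-cycles: all conjugates of the sum under \<open>alt_group n\<close> act alike. If the sum is
  built from a sparse \<open>X\<close>-invariant configuration, then iterated differences of conjugates isolate
  a single summand. The configurations come from an \<open>X\<close>-invariant graph on the \<open>n\<close> points.

  Write \<open>\<Phi>(x, y, z)\<close> for the sum of the two three-cycles with support \<open>{x, y, z}\<close>, as an
  operator on \<open>V\<close>.

  \<^item> The sum of \<open>\<Phi>\<close> over the triangles of the graph is a scalar, and its third differences show that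
    the sum of \<open>\<Phi>\<close> over the eight faces of any octahedron vanishes
    (\<open>octahedron_nine\<close>, \<open>octahedral\<close>).

  \<^item> Let \<open>\<kappa>(a, b, c, d)\<close> be the sum of \<open>\<Phi>\<close> over the faces of a tetrahedron, that is, the sum of
    all three-cycles of the alternating group on four points. The octahedral relation gives
    \<open>\<kappa>(a, b, c, d) = w(a, b) + w(c, d)\<close> with operators \<open>w\<close>. Multiplication inside small alternating
    groups shows that products of three operators \<open>w\<close> vanish, so their common kernel is a nonzero
    invariant subspace, hence \<open>w = 0\<close> and \<open>\<kappa> = 0\<close> (\<open>tip_vanishes\<close>, \<open>tetra_vanishes\<close>). In other
    words, \<open>\<Phi>\<close> is a cocycle.

  \<^item> The graph or its complement has only even degrees. For such a graph \<open>E\<close> the sum of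
    \<open>\<Phi>(p, x, y)\<close> over the edges \<open>xy\<close> of \<open>E\<close> does not depend on the base point \<open>p\<close>, because \<open>\<Phi>\<close> is
    a cocycle and the degrees are even (\<open>cone_base_change\<close>). So it commutes with \<open>X\<close> and is a
    scalar. Second differences now show \<open>\<Phi>(p, a - b, a' - b') = 0\<close>, and together with the cocycle
    relation this makes \<open>\<Phi>\<close> constant (\<open>Phi_constant\<close>).

  \<^item> The constant value is an idempotent that commutes with the group. If it is \<open>0\<close>, then the action
    is trivial, which the dimension of \<open>V\<close> excludes. If it is \<open>1\<close>, then \<open>g + inverse g = 1\<close> for all
    three-cycles \<open>g\<close>, as in the basic spin modules (\<open>spin_relation\<close>). Then the operator of a
    three-cycle depends, up to adding \<open>0\<close> or \<open>1\<close>, on its support only, and it is again a cocycle up to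
    \<open>0\<close> and \<open>1\<close>. The previous argument, applied modulo \<open>{0, 1}\<close>, makes a nontrivial even
    permutation act trivially, a contradiction (\<open>inconsistent\<close>).

  It remains to find the graphs. For \<open>k\<close>-subsets two subsets are adjacent if they differ in one
  element; for partitions into at least three blocks two partitions are adjacent if they share all but
  two blocks; for two blocks of size \<open>a\<close> they are adjacent if some block of one meets some block of the
  other in a single point. In each case nine explicit vertices form a configuration
  (\<open>detached_triangle\<close>) to which the difference arguments apply.
\<close>



section \<open>Functions on triples with values in a group of exponent two\<close>

lemma fresh_point:
  assumes "finite \<Omega>" "length xs < card \<Omega>"
  shows "\<exists>p\<in>\<Omega>. p \<notin> set xs"
proof (rule ccontr)
  assume "\<not> ?thesis"
  then have "\<Omega> \<subseteq> set xs" by blast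
  then have "card \<Omega> \<le> card (set xs)" by (simp add: card_mono)
  also have "\<dots> \<le> length xs" by (rule card_length)
  finally show False using assms by simp
qed

text \<open>The function \<open>F\<close> is regarded as a two-dimensional cochain of the full simplex with vertex set \<open>\<Omega>\<close>;
  it is evaluated on triples. Eleven points leave room for the auxiliary vertices of the arguments.\<close>

locale char_two_cochain =
  fixes \<Omega> :: "'p set" and F :: "'p set \<Rightarrow> 'a::ab_group_add"
  assumes fin: "finite \<Omega>" and big: "11 \<le> card \<Omega>"
    and two: "\<And>x::'a. x + x = 0"
begin

lemma two': "x + (x + y) = (y::'a)"
  by (simp add: two flip: add.assoc)

lemmas cancel = ac_simps two two' insert_commute

lemma eq_iff_add: "x = y \<longleftrightarrow> x + y = (0::'a)"
  by (metis two two' add.right_neutral)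

text \<open>The coboundary of \<open>F\<close>, evaluated on a tetrahedron.\<close>

definition tetra :: "'p \<Rightarrow> 'p \<Rightarrow> 'p \<Rightarrow> 'p \<Rightarrow> 'a"
  where "tetra a b c d = F {a, b, c} + F {a, b, d} + F {a, c, d} + F {b, c, d}"

lemma fresh: "length xs < 11 \<Longrightarrow> \<exists>p\<in>\<Omega>. p \<notin> set xs"
  using fresh_point[OF fin] big by simp

text \<open>The eight triples are the faces of an octahedron with the three pairs of opposite vertices
  \<open>a a'\<close>, \<open>b b'\<close>, \<open>c c'\<close>; the equation says that a third difference of \<open>F\<close> vanishes.\<close>

definition octahedral :: bool
  where "octahedral \<longleftrightarrow> (\<forall>a a' b b' c c'. distinct [a, a', b, b', c, c'] \<longrightarrow> {a, a', b, b', c, c'} \<subseteq> \<Omega> \<longrightarrow>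
      F {a, b, c} + F {a', b, c} + F {a, b', c} + F {a', b', c}
      + F {a, b, c'} + F {a', b, c'} + F {a, b', c'} + F {a', b', c'} = 0)"

definition apex :: "'p \<Rightarrow> 'p \<Rightarrow> 'a"
  where "apex d e = (SOME x. \<exists>a b c. distinct [a, b, c, d, e] \<and> {a, b, c, d, e} \<subseteq> \<Omega>
     \<and> x = tetra a b c d + tetra a b c e)"

text \<open>Two tetrahedra over a common triangle bound a bipyramid with tips \<open>d\<close> and \<open>e\<close>. Replacing one vertex of
  the triangle changes the bipyramid by an octahedron, so the sum depends on the tips only. Any two
  triangles are connected by such replacements through a third one, disjoint from both.\<close>

lemma apex:
  assumes oct: octahedral and d: "distinct [a, b, c, d, e]" "{a, b, c, d, e} \<subseteq> \<Omega>"
  shows "tetra a b c d + tetra a b c e = apex d e"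
proof -
  have step: "tetra a b c d + tetra a b c e = tetra a b c' d + tetra a b c' e"
    if "distinct [a, b, c, d, e]" "{a, b, c, d, e} \<subseteq> \<Omega>" "c' \<notin> {a, b, d, e}" "c' \<in> \<Omega>" for a b c c'
  proof (cases "c = c'")
    case False
    have "F {a, c, d} + F {b, c, d} + F {a, c', d} + F {b, c', d}
      + F {a, c, e} + F {b, c, e} + F {a, c', e} + F {b, c', e} = 0"
      using oct[unfolded octahedral_def, rule_format, of a b c c' d e] that False by auto
    then show ?thesis
      by (subst eq_iff_add) (simp add: tetra_def cancel)
  qed simp
  have rot: "tetra a b c d = tetra b c a d" for a b c d
    unfolding tetra_def by (simp add: cancel)
  have to_fresh: "tetra a b c d + tetra a b c e = tetra p q r d + tetra p q r e"
    if "distinct [a, b, c, d, e]" "{a, b, c, d, e} \<subseteq> \<Omega>" "distinct [p, q, r, d, e]" "{p, q, r} \<subseteq> \<Omega>"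
      "{p, q, r} \<inter> {a, b, c} = {}" for a b c p q r
  proof -
    have "tetra a b c d + tetra a b c e = tetra a b p d + tetra a b p e"
      using that by (intro step) auto
    also have "\<dots> = tetra p a b d + tetra p a b e" using rot by metis
    also have "\<dots> = tetra p a q d + tetra p a q e" using that by (intro step) auto
    also have "\<dots> = tetra q p a d + tetra q p a e" using rot by metis
    also have "\<dots> = tetra q p r d + tetra q p r e" using that by (intro step) auto
    also have "\<dots> = tetra p q r d + tetra p q r e" unfolding tetra_def by (simp add: cancel)
    finally show ?thesis .
  qed
  let ?P = "\<lambda>x. \<exists>a b c. distinct [a, b, c, d, e] \<and> {a, b, c, d, e} \<subseteq> \<Omega>
     \<and> x = tetra a b c d + tetra a b c e"
  have "?P (apex d e)" unfolding apex_def by (rule someI[of ?P]) (use d in blast)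
  then obtain a' b' c' where d': "distinct [a', b', c', d, e]" "{a', b', c', d, e} \<subseteq> \<Omega>"
    and x: "apex d e = tetra a' b' c' d + tetra a' b' c' e" by blast
  obtain p where p: "p \<in> \<Omega>" "p \<notin> set [a, b, c, d, e, a', b', c']" using fresh[of "[a, b, c, d, e, a', b', c']"] by auto
  obtain q where q: "q \<in> \<Omega>" "q \<notin> set [a, b, c, d, e, a', b', c', p]" using fresh[of "[a, b, c, d, e, a', b', c', p]"] by auto
  obtain r where r: "r \<in> \<Omega>" "r \<notin> set [a, b, c, d, e, a', b', c', p, q]" using fresh[of "[a, b, c, d, e, a', b', c', p, q]"] by auto
  have "tetra a b c d + tetra a b c e = tetra p q r d + tetra p q r e"
    by (rule to_fresh) (use p q r d in auto)
  moreover have "tetra a' b' c' d + tetra a' b' c' e = tetra p q r d + tetra p q r e"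
    by (rule to_fresh) (use p q r d' in auto)
  ultimately show ?thesis using x by simp
qed

lemma apex_cocycle:
  assumes oct: octahedral and "distinct [d, e, f]" "{d, e, f} \<subseteq> \<Omega>"
  shows "apex d e + apex e f = apex d f"
proof -
  obtain p where p: "p \<in> \<Omega>" "p \<notin> set [d, e, f]" using fresh[of "[d, e, f]"] by auto
  obtain q where q: "q \<in> \<Omega>" "q \<notin> set [d, e, f, p]" using fresh[of "[d, e, f, p]"] by auto
  obtain r where r: "r \<in> \<Omega>" "r \<notin> set [d, e, f, p, q]" using fresh[of "[d, e, f, p, q]"] by auto
  have "tetra p q r d + tetra p q r e = apex d e" "tetra p q r e + tetra p q r f = apex e f"
    "tetra p q r d + tetra p q r f = apex d f"
    using p q r assms by (auto intro!: apex)
  then show ?thesis using two' by (metis add.assoc)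
qed

lemma apex_commute:
  assumes oct: octahedral and "d \<noteq> e" "d \<in> \<Omega>" "e \<in> \<Omega>"
  shows "apex d e = apex e d"
proof -
  obtain p where p: "p \<in> \<Omega>" "p \<notin> set [d, e]" using fresh[of "[d, e]"] by auto
  obtain q where q: "q \<in> \<Omega>" "q \<notin> set [d, e, p]" using fresh[of "[d, e, p]"] by auto
  obtain r where r: "r \<in> \<Omega>" "r \<notin> set [d, e, p, q]" using fresh[of "[d, e, p, q]"] by auto
  have "tetra p q r d + tetra p q r e = apex d e" "tetra p q r e + tetra p q r d = apex e d"
    using p q r assms by (auto intro!: apex)
  then show ?thesis by (simp add: add.commute)
qed

text \<open>Among the tetrahedra inside \<open>{a, b, c, d, e}\<close> every triangle occurs twice, so the sum over all five is
  zero. Four of them pair up to bipyramids with tips \<open>a, b\<close> and \<open>c, d\<close>, and the fifth is \<open>abcd\<close>.\<close>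

lemma tetra_eq_apex:
  assumes oct: octahedral and d: "distinct [a, b, c, d]" "{a, b, c, d} \<subseteq> \<Omega>"
  shows "tetra a b c d = apex a b + apex c d"
proof -
  obtain e where e: "e \<in> \<Omega>" "e \<notin> set [a, b, c, d]" using fresh[of "[a, b, c, d]"] by auto
  have "tetra a b e c + tetra a b e d = apex c d" "tetra c d e a + tetra c d e b = apex a b"
    using e d by (auto intro!: apex[OF oct])
  then have "apex a b + apex c d = tetra c d e a + tetra c d e b + (tetra a b e c + tetra a b e d)" by simp
  also have "\<dots> = tetra a b c d" unfolding tetra_def by (simp add: cancel)
  finally show ?thesis ..
qed

text \<open>Put \<open>h(a, b) = F{a, c, d} + F{b, c, d}\<close>. The second hypothesis says that \<open>h(a, b)\<close> does not depend on
  \<open>c\<close> and \<open>d\<close>, and the first one says \<open>h(a, b) = h(c, d)\<close>. So \<open>h\<close> is constant, and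
  \<open>h(a, b) + h(b, z) = h(a, z)\<close> leaves only the constant zero: one vertex can be exchanged without
  changing \<open>F\<close>.\<close>

lemma const_if_rectangles_vanish:
  assumes closed: "\<And>a b c d. distinct [a, b, c, d] \<Longrightarrow> {a, b, c, d} \<subseteq> \<Omega> \<Longrightarrow> tetra a b c d = 0"
    and rect: "\<And>a b a' b' x. distinct [x, a, b, a', b'] \<Longrightarrow> {x, a, b, a', b'} \<subseteq> \<Omega> \<Longrightarrow>
      F {x, a, a'} + F {x, b, a'} + F {x, a, b'} + F {x, b, b'} = 0"
    and s: "s \<subseteq> \<Omega>" "card s = 3" and t: "t \<subseteq> \<Omega>" "card t = 3"
  shows "F s = F t"
proof -
  let ?h = "\<lambda>a b c d. F {a, c, d} + F {b, c, d}"
  have h1: "?h a b c d = ?h a b c' d" if "distinct [a, b, c, c', d]" "{a, b, c, c', d} \<subseteq> \<Omega>" for a b c c' d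
  proof -
    have "F {d, a, c} + F {d, b, c} + F {d, a, c'} + F {d, b, c'} = 0"
      using that by (intro rect) auto
    then show ?thesis by (subst eq_iff_add) (simp add: cancel)
  qed
  have h2: "?h a b c d = ?h c d a b" if "distinct [a, b, c, d]" "{a, b, c, d} \<subseteq> \<Omega>" for a b c d
    using closed[of a b c d] that unfolding tetra_def by (subst eq_iff_add) (simp add: cancel)
  have h3: "?h a b c d = ?h a b x y" if "distinct [a, b, c, d, x, y]" "{a, b, c, d, x, y} \<subseteq> \<Omega>" for a b c d x y
  proof -
    have "?h a b c d = ?h a b x d" using that by (intro h1) auto
    also have "\<dots> = ?h a b d x" by (simp add: cancel)
    also have "\<dots> = ?h a b y x" using that by (intro h1) auto
    also have "\<dots> = ?h a b x y" by (simp add: cancel)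
    finally show ?thesis .
  qed
  have h0: "F {a, c, d} = F {b, c, d}" if d: "distinct [a, b, c, d]" "{a, b, c, d} \<subseteq> \<Omega>" for a b c d
  proof -
    obtain p where p: "p \<in> \<Omega>" "p \<notin> set [a, b, c, d]" using fresh[of "[a, b, c, d]"] by auto
    obtain q where q: "q \<in> \<Omega>" "q \<notin> set [a, b, c, d, p]" using fresh[of "[a, b, c, d, p]"] by auto
    obtain r where r: "r \<in> \<Omega>" "r \<notin> set [a, b, c, d, p, q]" using fresh[of "[a, b, c, d, p, q]"] by auto
    obtain s where s: "s \<in> \<Omega>" "s \<notin> set [a, b, c, d, p, q, r]" using fresh[of "[a, b, c, d, p, q, r]"] by auto
    obtain z where z: "z \<in> \<Omega>" "z \<notin> set [a, b, c, d, p, q, r, s]" using fresh[of "[a, b, c, d, p, q, r, s]"] by auto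
    have "?h a b p q = ?h p q a b" "?h b z p q = ?h p q b z" "?h a z p q = ?h p q a z"
      using d p q z by (auto intro!: h2)
    moreover have "?h p q a b = ?h p q r s" "?h p q b z = ?h p q r s" "?h p q a z = ?h p q r s"
      using d p q r s z by (auto intro!: h3)
    moreover have "?h a b p q + ?h b z p q = ?h a z p q" by (simp add: cancel)
    ultimately have "?h a b p q = 0" by (metis add_cancel_left_right)
    moreover have "?h a b p q = ?h a b c d" using d p q by (auto intro!: h3)
    ultimately have "?h a b c d = 0" by simp
    then show ?thesis unfolding eq_iff_add[symmetric] .
  qed
  obtain a b c where abc: "s = {a, b, c}" "distinct [a, b, c]" using s(2) by (auto simp: card_3_iff)
  obtain a' b' c' where abc': "t = {a', b', c'}" "distinct [a', b', c']" using t(2) by (auto simp: card_3_iff)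
  obtain p where p: "p \<in> \<Omega>" "p \<notin> set [a, b, c, a', b', c']" using fresh[of "[a, b, c, a', b', c']"] by auto
  obtain q where q: "q \<in> \<Omega>" "q \<notin> set [a, b, c, a', b', c', p]" using fresh[of "[a, b, c, a', b', c', p]"] by auto
  obtain r where r: "r \<in> \<Omega>" "r \<notin> set [a, b, c, a', b', c', p, q]" using fresh[of "[a, b, c, a', b', c', p, q]"] by auto
  have "F {a, b, c} = F {p, q, r}" if "distinct [a, b, c]" "{a, b, c} \<subseteq> \<Omega>" "distinct [p, q, r]" "{p, q, r} \<subseteq> \<Omega>"
      "{a, b, c} \<inter> {p, q, r} = {}" for a b c
  proof -
    have "F {a, b, c} = F {p, b, c}" using that by (intro h0) auto
    also have "\<dots> = F {b, p, c}" by (simp add: insert_commute)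
    also have "\<dots> = F {q, p, c}" using that by (intro h0) auto
    also have "\<dots> = F {c, p, q}" by (simp add: insert_commute)
    also have "\<dots> = F {r, p, q}" using that by (intro h0) auto
    also have "\<dots> = F {p, q, r}" by (simp add: insert_commute)
    finally show ?thesis .
  qed
  from this[of a b c] this[of a' b' c'] show ?thesis using abc abc' p q r s t by auto
qed


lemma sum_const_even: "even (card A) \<Longrightarrow> (\<Sum>x\<in>A. c) = (0::'a)" if "finite A"
proof -
  have "(\<Sum>x\<in>A. c) = (if even (card A) then 0 else c)"
    using that by induction (auto simp: two)
  then show "even (card A) \<Longrightarrow> ?thesis" by simp
qed

lemma sum_closed:
  assumes "0 \<in> L" "\<And>x y. x \<in> L \<Longrightarrow> y \<in> L \<Longrightarrow> x + y \<in> L" "\<And>e. e \<in> E \<Longrightarrow> f e \<in> L"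
  shows "sum f E \<in> (L::'a set)"
  using assms(3) by (induction E rule: infinite_finite_induct) (auto simp: assms(1,2))

text \<open>By the cocycle relation, moving the base point from \<open>p\<close> to \<open>q\<close> changes the term of an edge \<open>xy\<close> by
  \<open>F{p, q, x} + F{p, q, y}\<close>. Altogether \<open>F{p, q, x}\<close> occurs as often as the degree of \<open>x\<close>, an even number
  of times. Everything is stated modulo a subgroup \<open>L\<close>, which is zero in the first application and
  of the form \<open>{0, v}\<close> in the second.\<close>

lemma cone_base_change:
  assumes L: "0 \<in> L" "\<And>x y. x \<in> L \<Longrightarrow> y \<in> L \<Longrightarrow> x + y \<in> L"
    and small: "\<And>t. card t \<noteq> 3 \<Longrightarrow> F t = 0"
    and closed: "\<And>a b c d. distinct [a, b, c, d] \<Longrightarrow> {a, b, c, d} \<subseteq> \<Omega> \<Longrightarrow> tetra a b c d \<in> L"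
    and E: "E \<subseteq> {e. e \<subseteq> \<Omega> \<and> card e = 2}"
    and even_deg: "\<And>x. x \<in> \<Omega> \<Longrightarrow> even (card {e \<in> E. x \<in> e})"
    and p: "p \<in> \<Omega>" "q \<in> \<Omega>"
  shows "(\<Sum>e\<in>E. F (insert p e)) + (\<Sum>e\<in>E. F (insert q e)) \<in> L"
proof (cases "p = q")
  case False
  have finE: "finite E" using E fin by (auto intro: finite_subset[of _ "Pow \<Omega>"])
  have cone_term: "F (insert p e) + F (insert q e) + (\<Sum>x\<in>e. F {p, q, x}) \<in> L" if "e \<in> E" for e
  proof -
    have "card e = 2" "e \<subseteq> \<Omega>" using that E by auto
    then obtain x y where e: "e = {x, y}" "x \<noteq> y" "x \<in> \<Omega>" "y \<in> \<Omega>" by (auto simp: card_2_iff)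
    have deg: "F {u, v} = 0" for u v :: 'p
      by (rule small) (simp add: card_insert_if)
    have eq: "F (insert p e) + F (insert q e) + (\<Sum>x\<in>e. F {p, q, x}) = tetra p q x y"
      using e by (simp add: tetra_def cancel)
    show ?thesis
    proof (cases "distinct [p, q, x, y]")
      case True
      then show ?thesis unfolding eq using p e by (intro closed) auto
    next
      case neq: False
      then consider "x = p" | "x = q" | "y = p" | "y = q" using e False by auto
      then have "tetra p q x y = 0"
        by cases (auto simp: tetra_def cancel deg)
      then show ?thesis unfolding eq using L by simp
    qed
  qed
  have "(\<Sum>e\<in>E. \<Sum>x\<in>e. F {p, q, x}) = (\<Sum>e\<in>E. \<Sum>x | x \<in> \<Omega> \<and> x \<in> e. F {p, q, x})"
    using E by (intro sum.cong refl arg_cong2[where f = sum]) auto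
  also have "\<dots> = (\<Sum>x\<in>\<Omega>. \<Sum>e | e \<in> E \<and> x \<in> e. F {p, q, x})"
    using finE fin by (rule sum.swap_restrict)
  also have "\<dots> = 0"
    using finE even_deg by (intro sum.neutral ballI sum_const_even) auto
  finally have "(\<Sum>e\<in>E. F (insert p e)) + (\<Sum>e\<in>E. F (insert q e))
    = (\<Sum>e\<in>E. F (insert p e) + F (insert q e) + (\<Sum>x\<in>e. F {p, q, x}))"
    by (simp add: sum.distrib)
  also have "\<dots> \<in> L" using L cone_term by (rule sum_closed)
  finally show ?thesis .
qed (simp add: two L)

lemma image_fixed_off:
  assumes "\<And>x. x \<notin> X \<Longrightarrow> h x = x" "e \<inter> X = {}"
  shows "h ` e = e"
proof -
  have "h ` e = (\<lambda>x. x) ` e" using assms by (intro image_cong) auto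
  then show ?thesis by simp
qed

lemma image_avoids:
  assumes "\<And>x. x \<notin> Y \<Longrightarrow> h x = x" "h ` Y = Y" "X \<inter> Y = {}" "e \<inter> X = {}"
  shows "h ` e \<inter> X = {}"
proof -
  have "h x \<notin> X" if "x \<in> e" for x
    using that assms by (cases "x \<in> Y") auto
  then show ?thesis by blast
qed

text \<open>Adding up the four translates of the sum cancels each edge that misses \<open>A\<close> or \<open>A'\<close>, since \<open>s\<close> moves
  only points of \<open>A\<close> and \<open>s'\<close> only points of \<open>A'\<close>. The edge \<open>aa'\<close> is the only other one.\<close>

lemma second_difference:
  fixes G :: "'p set \<Rightarrow> 'a"
  assumes L: "0 \<in> L" "\<And>x y. x \<in> L \<Longrightarrow> y \<in> L \<Longrightarrow> x + y \<in> L"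
    and inv: "\<And>h. h \<in> {id, s, s', s \<circ> s'} \<Longrightarrow> (\<Sum>e\<in>E. G (h ` e)) + k \<in> L"
    and E: "finite E" "{a, a'} \<in> E"
      "\<And>e. e \<in> E \<Longrightarrow> e \<inter> A \<noteq> {} \<Longrightarrow> e \<inter> A' \<noteq> {} \<Longrightarrow> e = {a, a'}"
    and s: "s a = b" "\<And>x. x \<notin> A \<Longrightarrow> s x = x" "s' a' = b'" "\<And>x. x \<notin> A' \<Longrightarrow> s' x = x"
      "A \<inter> A' = {}" "{a, b} \<subseteq> A" "{a', b'} \<subseteq> A'" "s ` A = A" "s' ` A' = A'"
  shows "G {a, a'} + G {b, a'} + G {a, b'} + G {b, b'} \<in> L"
proof -
  let ?B = "\<lambda>e. G e + G (s ` e) + G (s' ` e) + G (s ` s' ` e)"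
  have "?B e = 0" if e: "e \<in> E" "e \<noteq> {a, a'}" for e
  proof -
    consider "e \<inter> A = {}" | "e \<inter> A' = {}" using E(3) e by blast
    then show ?thesis
    proof cases
      case 1
      have "s ` e = e" using s(2) 1 by (rule image_fixed_off)
      moreover have "s' ` e \<inter> A = {}" using s(4,9,5) 1 by (rule image_avoids)
      with s(2) have "s ` s' ` e = s' ` e" by (rule image_fixed_off)
      ultimately show ?thesis by (simp add: cancel)
    next
      case 2
      have "s' ` e = e" using s(4) 2 by (rule image_fixed_off)
      then show ?thesis by (simp add: cancel)
    qed
  qed
  then have sum1: "(\<Sum>e\<in>E. ?B e) = ?B {a, a'}"
    using E(1,2) by (simp add: sum.remove[of E "{a, a'}"] sum.neutral)
  have "a \<notin> A'" "a' \<notin> A" "b \<notin> A'" "b' \<notin> A" using s by auto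
  then have sum2: "?B {a, a'} = G {a, a'} + G {b, a'} + G {a, b'} + G {b, b'}"
    using s by simp
  have sum3: "(\<Sum>e\<in>E. ?B e) = ((\<Sum>e\<in>E. G (id ` e)) + k) + ((\<Sum>e\<in>E. G (s ` e)) + k)
      + ((\<Sum>e\<in>E. G (s' ` e)) + k) + ((\<Sum>e\<in>E. G ((s \<circ> s') ` e)) + k)"
    by (simp add: sum.distrib cancel image_comp)
  have "(\<Sum>e\<in>E. ?B e) \<in> L"
    unfolding sum3 by (intro L(2) inv) auto
  then show ?thesis unfolding sum1 sum2 .
qed

text \<open>The analogue for three permutations with disjoint supports and triples instead of edges.\<close>

lemma third_difference:
  fixes G :: "'p set \<Rightarrow> 'a"
  assumes inv: "\<And>h. h \<in> {id, s, s', s''} \<union> {s \<circ> s', s \<circ> s'', s' \<circ> s'', s \<circ> s' \<circ> s''} \<Longrightarrow> (\<Sum>e\<in>E. G (h ` e)) = k"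
    and E: "finite E" "{a, a', a''} \<in> E"
      "\<And>e. e \<in> E \<Longrightarrow> e \<inter> A \<noteq> {} \<Longrightarrow> e \<inter> A' \<noteq> {} \<Longrightarrow> e \<inter> A'' \<noteq> {} \<Longrightarrow> e = {a, a', a''}"
    and s: "s a = b" "\<And>x. x \<notin> A \<Longrightarrow> s x = x" "s' a' = b'" "\<And>x. x \<notin> A' \<Longrightarrow> s' x = x"
      "s'' a'' = b''" "\<And>x. x \<notin> A'' \<Longrightarrow> s'' x = x"
      "A \<inter> A' = {}" "A \<inter> A'' = {}" "A' \<inter> A'' = {}" "{a, b} \<subseteq> A" "{a', b'} \<subseteq> A'" "{a'', b''} \<subseteq> A''"
      "s ` A = A" "s' ` A' = A'" "s'' ` A'' = A''"
  shows "G {a, a', a''} + G {b, a', a''} + G {a, b', a''} + G {b, b', a''}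
    + G {a, a', b''} + G {b, a', b''} + G {a, b', b''} + G {b, b', b''} = 0"
proof -
  let ?B = "\<lambda>e. G e + G (s ` e) + G (s' ` e) + G (s ` s' ` e)"
  let ?C = "\<lambda>e. ?B e + ?B (s'' ` e)"
  have B0: "?B e = 0" if "e \<inter> A = {} \<or> e \<inter> A' = {}" for e
    using that
  proof
    assume 1: "e \<inter> A = {}"
    have "s ` e = e" by (rule image_fixed_off[OF s(2) 1])
    moreover have "s ` s' ` e = s' ` e" by (rule image_fixed_off[OF s(2)], simp, rule image_avoids[OF s(4)]) (use s 1 in auto)
    ultimately show ?thesis by (simp add: cancel)
  next
    assume 2: "e \<inter> A' = {}"
    have "s' ` e = e" by (rule image_fixed_off[OF s(4) 2])
    then show ?thesis by (simp add: cancel)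
  qed
  have "?C e = 0" if e: "e \<in> E" "e \<noteq> {a, a', a''}" for e
  proof -
    consider "e \<inter> A = {} \<or> e \<inter> A' = {}" | "e \<inter> A'' = {}" using E(3) e by blast
    then show ?thesis
    proof cases
      case 1
      moreover have "s'' ` e \<inter> A = {} \<or> s'' ` e \<inter> A' = {}"
        using 1 image_avoids[OF s(6,15,8), of e] image_avoids[OF s(6,15,9), of e] by blast
      ultimately show ?thesis by (simp only: B0 two)
    next
      case 2
      have "s'' ` e = e" by (rule image_fixed_off[OF s(6) 2])
      then show ?thesis by (simp only: two)
    qed
  qed
  then have sum1: "(\<Sum>e\<in>E. ?C e) = ?C {a, a', a''}"
    using E(1,2) by (simp add: sum.remove[of E "{a, a', a''}"] sum.neutral)
  have "a \<notin> A'" "a' \<notin> A" "b \<notin> A'" "b' \<notin> A" "a \<notin> A''" "a' \<notin> A''" "b \<notin> A''" "b' \<notin> A''"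
    "a'' \<notin> A'" "a'' \<notin> A" "b'' \<notin> A'" "b'' \<notin> A" using s by auto
  then have sum2: "?C {a, a', a''} = G {a, a', a''} + G {b, a', a''} + G {a, b', a''} + G {b, b', a''}
    + G {a, a', b''} + G {b, a', b''} + G {a, b', b''} + G {b, b', b''}"
    using s by (simp add: ac_simps)
  have "(\<Sum>e\<in>E. ?C e) = (\<Sum>e\<in>E. G (id ` e)) + (\<Sum>e\<in>E. G (s ` e))
      + (\<Sum>e\<in>E. G (s' ` e)) + (\<Sum>e\<in>E. G ((s \<circ> s') ` e)) + ((\<Sum>e\<in>E. G (s'' ` e)) + (\<Sum>e\<in>E. G ((s \<circ> s'') ` e))
      + (\<Sum>e\<in>E. G ((s' \<circ> s'') ` e)) + (\<Sum>e\<in>E. G ((s \<circ> s' \<circ> s'') ` e)))"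
    by (simp add: sum.distrib image_comp o_assoc)
  also have "\<dots> = k + k + k + k + (k + k + k + k)"
    by (intro arg_cong2[where f = "(+)"] inv) auto
  also have "\<dots> = 0" by (simp add: two)
  finally show ?thesis unfolding sum1 sum2 .
qed

end


section \<open>Three-cycles and double transpositions\<close>

definition cyc :: "'p \<Rightarrow> 'p \<Rightarrow> 'p \<Rightarrow> 'p \<Rightarrow> 'p"
  where "cyc x y z w = (if w = x then y else if w = y then z else if w = z then x else w)"

lemma cyc_eq_transpose: "distinct [x, y, z] \<Longrightarrow> cyc x y z = transpose x y \<circ> transpose y z"
  by (auto simp: cyc_def fun_eq_iff transpose_def)

lemma cyc_in_alt:
  assumes "distinct [x, y, z]" "{x, y, z} \<subseteq> {1..n}"
  shows "cyc x y z \<in> carrier (alt_group n)"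
  using assms unfolding cyc_eq_transpose[OF assms(1)] alt_group_carrier
  by (auto simp: permutes_compose permutes_swap_id evenperm_comp evenperm_swap permutation_swap_id)

text \<open>A permutation with the prescribed values is built by transpositions. If it is odd, it is corrected
  by a transposition of two points that are not among the values.\<close>

lemma alt_group_transitive:
  assumes "distinct xs" "distinct ys" "set xs \<subseteq> {1..n}" "set ys \<subseteq> {1..n}"
    and "length xs = length ys" "length ys + 2 \<le> n"
  shows "\<exists>g\<in>carrier (alt_group n). map g xs = ys"
proof -
  have "\<exists>p. p permutes {1..n} \<and> map p xs = ys"
    using assms(5,1-4)
  proof (induction xs ys rule: list_induct2)
    case Nil
    then show ?case by (auto intro: exI[of _ id] permutes_id)
  next
    case (Cons x xs y ys)
    then obtain p where p: "p permutes {1..n}" "map p xs = ys" by auto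
    have "p x \<in> {1..n}" using p Cons.prems by (simp add: permutes_in_image del: atLeastAtMost_iff)
    then have perm: "(transpose (p x) y \<circ> p) permutes {1..n}"
      using Cons.prems p by (intro permutes_compose[of p] permutes_swap_id) auto
    have "map (transpose (p x) y \<circ> p) xs = map p xs"
    proof (intro map_cong refl)
      fix z assume z: "z \<in> set xs"
      then have "p z \<noteq> p x" using Cons.prems permutes_inj[OF p(1)] by (auto dest: injD)
      moreover have "p z \<noteq> y" using z p(2) Cons.prems by auto
      ultimately show "(transpose (p x) y \<circ> p) z = p z" by simp
    qed
    also note p(2)
    finally have "map (transpose (p x) y \<circ> p) xs = ys" .
    then have "map (transpose (p x) y \<circ> p) (x # xs) = y # ys"
      unfolding list.map o_apply transpose_apply_first by (rule arg_cong)
    with perm show ?case by (intro exI conjI)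
  qed
  then obtain p where p: "p permutes {1..n}" "map p xs = ys" by blast
  show ?thesis
  proof (cases "evenperm p")
    case True
    then show ?thesis using p by (auto simp: alt_group_carrier)
  next
    case False
    obtain u where u: "u \<in> {1..n}" "u \<notin> set ys" using fresh_point[of "{1..n}" ys] assms(6) by auto
    obtain v where v: "v \<in> {1..n}" "v \<notin> set (u # ys)" using fresh_point[of "{1..n}" "u # ys"] assms(6) by auto
    have "permutation p" using p(1) permutation_permutes by blast
    then have "evenperm (transpose u v \<circ> p)"
      using False v by (simp add: evenperm_comp permutation_swap_id evenperm_swap)
    moreover have "(transpose u v \<circ> p) permutes {1..n}"
      using u v p by (intro permutes_compose[of p] permutes_swap_id) auto
    moreover have "map (transpose u v \<circ> p) xs = map p xs"
      using u v p(2) by (intro map_cong refl) (auto simp: transpose_def)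
    ultimately show ?thesis using p(2)
      by (intro bexI[of _ "transpose u v \<circ> p"]) (simp_all only: alt_group_carrier mem_Collect_eq simp_thms)
  qed
qed


text \<open>Sets such as \<open>{1..n}\<close> shall keep their form under simplification.\<close>

declare One_nat_def [simp del]

definition cycles_on :: "'p set \<Rightarrow> ('p \<Rightarrow> 'p) set"
  where "cycles_on t = {cyc x y z | x y z. distinct [x, y, z] \<and> t = {x, y, z}}"

lemma cyc_rotate: "distinct [x, y, z] \<Longrightarrow> cyc x y z = cyc y z x"
  by (auto simp: cyc_def fun_eq_iff)

lemma cycles_on_triple:
  assumes "distinct [x, y, z]"
  shows "cycles_on {x, y, z} = {cyc x y z, cyc x z y}"
proof -
  have "cyc a b c \<in> {cyc x y z, cyc x z y}" if "distinct [a, b, c]" "{x, y, z} = {a, b, c}" for a b c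
  proof -
    have abc: "a \<in> {x, y, z}" "b \<in> {x, y, z}" "c \<in> {x, y, z}" using that(2) by auto
    have "cyc y z x = cyc x y z" "cyc z x y = cyc x y z" "cyc z y x = cyc x z y" "cyc y x z = cyc x z y"
      using assms by (auto simp: cyc_def fun_eq_iff)
    with abc that(1) show ?thesis by (elim insertE emptyE) simp_all
  qed
  moreover have "{x, y, z} = {x, z, y}" by auto
  then have "cyc x y z \<in> cycles_on {x, y, z}" "cyc x z y \<in> cycles_on {x, y, z}"
    using assms unfolding cycles_on_def by (auto intro!: exI) 
  ultimately show ?thesis unfolding cycles_on_def by blast
qed

lemma cycles_on_empty: "card t \<noteq> 3 \<Longrightarrow> cycles_on t = {}"
  by (auto simp: cycles_on_def)

lemma cyc_conj: "inj g \<Longrightarrow> g \<circ> cyc x y z = cyc (g x) (g y) (g z) \<circ> g"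
  by (auto simp: cyc_def fun_eq_iff dest: injD)

text \<open>The double transpositions on \<open>{a, b, c, d}\<close> are \<open>klein a b c d\<close>, \<open>klein a c b d\<close> and \<open>klein a d b c\<close>.\<close>

definition klein :: "'p \<Rightarrow> 'p \<Rightarrow> 'p \<Rightarrow> 'p \<Rightarrow> ('p \<Rightarrow> 'p)"
  where "klein a b c d = transpose a b \<circ> transpose c d"

lemma klein_commute: "distinct [a, b, c, d] \<Longrightarrow> klein a b c d = klein c d a b"
  by (auto simp: fun_eq_iff klein_def transpose_def)

text \<open>The four three-cycles in a coset of the Klein four-group, one for each triple.\<close>

lemma cyc_klein:
  assumes "distinct [a, b, c, d]"
  shows "cyc a b c \<circ> klein a b c d = cyc a c d" "cyc a b c \<circ> klein a c b d = cyc b d c"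
    "cyc a b c \<circ> klein a d b c = cyc a d b"
  using assms by (auto simp: fun_eq_iff cyc_def klein_def transpose_def)

lemma klein_in_alt:
  assumes "distinct [a, b, c, d]" "{a, b, c, d} \<subseteq> {1..n}"
  shows "klein a b c d \<in> carrier (alt_group n)"
  using assms unfolding klein_def alt_group_carrier
  by (auto simp: permutes_compose permutes_swap_id evenperm_comp evenperm_swap permutation_swap_id)

section \<open>Sums of three-cycles as operators\<close>

locale alt_module = group_rep "alt_group n" scale \<rho>
  for n :: nat and scale :: "'f::field \<Rightarrow> 'v::ab_group_add \<Rightarrow> 'v" and \<rho> +
  assumes two: "\<And>v::'v. v + v = 0" and n: "11 \<le> n"
    and irreducible: "\<And>W. invariant_subspace W \<Longrightarrow> W = {0} \<or> W = UNIV"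
begin

abbreviation A where "A \<equiv> carrier (alt_group n)"

lemma rho_comp: "g \<in> A \<Longrightarrow> h \<in> A \<Longrightarrow> \<rho> (g \<circ> h) v = \<rho> g (\<rho> h v)"
  using composition_rule[of v g h] by (simp add: alt_group_mult)

lemma comp_closed: "g \<in> A \<Longrightarrow> h \<in> A \<Longrightarrow> g \<circ> h \<in> A"
  using monoid.m_closed[OF group.is_monoid[OF alt_group_is_group], of g n h] by (simp add: alt_group_mult)

lemma id_closed: "id \<in> A"
  by (simp add: alt_group_carrier permutes_id)

lemma rho_id: "\<rho> id v = v"
  using id_eq_one by (simp add: alt_group_one fun_eq_iff)

lemma rho_hom:
  assumes "g \<in> A"
  shows rho_add: "\<rho> g (u + v) = \<rho> g u + \<rho> g v" and rho_scale: "\<rho> g (scale c v) = scale c (\<rho> g v)"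
proof -
  interpret l: Vector_Spaces.linear scale scale "\<rho> g" by (rule linear[OF assms])
  show "\<rho> g (u + v) = \<rho> g u + \<rho> g v" "\<rho> g (scale c v) = scale c (\<rho> g v)"
    by (simp_all add: l.add l.scale)
qed

lemma rho_zero: "g \<in> A \<Longrightarrow> \<rho> g 0 = 0"
  using rho_add[of g 0 0] by simp

lemma rho_sum: "g \<in> A \<Longrightarrow> \<rho> g (sum f S) = (\<Sum>x\<in>S. \<rho> g (f x))"
  by (induction S rule: infinite_finite_induct) (simp_all add: rho_zero rho_add)

lemma alt_inj: "g \<in> A \<Longrightarrow> inj g" and alt_image: "g \<in> A \<Longrightarrow> x \<in> {1..n} \<Longrightarrow> g x \<in> {1..n}"
  by (auto simp: alt_group_carrier permutes_inj permutes_in_image simp del: atLeastAtMost_iff)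

text \<open>Adding a three-cycle and its inverse makes the operator depend on the unordered triple only, which
  allows for summation over triangles of graphs. It is zero if \<open>t\<close> does not have three elements.\<close>

definition Phi :: "nat set \<Rightarrow> 'v \<Rightarrow> 'v"
  where "Phi t v = (\<Sum>g\<in>cycles_on t. \<rho> g v)"

lemma Phi_triple: "distinct [x, y, z] \<Longrightarrow> Phi {x, y, z} v = \<rho> (cyc x y z) v + \<rho> (cyc x z y) v"
proof -
  assume d: "distinct [x, y, z]"
  then have "cyc x y z x \<noteq> cyc x z y x" by (auto simp: cyc_def)
  then have "cyc x y z \<noteq> cyc x z y" by metis
  then show ?thesis unfolding Phi_def cycles_on_triple[OF d] by simp
qed

lemma Phi_small: "card t \<noteq> 3 \<Longrightarrow> Phi t v = 0"
  by (simp add: Phi_def cycles_on_empty)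

lemma cycles_on_alt: "t \<subseteq> {1..n} \<Longrightarrow> cycles_on t \<subseteq> A"
  by (auto simp only: cycles_on_def intro!: cyc_in_alt)

lemma Phi_linear:
  assumes "t \<subseteq> {1..n}"
  shows Phi_add: "Phi t (u + v) = Phi t u + Phi t v" and Phi_scale: "Phi t (scale c v) = scale c (Phi t v)"
proof -
  have g: "g \<in> A" if "g \<in> cycles_on t" for g using cycles_on_alt[OF assms] that by blast
  show "Phi t (u + v) = Phi t u + Phi t v" "Phi t (scale c v) = scale c (Phi t v)"
    by (simp_all add: Phi_def g rho_add rho_scale sum.distrib scale_sum_right)
qed

lemma Phi_zero: "t \<subseteq> {1..n} \<Longrightarrow> Phi t 0 = 0"
  using Phi_add[of t 0 0] by simp

lemma Phi_equivariant:
  assumes h: "h \<in> A" and t: "t \<subseteq> {1..n}"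
  shows "\<rho> h (Phi t v) = Phi (h ` t) (\<rho> h v)"
proof (cases "card t = 3")
  case True
  then obtain x y z where t': "t = {x, y, z}" "distinct [x, y, z]" by (auto simp: card_3_iff)
  have d: "distinct [h x, h y, h z]" using t'(2) alt_inj[OF h] by (auto dest: injD)
  have move: "\<rho> h (\<rho> (cyc x y z) v) = \<rho> (cyc (h x) (h y) (h z)) (\<rho> h v)"
    if d: "distinct [x, y, z]" and sub: "{x, y, z} \<subseteq> {1..n}" for x y z
  proof -
    have "distinct [h x, h y, h z]" using d alt_inj[OF h] by (auto dest: injD)
    moreover have "{h x, h y, h z} \<subseteq> {1..n}" using sub alt_image[OF h] by blast
    ultimately have "cyc x y z \<in> A" "cyc (h x) (h y) (h z) \<in> A" using d sub by (auto intro!: cyc_in_alt)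
    then show ?thesis
      using h by (simp only: rho_comp[symmetric] cyc_conj[OF alt_inj[OF h]])
  qed
  have d': "distinct [x, z, y]" "{x, z, y} \<subseteq> {1..n}" using t' t by auto
  show ?thesis
    using move[OF t'(2)] move[OF d'] t t' d h by (simp only: Phi_triple[OF t'(2)] Phi_triple[OF d] rho_add image_insert image_empty)
next
  case False
  moreover have "card (h ` t) = card t" by (rule card_image) (use alt_inj[OF h] in \<open>auto intro: inj_on_subset\<close>)
  ultimately show ?thesis using h by (simp add: Phi_small rho_zero)
qed

sublocale cochain: char_two_cochain "{1..n}" "\<lambda>t. Phi t v" for v
  using two n by unfold_locales auto

definition klein_sum :: "nat \<Rightarrow> nat \<Rightarrow> nat \<Rightarrow> nat \<Rightarrow> 'v \<Rightarrow> 'v"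
  where "klein_sum a b c d v = v + \<rho> (klein a b c d) v + \<rho> (klein a c b d) v + \<rho> (klein a d b c) v"

lemma cyc_klein_sum:
  assumes "distinct [a, b, c, d]" "{a, b, c, d} \<subseteq> {1..n}"
  shows "\<rho> (cyc a b c) (klein_sum a b c d v)
    = \<rho> (cyc a b c) v + \<rho> (cyc a c d) v + \<rho> (cyc b d c) v + \<rho> (cyc a d b) v"
proof -
  have "cyc a b c \<in> A" by (rule cyc_in_alt) (use assms in auto)
  moreover have "klein a b c d \<in> A" by (rule klein_in_alt) (use assms in auto)
  moreover have "klein a c b d \<in> A" by (rule klein_in_alt) (use assms in auto)
  moreover have "klein a d b c \<in> A" by (rule klein_in_alt) (use assms in auto)
  ultimately show ?thesis
    by (simp only: klein_sum_def rho_add rho_comp[symmetric] cyc_klein[OF assms(1)])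
qed

lemma cyc_square: "distinct [a, b, c] \<Longrightarrow> cyc a b c \<circ> cyc a b c = cyc a c b"
  by (auto simp: cyc_def fun_eq_iff)

lemma cyc_inverse: "distinct [a, b, c] \<Longrightarrow> cyc a b c \<circ> cyc a c b = id"
  by (auto simp: cyc_def fun_eq_iff)

text \<open>The eight three-cycles on \<open>{a, b, c, d}\<close> form the two nontrivial cosets of the Klein four-group.\<close>

lemma tetra_klein:
  assumes d: "distinct [a, b, c, d]" "{a, b, c, d} \<subseteq> {1..n}"
  shows "cochain.tetra v a b c d = \<rho> (cyc a b c) (klein_sum a b c d v) + \<rho> (cyc a c b) (klein_sum a b c d v)"
proof -
  have k: "klein_sum a c b d v = klein_sum a b c d v"
    by (simp only: klein_sum_def transpose_commute[of c b] klein_def ac_simps)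
  have "\<rho> (cyc a c b) (klein_sum a b c d v)
      = \<rho> (cyc a c b) v + \<rho> (cyc a b d) v + \<rho> (cyc b c d) v + \<rho> (cyc a d c) v"
    using d cyc_klein_sum[of a c b d v] cyc_rotate[of b c d] cyc_rotate[of c d b] by (simp add: k insert_commute)
  then show ?thesis
    using d cyc_klein_sum[OF d, of v] by (simp add: cochain.tetra_def Phi_triple ac_simps)
qed




lemma rho_cyc:
  assumes d: "distinct [a, b, c]" "{a, b, c} \<subseteq> {1..n}"
  shows "\<rho> (cyc a b c) (\<rho> (cyc a b c) v) = \<rho> (cyc a c b) v" "\<rho> (cyc a b c) (\<rho> (cyc a c b) v) = v"
proof -
  have A: "cyc a b c \<in> A" by (rule cyc_in_alt) (use d in auto)
  have A': "cyc a c b \<in> A" by (rule cyc_in_alt) (use d in auto)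
  show "\<rho> (cyc a b c) (\<rho> (cyc a b c) v) = \<rho> (cyc a c b) v"
    by (simp only: rho_comp[OF A A, symmetric] cyc_square[OF d(1)])
  show "\<rho> (cyc a b c) (\<rho> (cyc a c b) v) = v"
    by (simp only: rho_comp[OF A A', symmetric] cyc_inverse[OF d(1)] rho_id)
qed

text \<open>Multiplication by \<open>cyc a b c\<close> permutes the cosets of the Klein four-group cyclically. In the product of
  \<open>Phi {a, b, c}\<close> with the sum of the nontrivial cosets the trivial coset occurs twice and each of the
  others once.\<close>

lemma Phi_tetra:
  assumes d: "distinct [a, b, c, d]" "{a, b, c, d} \<subseteq> {1..n}"
  shows "Phi {a, b, c} (cochain.tetra v a b c d) = cochain.tetra v a b c d"
proof -
  have d1: "distinct [a, b, c]" "{a, b, c} \<subseteq> {1..n}" and d2: "distinct [a, c, b]" "{a, c, b} \<subseteq> {1..n}"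
    using d by auto
  show ?thesis
    unfolding tetra_klein[OF d] Phi_triple[OF d1(1)] rho_add[OF cyc_in_alt[OF d1]] rho_add[OF cyc_in_alt[OF d2]]
      rho_cyc[OF d1] rho_cyc[OF d2]
    by (simp only: cochain.cancel)
qed

lemma Phi_tetra_all:
  assumes d: "distinct [a, b, c, d]" "{a, b, c, d} \<subseteq> {1..n}"
  shows "Phi {a, b, c} (cochain.tetra v a b c d) = cochain.tetra v a b c d"
    "Phi {a, b, d} (cochain.tetra v a b c d) = cochain.tetra v a b c d"
    "Phi {a, c, d} (cochain.tetra v a b c d) = cochain.tetra v a b c d"
    "Phi {b, c, d} (cochain.tetra v a b c d) = cochain.tetra v a b c d"
proof -
  have p: "cochain.tetra v a b d c = cochain.tetra v a b c d" "cochain.tetra v a c d b = cochain.tetra v a b c d"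
    "cochain.tetra v b c d a = cochain.tetra v a b c d"
    unfolding cochain.tetra_def by (simp_all add: ac_simps insert_commute)
  show "Phi {a, b, c} (cochain.tetra v a b c d) = cochain.tetra v a b c d" using d by (rule Phi_tetra)
  show "Phi {a, b, d} (cochain.tetra v a b c d) = cochain.tetra v a b c d"
    unfolding p(1)[symmetric] by (rule Phi_tetra) (use d in auto)
  show "Phi {a, c, d} (cochain.tetra v a b c d) = cochain.tetra v a b c d"
    unfolding p(2)[symmetric] by (rule Phi_tetra) (use d in auto)
  show "Phi {b, c, d} (cochain.tetra v a b c d) = cochain.tetra v a b c d"
    unfolding p(3)[symmetric] by (rule Phi_tetra) (use d in auto)
qed

text \<open>Each of the four faces fixes the vector, and four equal terms cancel.\<close>

lemma tetra_tetra:
  assumes d: "distinct [a, b, c, d]" "{a, b, c, d} \<subseteq> {1..n}"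
  shows "cochain.tetra (cochain.tetra v a b c d) a b c d = 0"
  unfolding cochain.tetra_def[of "cochain.tetra v a b c d"] Phi_tetra_all[OF d]
  by (simp only: cochain.cancel)

lemma tetra_linear:
  assumes "{a, b, c, d} \<subseteq> {1..n}"
  shows "cochain.tetra (u + v) a b c d = cochain.tetra u a b c d + cochain.tetra v a b c d"
    and "cochain.tetra (scale r v) a b c d = scale r (cochain.tetra v a b c d)"
  using assms by (simp_all add: cochain.tetra_def Phi_add Phi_scale ac_simps scale_right_distrib)

lemma tetra_equivariant:
  assumes "h \<in> A" "{a, b, c, d} \<subseteq> {1..n}"
  shows "\<rho> h (cochain.tetra v a b c d) = cochain.tetra (\<rho> h v) (h a) (h b) (h c) (h d)"
  using assms by (simp add: cochain.tetra_def rho_add Phi_equivariant)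

lemma three_more:
  assumes "length xs < 9"
  obtains a b c where "distinct [a, b, c]" "{a, b, c} \<subseteq> {1..n}" "{a, b, c} \<inter> set xs = {}"
proof -
  obtain a where a: "a \<in> {1..n}" "a \<notin> set xs" using cochain.fresh[of xs] assms by auto
  obtain b where b: "b \<in> {1..n}" "b \<notin> set (a # xs)" using cochain.fresh[of "a # xs"] assms by auto
  obtain c where c: "c \<in> {1..n}" "c \<notin> set (a # b # xs)" using cochain.fresh[of "a # b # xs"] assms by auto
  show ?thesis by (rule that[of a b c]) (use a b c in auto)
qed

section \<open>Octahedral modules are cocycle modules\<close>

context
  assumes oct: "\<And>v. cochain.octahedral v"
begin

text \<open>The tips of a bipyramid as an operator on the module.\<close>

definition tip :: "'v \<Rightarrow> nat \<Rightarrow> nat \<Rightarrow> 'v"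
  where "tip v d e = cochain.apex v d e"

lemmas tetra_tip = cochain.apex[OF oct, folded tip_def]
lemmas tip_cocycle = cochain.apex_cocycle[OF oct, folded tip_def]
lemmas tip_commute = cochain.apex_commute[OF oct, folded tip_def]
lemmas tetra_eq_tip = cochain.tetra_eq_apex[OF oct, folded tip_def]

lemma tip_linear:
  assumes d: "d \<noteq> e" "d \<in> {1..n}" "e \<in> {1..n}"
  shows tip_add: "tip (u + v) d e = tip u d e + tip v d e"
    and tip_scale: "tip (scale r v) d e = scale r (tip v d e)"
    and tip_equivariant: "h \<in> A \<Longrightarrow> \<rho> h (tip v d e) = tip (\<rho> h v) (h d) (h e)"
proof -
  obtain a b c where abc: "distinct [a, b, c]" "{a, b, c} \<subseteq> {1..n}" "{a, b, c} \<inter> set [d, e] = {}"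
    by (rule three_more[of "[d, e]"]) simp
  have dd: "distinct [a, b, c, d, e]" "{a, b, c, d, e} \<subseteq> {1..n}" using d abc by auto
  note ap = tetra_tip[OF dd, symmetric]
  have sub: "{a, b, c, d} \<subseteq> {1..n}" "{a, b, c, e} \<subseteq> {1..n}" using dd by auto
  show "tip (u + v) d e = tip u d e + tip v d e"
    unfolding ap tetra_linear[OF sub(1)] tetra_linear[OF sub(2)] by (simp add: ac_simps)
  show "tip (scale r v) d e = scale r (tip v d e)"
    unfolding ap tetra_linear[OF sub(1)] tetra_linear[OF sub(2)] by (simp add: scale_right_distrib)
  assume h: "h \<in> A"
  have hd: "distinct [h a, h b, h c, h d, h e]" "{h a, h b, h c, h d, h e} \<subseteq> {1..n}"
    using dd alt_inj[OF h] alt_image[OF h] by (auto dest: injD simp del: atLeastAtMost_iff)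
  show "\<rho> h (tip v d e) = tip (\<rho> h v) (h d) (h e)"
    unfolding ap tetra_tip[OF hd, symmetric] rho_add[OF h]
      tetra_equivariant[OF h sub(1)] tetra_equivariant[OF h sub(2)] ..
qed

lemma tip_zero: "d \<noteq> e \<Longrightarrow> d \<in> {1..n} \<Longrightarrow> e \<in> {1..n} \<Longrightarrow> tip 0 d e = 0"
  using tip_add[of d e 0 0] by simp

text \<open>The bipyramid may be based on the triangle \<open>abc\<close>, and \<open>Phi {a, b, c}\<close> fixes both of its tetrahedra.\<close>

lemma Phi_tip:
  assumes d: "distinct [a, b, c, d, e]" "{a, b, c, d, e} \<subseteq> {1..n}"
  shows "Phi {a, b, c} (tip v d e) = tip v d e"
proof -
  have d1: "distinct [a, b, c, d]" "{a, b, c, d} \<subseteq> {1..n}" and d2: "distinct [a, b, c, e]" "{a, b, c, e} \<subseteq> {1..n}"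
    and d3: "{a, b, c} \<subseteq> {1..n}"
    using d by auto
  show ?thesis
    unfolding tetra_tip[OF d, symmetric] Phi_add[OF d3] Phi_tetra[OF d1] Phi_tetra[OF d2] ..
qed

text \<open>Faces that avoid \<open>d\<close> and \<open>e\<close> fix \<open>tip v d e\<close>, so every tetrahedron that avoids \<open>d\<close> and \<open>e\<close> kills it.
  Hence \<open>tip (tip v d e) a b\<close> takes the same value on disjoint pairs, thus on all pairs, and the
  additivity of \<open>tip\<close> leaves only zero.\<close>

lemma tip_tip_disjoint:
  assumes d: "distinct [a, b, d, e]" "{a, b, d, e} \<subseteq> {1..n}"
  shows "tip (tip v d e) a b = 0"
proof -
  let ?u = "tip v d e"
  \<comment> \<open>The tetrahedron \<open>abcf\<close> kills \<open>?u\<close>, and it is the sum of the two sides.\<close>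
  have eq: "tip ?u a b = tip ?u c f"
    if "distinct [a, b, c, f, d, e]" "{a, b, c, f, d, e} \<subseteq> {1..n}" for a b c f
  proof -
    have "Phi {a, b, c} ?u = ?u" "Phi {a, b, f} ?u = ?u" "Phi {a, c, f} ?u = ?u" "Phi {b, c, f} ?u = ?u"
      by (rule Phi_tip; use that in auto)+
    then have "cochain.tetra ?u a b c f = 0"
      by (simp only: cochain.tetra_def cochain.cancel)
    moreover have "cochain.tetra ?u a b c f = tip ?u a b + tip ?u c f"
      by (rule tetra_eq_tip) (use that in auto)
    ultimately show ?thesis by (metis cochain.eq_iff_add)
  qed
  obtain c f g where cfg: "distinct [c, f, g]" "{c, f, g} \<subseteq> {1..n}" "{c, f, g} \<inter> set [a, b, d, e] = {}"
    by (rule three_more[of "[a, b, d, e]"]) simp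
  have "tip ?u a b = tip ?u f g" by (rule eq) (use d cfg in auto)
  moreover have "tip ?u b c = tip ?u f g" by (rule eq) (use d cfg in auto)
  moreover have "tip ?u a c = tip ?u f g" by (rule eq) (use d cfg in auto)
  moreover have "tip ?u a b + tip ?u b c = tip ?u a c"
    by (rule tip_cocycle) (use d cfg in auto)
  ultimately show ?thesis by simp
qed

text \<open>Expand the square of the tetrahedron, which is zero; the mixed terms vanish.\<close>

lemma tip_square:
  assumes d: "distinct [a, b, c, d]" "{a, b, c, d} \<subseteq> {1..n}"
  shows "tip (tip v a b) a b = tip (tip v c d) c d"
proof -
  let ?u = "tip v a b + tip v c d"
  have eq: "cochain.tetra v a b c d = ?u" by (rule tetra_eq_tip[OF d])
  have z: "tip (tip v c d) a b = 0" "tip (tip v a b) c d = 0"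
    by (rule tip_tip_disjoint; use d in auto)+
  have "0 = tip ?u a b + tip ?u c d"
    using tetra_tetra[OF d, of v] unfolding eq tetra_eq_tip[OF d] ..
  also have "\<dots> = tip (tip v a b) a b + tip (tip v c d) a b
      + (tip (tip v a b) c d + tip (tip v c d) c d)"
    by (intro arg_cong2[where f = "(+)"] tip_add) (use d in auto)
  finally have "0 = tip (tip v a b) a b + tip (tip v c d) c d"
    by (simp only: z add_0_left add_0_right)
  then show ?thesis by (rule cochain.eq_iff_add[THEN iffD2, OF sym])
qed

definition "tip_kernel = {v. \<forall>d\<in>{1..n}. \<forall>e\<in>{1..n}. d \<noteq> e \<longrightarrow> tip v d e = 0}"

lemma tip_kernel_invariant: "invariant_subspace tip_kernel"
  unfolding invariant_subspace_def
proof (intro conjI ballI)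
  show "subspace tip_kernel"
    by (rule subspaceI) (auto simp: tip_kernel_def tip_zero tip_add tip_scale)
  fix g w assume g: "g \<in> A" and w: "w \<in> tip_kernel"
  show "\<rho> g w \<in> tip_kernel"
    unfolding tip_kernel_def mem_Collect_eq
  proof (intro ballI impI)
    fix d e assume de: "d \<in> {1..n}" "e \<in> {1..n}" "d \<noteq> e"
    have gp: "g permutes {1..n}" using g by (simp add: alt_group_carrier)
    obtain d' e' where d': "d = g d'" "e = g e'" using permutes_surj[OF gp] by (metis surjD)
    then have "d' \<in> {1..n}" "e' \<in> {1..n}" "d' \<noteq> e'" using de permutes_in_image[OF gp] by auto
    then show "tip (\<rho> g w) d e = 0"
      using w g by (simp add: d' tip_equivariant[symmetric] rho_zero tip_kernel_def)
  qed
qed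

text \<open>Let \<open>s = tip (tip v d e) a d\<close>. It does not depend on \<open>a\<close>, since the operators of disjoint pairs
  annihilate each other. Given a pair \<open>{x, y}\<close> without \<open>d\<close>, one may therefore choose \<open>a\<close> outside of it,
  and \<open>tip s x y\<close> vanishes as a product for disjoint pairs. For a pair \<open>{x, d}\<close> choose \<open>a = x\<close> and exchange the
  square for the square of a pair disjoint from \<open>d\<close> and \<open>e\<close>. The pair \<open>{d, e}\<close> follows by additivity.\<close>

lemma tip_tip_in_kernel:
  assumes d: "distinct [a, d, e]" "{a, d, e} \<subseteq> {1..n}"
  shows "tip (tip v d e) a d \<in> tip_kernel"
proof -
  let ?u = "tip v d e"
  have indep: "tip ?u a d = tip ?u a' d" if "a' \<in> {1..n}" "a' \<notin> {d, e}" for a'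
  proof (cases "a' = a")
    case False
    have "tip ?u a a' + tip ?u a' d = tip ?u a d"
      by (rule tip_cocycle) (use d that False in auto)
    moreover have "tip ?u a a' = 0"
      by (rule tip_tip_disjoint) (use d that False in auto)
    ultimately show ?thesis by simp
  qed simp
  let ?s = "tip ?u a d"
  \<comment> \<open>Pairs that avoid \<open>d\<close>, among them those that contain \<open>e\<close>.\<close>
  have off: "tip ?s x y = 0" if "x \<in> {1..n}" "y \<in> {1..n}" "x \<noteq> y" "x \<noteq> d" "y \<noteq> d" for x y
  proof -
    obtain a' where a': "a' \<in> {1..n}" "a' \<notin> set [x, y, d, e]" using cochain.fresh[of "[x, y, d, e]"] by auto
    have "tip (tip ?u a' d) x y = 0"
      by (rule tip_tip_disjoint) (use a' that d in auto)
    then show ?thesis using indep[of a'] a' by simp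
  qed
  have at': "tip ?s x d = 0" if x: "x \<in> {1..n}" "x \<notin> {d, e}" for x
  proof -
    obtain p q r where pq: "distinct [p, q, r]" "{p, q, r} \<subseteq> {1..n}" "{p, q, r} \<inter> set [x, d, e] = {}"
      by (rule three_more[of "[x, d, e]"]) simp
    have z: "tip ?u p q = 0"
      by (rule tip_tip_disjoint) (use pq x d in auto)
    have "tip ?s x d = tip (tip ?u x d) x d" unfolding indep[OF x] ..
    also have "\<dots> = tip (tip ?u p q) p q"
      by (rule tip_square) (use pq x d in auto)
    also have "\<dots> = 0"
      unfolding z by (rule tip_zero) (use pq in auto)
    finally show ?thesis .
  qed
  have at: "tip ?s x d = 0" if x: "x \<in> {1..n}" "x \<noteq> d" for x
  proof (cases "x = e")
    case True
    obtain y where y: "y \<in> {1..n}" "y \<notin> set [d, e]" using cochain.fresh[of "[d, e]"] by auto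
    have "tip ?s e y + tip ?s y d = tip ?s e d"
      by (rule tip_cocycle) (use d y in auto)
    then show ?thesis using off[of e y] at'[of y] y d True by auto
  qed (use at' x in auto)
  have "tip ?s d x = 0" if "x \<in> {1..n}" "x \<noteq> d" for x
    using at[OF that] tip_commute[of x d ?s] that d by auto
  then show ?thesis
    using off at unfolding tip_kernel_def by auto metis
qed

text \<open>The common kernel of these operators is invariant. If it were zero, then by the previous lemma all
  products of two of them, and then the operators themselves, would be zero.\<close>

lemma tip_vanishes:
  assumes d: "d \<noteq> e" "d \<in> {1..n}" "e \<in> {1..n}"
  shows "tip v d e = 0"
proof -
  consider "tip_kernel = {0}" | "tip_kernel = UNIV"
    using irreducible[OF tip_kernel_invariant] by blast
  then show ?thesis
  proof cases
    case 1
    have zero: "tip (tip v d e) a d = 0" if "distinct [a, d, e]" "{a, d, e} \<subseteq> {1..n}" for a d e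
      using tip_tip_in_kernel[OF that] 1 by auto
    let ?u = "tip v d e"
    have c: "tip v d e = tip v e d" using d by (intro tip_commute)
    have ad: "tip ?u a d = 0" "tip ?u a e = 0" if "a \<in> {1..n}" "a \<notin> {d, e}" for a
      using zero[of a d e] zero[of a e d] that d c by auto
    obtain x where x: "x \<in> {1..n}" "x \<notin> set [d, e]" using cochain.fresh[of "[d, e]"] by auto
    have sym: "tip ?u p q = tip ?u q p" if "p \<in> {1..n}" "q \<in> {1..n}" "p \<noteq> q" for p q
      using that by (intro tip_commute)
    have "tip ?u d x + tip ?u x e = tip ?u d e"
      by (rule tip_cocycle) (use d x in auto)
    then have de: "tip ?u d e = 0" using ad[of x] x d sym[of d x] by auto
    have "tip ?u p q = 0" if p: "p \<in> {1..n}" "q \<in> {1..n}" "p \<noteq> q" for p q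
    proof -
      consider "p \<notin> {d, e}" "q \<notin> {d, e}" | "p \<in> {d, e}" "q \<notin> {d, e}" | "p \<notin> {d, e}" "q \<in> {d, e}" | "{p, q} = {d, e}"
        using p by blast
      then show ?thesis
      proof cases
        case 1
        then show ?thesis by (intro tip_tip_disjoint) (use d p in auto)
      next
        case 4
        then show ?thesis using de sym[OF p] p by (auto simp: doubleton_eq_iff)
      qed (use ad[of p] ad[of q] sym[OF p] p in auto)
    qed
    then have "?u \<in> tip_kernel" by (auto simp: tip_kernel_def)
    then show ?thesis using 1 by blast
  next
    case 2
    then have "v \<in> tip_kernel" by simp
    then show ?thesis using d by (simp add: tip_kernel_def)
  qed
qed

lemma tetra_vanishes:
  assumes d: "distinct [a, b, c, d]" "{a, b, c, d} \<subseteq> {1..n}"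
  shows "cochain.tetra v a b c d = 0"
  using tetra_eq_tip[OF d] tip_vanishes[of a b] tip_vanishes[of c d] d by simp

end

end


section \<open>Eigenvectors, trivial actions and even graphs\<close>

text \<open>In finite dimension some nonzero polynomial in \<open>T\<close> kills \<open>v\<close>. Consider a nonzero polynomial of minimal
  degree which in this way kills some nonzero vector \<open>u\<close>, and split off a linear factor: the cofactor
  does not kill \<open>u\<close>, and it maps \<open>u\<close> to an eigenvector.\<close>

lemma eigenvector_exists:
  fixes scale :: "'f::alg_closed_field \<Rightarrow> 'v::ab_group_add \<Rightarrow> 'v"
  assumes vs: "vector_space scale" and lin: "Vector_Spaces.linear scale scale T"
    and B: "finite B" "module.span scale B = UNIV" and v: "(v :: 'v) \<noteq> 0"
  shows "\<exists>c u. u \<noteq> 0 \<and> T u = scale c u"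
proof -
  interpret vector_space scale by (rule vs)
  interpret l: Vector_Spaces.linear scale scale T by (rule lin)
  define ev where "ev p u = (\<Sum>i\<le>degree p. scale (coeff p i) ((T ^^ i) u))" for p u
  have ev_bound: "ev p u = (\<Sum>i\<le>N. scale (coeff p i) ((T ^^ i) u))" if "degree p \<le> N" for p u N
    unfolding ev_def using that by (intro sum.mono_neutral_left) (auto simp: coeff_eq_0)
  have ev_factor: "ev ([:- r, 1:] * q) u = T (ev q u) - scale r (ev q u)" for r q u
  proof -
    let ?N = "Suc (degree q)"
    have "degree ([:- r, 1:] * q) \<le> ?N"
      using degree_mult_le[of "[:- r, 1:]" q] by simp
    then have "ev ([:- r, 1:] * q) u = (\<Sum>i\<le>?N. scale (coeff ([:- r, 1:] * q) i) ((T ^^ i) u))"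
      by (rule ev_bound)
    also have "\<dots> = (\<Sum>i\<le>?N. scale (coeff (pCons 0 q) i) ((T ^^ i) u)) - (\<Sum>i\<le>?N. scale (r * coeff q i) ((T ^^ i) u))"
      by (simp add: sum_subtractf[symmetric] algebra_simps del: sum.atMost_Suc)
    also have "(\<Sum>i\<le>?N. scale (coeff (pCons 0 q) i) ((T ^^ i) u)) = (\<Sum>i\<le>degree q. scale (coeff q i) (T ((T ^^ i) u)))"
      by (subst sum.atMost_Suc_shift) simp
    also have "\<dots> = T (ev q u)" by (simp add: ev_def l.sum l.scale)
    also have "(\<Sum>i\<le>?N. scale (r * coeff q i) ((T ^^ i) u)) = scale r (ev q u)"
      by (subst ev_bound[of q ?N]) (simp_all add: scale_sum_right del: sum.atMost_Suc)
    finally show ?thesis .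
  qed
  have "\<exists>p. p \<noteq> 0 \<and> ev p v = 0"
  proof -
    let ?N = "card B" and ?f = "\<lambda>i. (T ^^ i) v"
    have "\<exists>c. (\<exists>i\<le>?N. c i \<noteq> 0) \<and> (\<Sum>i\<le>?N. scale (c i) (?f i)) = 0"
    proof (cases "inj_on ?f {..?N}")
      case True
      have "dependent (?f ` {..?N})"
        using independent_span_bound[OF B(1), of "?f ` {..?N}"] card_image[OF True] B(2) by auto
      then obtain u where u: "\<exists>w\<in>?f ` {..?N}. u w \<noteq> 0" "(\<Sum>w\<in>?f ` {..?N}. scale (u w) w) = 0"
        by (auto simp: dependent_finite)
      then show ?thesis by (intro exI[of _ "\<lambda>i. u (?f i)"]) (auto simp: sum.reindex[OF True])
    next
      case False
      then obtain i j where ij: "i \<le> ?N" "j \<le> ?N" "i \<noteq> j" "?f i = ?f j" by (auto simp: inj_on_def)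
      let ?c = "\<lambda>l. if l = i then 1 else if l = j then - 1 else (0::'f)"
      have "(\<Sum>l\<le>?N. scale (?c l) (?f l)) = (\<Sum>l\<in>{i, j}. scale (?c l) (?f l))"
        using ij by (intro sum.mono_neutral_right) auto
      also have "\<dots> = 0" using ij by simp
      finally show ?thesis using ij by (intro exI[of _ ?c]) auto
    qed
    then obtain c i where c: "i \<le> ?N" "c i \<noteq> 0" "(\<Sum>i\<le>?N. scale (c i) (?f i)) = 0" by blast
    define p where "p = (\<Sum>i\<le>?N. monom (c i) i)"
    have co: "coeff p j = (if j \<le> ?N then c j else 0)" for j
      by (simp add: p_def coeff_sum)
    have "degree p \<le> ?N" by (rule degree_le) (simp add: co)
    then have "ev p v = 0" using c(3) by (simp add: ev_bound co)
    moreover have "p \<noteq> 0" using co[of i] c by auto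
    ultimately show ?thesis by blast
  qed
  then have "\<exists>d p u. p \<noteq> 0 \<and> degree p = d \<and> u \<noteq> 0 \<and> ev p u = 0" using v by blast
  then obtain p u where p: "p \<noteq> 0" "u \<noteq> 0" "ev p u = 0"
    and min: "\<And>q w. q \<noteq> 0 \<Longrightarrow> degree q < degree p \<Longrightarrow> w \<noteq> 0 \<Longrightarrow> ev q w \<noteq> 0"
    using exists_least_iff[of "\<lambda>d. \<exists>p u. p \<noteq> 0 \<and> degree p = d \<and> u \<noteq> 0 \<and> ev p u = 0"] by metis
  \<comment> \<open>A nonzero constant does not kill \<open>u\<close>.\<close>
  have "degree p \<noteq> 0"
  proof
    assume d: "degree p = 0"
    then have "scale (coeff p 0) u = 0" using p(3) by (simp add: ev_def)
    moreover have "coeff p 0 \<noteq> 0" using d p(1) by (metis leading_coeff_0_iff)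
    ultimately show False using p(2) by (simp add: scale_eq_0_iff)
  qed
  then obtain r where "poly p r = 0" using alg_closed_imp_poly_has_root[of p] by auto
  then obtain q where q: "p = [:- r, 1:] * q" by (auto simp: poly_eq_0_iff_dvd)
  then have "q \<noteq> 0" using p(1) by auto
  then have "degree q < degree p" unfolding q by (subst degree_mult_eq) auto
  with \<open>q \<noteq> 0\<close> min p(2) have "ev q u \<noteq> 0" by blast
  moreover have "T (ev q u) = scale r (ev q u)" using p(3) unfolding q ev_factor by simp
  ultimately show ?thesis by blast
qed


lemma klein_conj: "inj g \<Longrightarrow> g \<circ> klein a b c d = klein (g a) (g b) (g c) (g d) \<circ> g"
  by (auto simp: klein_def fun_eq_iff transpose_def dest: injD)

lemma klein_klein:
  assumes d: "distinct [a, b, c, d, e]"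
  shows "klein a b c d \<circ> klein a b c e = cyc d c e"
proof -
  have "klein a b c d \<circ> klein a b c e = klein c d a b \<circ> klein a b c e"
    using d klein_commute[of a b c d] by simp
  also have "\<dots> = transpose d c \<circ> transpose c e"
    by (simp add: klein_def fun_eq_iff transpose_commute)
  also have "\<dots> = cyc d c e" using d cyc_eq_transpose[of d c e] by auto
  finally show ?thesis .
qed

lemma cyc_eq_cycle_of_list: "distinct [x, y, z] \<Longrightarrow> cycle_of_list [x, y, z] = cyc x y z"
  by (simp add: cyc_eq_transpose)

lemma three_cycle_is_cyc:
  assumes "c \<in> three_cycles n"
  obtains x y z where "distinct [x, y, z]" "{x, y, z} \<subseteq> {1..n}" "c = cyc x y z"
proof -
  obtain cs where cs: "c = cycle_of_list cs" "distinct cs" "length cs = 3" "set cs \<subseteq> {1..n}" using assms by blast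
  then obtain x y z where xyz: "cs = [x, y, z]" by (auto simp: length_Suc_conv numeral_3_eq_3)
  have "c = cyc x y z" using cs(1,2) unfolding xyz by (simp only: cyc_eq_cycle_of_list)
  then show ?thesis using that[of x y z] cs(2,4) unfolding xyz by auto
qed

lemma finite_alt_group: "finite (carrier (alt_group n))"
  by (rule finite_subset[OF _ finite_permutations[of "{1..n}"]]) (auto simp: alt_group_carrier)

context alt_module
begin

lemma rho_surj: "h \<in> A \<Longrightarrow> \<exists>u. \<rho> h u = v"
  using bij_prop0[of h] by (metis Bij_def Int_iff bij_betw_def mem_Collect_eq rangeE UNIV_I)

lemma rho_inj: "h \<in> A \<Longrightarrow> \<rho> h u = \<rho> h v \<Longrightarrow> u = v"
  using bij_prop0[of h] by (auto simp: Bij_def bij_betw_def dest: injD)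

text \<open>The alternating group is generated by its three-cycles.\<close>

lemma trivial_action:
  assumes "\<And>x y z v. distinct [x, y, z] \<Longrightarrow> {x, y, z} \<subseteq> {1..n} \<Longrightarrow> \<rho> (cyc x y z) v = v" and g: "g \<in> A"
  shows "\<rho> g v = v"
proof -
  interpret G: group "alt_group n" by (rule alt_group_is_group)
  have "g \<in> generate (alt_group n) (three_cycles n)" using g alt_group_carrier_as_three_cycles by blast
  then have "g \<in> A \<and> (\<forall>v. \<rho> g v = v)"
  proof induction
    case one
    show ?case using id_closed rho_id by (simp only: alt_group_one) simp
  next
    case (incl c)
    have "c \<in> A" using incl three_cycles_incl by (rule subsetD[rotated])
    moreover obtain x y z where "distinct [x, y, z]" "{x, y, z} \<subseteq> {1..n}" "c = cyc x y z"
      using incl by (rule three_cycle_is_cyc)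
    then have "\<rho> c v = v" for v using assms(1) by (simp only:)
    ultimately show ?case by simp
  next
    case (inv c)
    have c: "c \<in> A" using inv three_cycles_incl by (rule subsetD[rotated])
    then have c': "inv\<^bsub>alt_group n\<^esub> c \<in> A" by simp
    obtain x y z where "distinct [x, y, z]" "{x, y, z} \<subseteq> {1..n}" "c = cyc x y z"
      using inv by (rule three_cycle_is_cyc)
    then have triv: "\<rho> c v = v" for v using assms(1) by (simp only:)
    have "c \<circ> inv\<^bsub>alt_group n\<^esub> c = id" using G.r_inv[OF c] by (simp only: alt_group_mult alt_group_one)
    then have "\<rho> (inv\<^bsub>alt_group n\<^esub> c) v = v" for v
      using rho_comp[OF c c', of v] triv[of "\<rho> (inv\<^bsub>alt_group n\<^esub> c) v"] by (simp add: rho_id)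
    then show ?case using c' by simp
  next
    case (eng g h)
    then show ?case using rho_comp[of g h] comp_closed[of g h] unfolding alt_group_mult by metis
  qed
  then show ?thesis by simp
qed

lemma finite_spanning: "\<exists>B. finite B \<and> span B = UNIV"
proof (cases "\<exists>v::'v. v \<noteq> 0")
  case True
  then obtain v :: 'v where v: "v \<noteq> 0" by blast
  let ?B = "(\<lambda>g. \<rho> g v) ` A"
  have "\<rho> g w \<in> span ?B" if g: "g \<in> A" and w: "w \<in> span ?B" for g w
    using w
  proof (induction rule: span_induct_alt)
    case base
    then show ?case using g by (simp add: rho_zero span_zero)
  next
    case (step c x y)
    then obtain h where h: "h \<in> A" "x = \<rho> h v" by blast
    have "\<rho> g x = \<rho> (g \<circ> h) v" using g h by (simp only: rho_comp)
    then have "\<rho> g x \<in> ?B" using comp_closed[OF g h(1)] by (rule image_eqI)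
    then have "\<rho> g x \<in> span ?B" by (rule span_base)
    then show ?case using step g by (simp add: rho_add rho_scale span_add span_scale)
  qed
  then have "invariant_subspace (span ?B)" by (simp add: invariant_subspace_def subspace_span)
  then have "span ?B = {0} \<or> span ?B = UNIV" by (rule irreducible)
  moreover have "\<rho> id v \<in> ?B" using id_closed by (rule imageI)
  then have "v \<in> ?B" by (simp only: rho_id)
  then have "v \<in> span ?B" by (rule span_base)
  ultimately have "span ?B = UNIV" using v by auto
  moreover have "finite ?B" using finite_alt_group by (rule finite_imageI)
  ultimately show ?thesis by (intro exI conjI)
next
  case False
  then have "span {} = (UNIV :: 'v set)" by auto
  then show ?thesis by (intro exI[of _ "{}"] conjI finite.emptyI)
qed

text \<open>The conditions \<open>D v = 0\<close> and \<open>D v = f v\<close> define two subgroups that cover everything, and a group is not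
  the union of two proper subgroups.\<close>

lemma dichotomy:
  assumes "\<And>u v. D (u + v) = D u + D v" "\<And>u v. f (u + v) = f u + f v" "\<And>v. f v = 0 \<Longrightarrow> v = 0"
    and "\<And>v. D v = 0 \<or> D v = (f v :: 'v)"
  shows "(\<forall>v. D v = 0) \<or> (\<forall>v. D v = f v)"
proof (rule ccontr)
  assume "\<not> ?thesis"
  then obtain u v where u: "D u \<noteq> 0" and v: "D v \<noteq> f v" by blast
  then have "D u = f u" "D v = 0" using assms(4) by blast+
  moreover have "D (u + v) = 0 \<or> D (u + v) = f (u + v)" using assms(4) .
  ultimately have "f u = 0 \<or> f v = 0" using assms(1,2) by auto
  then show False using assms(2)[of 0 0] u v \<open>D u = f u\<close> \<open>D v = 0\<close> by auto
qed

end

definition pairs :: "nat \<Rightarrow> nat set set"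
  where "pairs n = {e. e \<subseteq> {1..n} \<and> card e = 2}"

definition degree_in :: "nat set set \<Rightarrow> nat \<Rightarrow> nat"
  where "degree_in E x = card {e \<in> E. x \<in> e}"

lemma finite_pairs: "finite (pairs n)"
  by (rule finite_subset[of _ "Pow {1..n}"]) (auto simp: pairs_def)

lemma degree_pairs: "x \<in> {1..n} \<Longrightarrow> degree_in (pairs n) x = n - 1"
proof -
  assume x: "x \<in> {1..n}"
  have "e \<in> (\<lambda>y. {x, y}) ` ({1..n} - {x})" if e: "e \<in> pairs n" "x \<in> e" for e
  proof -
    have "card e = 2" "e \<subseteq> {1..n}" using e by (auto simp: pairs_def)
    then obtain u w where u: "e = {u, w}" "u \<noteq> w" "u \<in> {1..n}" "w \<in> {1..n}"
      unfolding card_2_iff by blast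
    have "e = {x, if x = u then w else u}" using u(1) e(2) by auto
    then show ?thesis using u by (intro image_eqI[of _ _ "if x = u then w else u"]) auto
  qed
  then have "{e \<in> pairs n. x \<in> e} = (\<lambda>y. {x, y}) ` ({1..n} - {x})"
    using x by (auto simp: pairs_def)
  moreover have "inj_on (\<lambda>y. {x, y}) ({1..n} - {x})"
    by (auto simp: inj_on_def doubleton_eq_iff)
  ultimately show ?thesis using x by (simp add: degree_in_def card_image)
qed

text \<open>If all degrees are odd, then \<open>n\<close> is even since the degrees sum up to twice the number of edges. So the
  degrees in the complete graph, which are \<open>n - 1\<close>, are odd as well, and those in the complement are
  even.\<close>

lemma even_graph_exists:
  assumes E: "E \<subseteq> pairs n"
    and parity: "\<And>x y. x \<in> {1..n} \<Longrightarrow> y \<in> {1..n} \<Longrightarrow> even (degree_in E x) = even (degree_in E y)"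
  obtains E' where "E' = E \<or> E' = pairs n - E" "\<And>x. x \<in> {1..n} \<Longrightarrow> even (degree_in E' x)"
proof (cases "\<forall>x\<in>{1..n}. even (degree_in E x)")
  case True
  then show ?thesis using that[of E] by blast
next
  case False
  then have odd: "odd (degree_in E x)" if "x \<in> {1..n}" for x using parity that by blast
  have finE: "finite E" using E finite_pairs by (rule finite_subset)
  have "(\<Sum>x\<in>{1..n}. degree_in E x) = (\<Sum>x\<in>{1..n}. \<Sum>e | e \<in> E \<and> x \<in> e. 1)"
    by (simp add: degree_in_def)
  also have "\<dots> = (\<Sum>e\<in>E. \<Sum>x | x \<in> {1..n} \<and> x \<in> e. 1)"
    using finE by (intro sum.swap_restrict) auto
  also have "\<dots> = (\<Sum>e\<in>E. 2)"
  proof (intro sum.cong refl)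
    fix e assume "e \<in> E"
    then have e: "e \<subseteq> {1..n}" "card e = 2" using E by (auto simp: pairs_def)
    then have "{x \<in> {1..n}. x \<in> e} = e" by blast
    with e show "(\<Sum>x | x \<in> {1..n} \<and> x \<in> e. 1) = (2::nat)" by simp
  qed
  finally have "even (\<Sum>x\<in>{1..n}. degree_in E x)" by simp
  then have "even (card {x \<in> {1..n}. odd (degree_in E x)})" by (simp only: even_sum_iff finite_atLeastAtMost)
  moreover have "{x \<in> {1..n}. odd (degree_in E x)} = {1..n}" using odd by blast
  ultimately have "even n" by simp
  show ?thesis
  proof (rule that[of "pairs n - E"])
    fix x assume x: "x \<in> {1..n}"
    have "{e \<in> pairs n. x \<in> e} = {e \<in> E. x \<in> e} \<union> {e \<in> pairs n - E. x \<in> e}" using E by auto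
    then have "degree_in (pairs n) x = degree_in E x + degree_in (pairs n - E) x"
      unfolding degree_in_def using finE finite_pairs by (subst card_Un_disjoint[symmetric]) auto
    then show "even (degree_in (pairs n - E) x)"
      using odd[OF x] degree_pairs[OF x] \<open>even n\<close> x by auto presburger
  qed blast
qed

lemma sum_image_invariant:
  assumes "inj h" "(`) h ` S = S"
  shows "(\<Sum>t\<in>S. f (h ` t)) = (\<Sum>t\<in>S. f t)"
proof -
  have "inj_on ((`) h) S" using assms(1) by (auto simp: inj_on_def inj_image_eq_iff)
  then have "(\<Sum>t\<in>(`) h ` S. f t) = (\<Sum>t\<in>S. f (h ` t))" by (simp add: sum.reindex)
  then show ?thesis by (simp add: assms(2))
qed

lemma pairs_invariant:
  assumes h: "h permutes {1..n}"
  shows "(`) h ` pairs n = pairs n"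
proof -
  have *: "h ` e \<in> pairs n" if e: "e \<in> pairs n" and h: "h permutes {1..n}" for h e
  proof -
    have "card (h ` e) = card e" by (rule card_image) (rule permutes_inj_on[OF h])
    moreover have "h ` e \<subseteq> {1..n}" using e permutes_image[OF h] unfolding pairs_def by blast
    ultimately show ?thesis using e by (simp add: pairs_def)
  qed
  have "pairs n \<subseteq> (`) h ` pairs n"
  proof
    fix e assume e: "e \<in> pairs n"
    have "e = h ` inv' h ` e" by (simp add: image_comp permutes_inv_o[OF h])
    moreover have "inv' h ` e \<in> pairs n" using e permutes_inv[OF h] by (rule *)
    ultimately show "e \<in> (`) h ` pairs n" by (rule image_eqI)
  qed
  moreover have "(`) h ` pairs n \<subseteq> pairs n" using *[OF _ h] by (rule image_subsetI)
  ultimately show ?thesis by (rule subset_antisym[rotated])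
qed


section \<open>Irreducible restrictions to a group that preserves a graph\<close>

text \<open>The set \<open>Y\<close> generates the subgroup to which the module is restricted; the order of its elements enters
  in the spin case. The triangle \<open>a1 a2 a3\<close> of
  the graph \<open>E\<close> can be isolated: among the triples with one vertex \<open>ai\<close>, \<open>bi\<close> or \<open>ci\<close> for each \<open>i\<close> it is the
  only triangle, and \<open>a1 a2\<close> is the only edge between the first two sets of vertices. The assumptions
  are contradictory, as will be shown.\<close>

locale irreducible_restriction = group_rep "alt_group n" scale \<rho>
  for n :: nat and scale :: "'f::alg_closed_field \<Rightarrow> 'v::ab_group_add \<Rightarrow> 'v" and \<rho> +
  fixes Y :: "(nat \<Rightarrow> nat) set" and E :: "nat set set"
    and a1 b1 c1 a2 b2 c2 a3 b3 c3 :: nat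
  assumes char2: "\<And>v::'v. v + v = 0" and large: "11 \<le> n"
    and Y_alt: "Y \<subseteq> carrier (alt_group n)" and Y_order: "\<And>y. y \<in> Y \<Longrightarrow> y \<circ> y \<circ> y = id"
    and Y_irreducible: "\<And>W. subspace W \<Longrightarrow> (\<And>y w. y \<in> Y \<Longrightarrow> w \<in> W \<Longrightarrow> \<rho> y w \<in> W) \<Longrightarrow> W = {0} \<or> W = UNIV"
    and not_line: "\<And>v::'v. span {v} \<noteq> UNIV"
    and E_pairs: "E \<subseteq> pairs n" and E_invariant: "\<And>y. y \<in> Y \<Longrightarrow> (`) y ` E = E"
    and parity: "\<And>x y. x \<in> {1..n} \<Longrightarrow> y \<in> {1..n} \<Longrightarrow> even (degree_in E x) = even (degree_in E y)"
    and nine: "distinct [a1, b1, c1, a2, b2, c2, a3, b3, c3]" "{a1, b1, c1, a2, b2, c2, a3, b3, c3} \<subseteq> {1..n}"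
    and triangle: "{a1, a2} \<in> E" "{a1, a3} \<in> E" "{a2, a3} \<in> E"
    and non_edges: "\<And>x y. x \<in> {a1, b1, c1} \<Longrightarrow> y \<in> {a2, b2, c2} \<Longrightarrow> {x, y} \<in> E \<Longrightarrow> x = a1 \<and> y = a2"
      "{a1, b3} \<notin> E" "{a1, c3} \<notin> E"
begin

sublocale alt_module n scale \<rho>
proof
  fix W assume "invariant_subspace W"
  then show "W = {0} \<or> W = UNIV"
    unfolding invariant_subspace_def using Y_alt by (intro Y_irreducible) auto
qed (use char2 large in auto)

text \<open>Schur's lemma: an eigenspace of \<open>T\<close> is invariant under \<open>Y\<close>.\<close>

lemma commuting_scalar:
  assumes lin: "\<And>u v. T (u + v) = T u + T v" "\<And>r v. T (scale r v) = scale r (T v)"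
    and comm: "\<And>y v. y \<in> Y \<Longrightarrow> \<rho> y (T v) = T (\<rho> y v)"
  shows "\<exists>c. \<forall>v. T v = scale c v"
proof -
  have vs: "vector_space scale" by (rule vector_space_axioms)
  have l: "Vector_Spaces.linear scale scale T"
    by (intro Vector_Spaces.linear.intro module_hom.intro module_hom_axioms.intro vs module_axioms lin)
  obtain B where B: "finite B" "span B = UNIV" using finite_spanning by blast
  have "\<exists>v::'v. v \<noteq> 0" using not_line[of 0] by auto
  then obtain v :: 'v where "v \<noteq> 0" by blast
  from eigenvector_exists[OF vs l B this] obtain c u where u: "u \<noteq> 0" "T u = scale c u" by blast
  let ?W = "{v. T v = scale c v}"
  have T0: "T 0 = 0" using lin(1)[of 0 0] by simp
  have "subspace ?W"
    by (rule subspaceI) (simp_all add: lin T0 scale_right_distrib scale_left_commute)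
  moreover have "\<rho> y w \<in> ?W" if "y \<in> Y" "w \<in> ?W" for y w
    using that comm[of y w] Y_alt rho_scale[of y c w] by auto
  ultimately have "?W = {0} \<or> ?W = UNIV" by (rule Y_irreducible)
  moreover have "u \<in> ?W" using u(2) by simp
  ultimately have "?W = UNIV" using u(1) by blast
  then show ?thesis by blast
qed

lemma Y_A: "y \<in> Y \<Longrightarrow> y \<in> A" using Y_alt by blast

lemma A_permutes: "h \<in> A \<Longrightarrow> h permutes {1..n}"
  by (simp add: alt_group_carrier)

definition "triangles = {t. t \<subseteq> {1..n} \<and> card t = 3 \<and> (\<forall>e. e \<subseteq> t \<longrightarrow> card e = 2 \<longrightarrow> e \<in> E)}"

lemma finite_triangles: "finite triangles"
  by (rule finite_subset[of _ "Pow {1..n}"]) (auto simp: triangles_def)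

lemma E_image_iff: "y \<in> Y \<Longrightarrow> y ` e \<in> E \<longleftrightarrow> e \<in> E"
proof
  assume y: "y \<in> Y"
  have inj: "inj y" using y by (intro alt_inj Y_A)
  assume "y ` e \<in> E"
  then have "y ` e \<in> (`) y ` E" using E_invariant[OF y] by simp
  then show "e \<in> E" using inj by (auto simp: inj_image_eq_iff)
next
  assume "y \<in> Y" "e \<in> E"
  then show "y ` e \<in> E" using E_invariant by blast
qed

lemma triangles_invariant:
  assumes y: "y \<in> Y"
  shows "(`) y ` triangles = triangles"
proof -
  have p: "y permutes {1..n}" using y by (intro A_permutes Y_A)
  have inj: "inj y" using p by (rule permutes_inj)
  have im: "y ` t \<in> triangles" if t: "t \<in> triangles" for t
  proof -
    have "y ` t \<subseteq> {1..n}" using t permutes_image[OF p] unfolding triangles_def by blast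
    moreover have "card (y ` t) = 3"
      using t card_image[OF permutes_inj_on[OF p], of t] by (simp add: triangles_def)
    moreover have "e \<in> E" if e: "e \<subseteq> y ` t" "card e = 2" for e
    proof -
      obtain e' where e': "e' \<subseteq> t" "e = y ` e'" using e(1) by (auto simp: subset_image_iff)
      then have "card e' = 2" using e(2) card_image[OF permutes_inj_on[OF p], of e'] by simp
      then have "e' \<in> E" using t e'(1) unfolding triangles_def by blast
      then show ?thesis using E_image_iff[OF y] e'(2) by simp
    qed
    ultimately show ?thesis unfolding triangles_def by blast
  qed
  have "card ((`) y ` triangles) = card triangles"
    by (rule card_image) (auto simp: inj_on_def inj_image_eq_iff[OF inj])
  then show ?thesis
    using card_subset_eq[OF finite_triangles, of "(`) y ` triangles"] im by blast
qed

lemma family_sum_transport: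
  assumes scal: "\<And>v. (\<Sum>t\<in>S. Phi t v) = scale c v" and S: "\<And>t. t \<in> S \<Longrightarrow> t \<subseteq> {1..n}" and h: "h \<in> A"
  shows "(\<Sum>t\<in>S. Phi (h ` t) v) = scale c v"
proof -
  obtain u where u: "v = \<rho> h u" using rho_surj[OF h, of v] by blast
  have "(\<Sum>t\<in>S. Phi (h ` t) v) = (\<Sum>t\<in>S. \<rho> h (Phi t u))"
    unfolding u using S by (intro sum.cong refl Phi_equivariant[OF h, symmetric])
  also have "\<dots> = scale c v"
    unfolding u rho_sum[OF h, symmetric] scal rho_scale[OF h] ..
  finally show ?thesis .
qed

lemma triangle_sum_scalar: "\<exists>c. \<forall>v. (\<Sum>t\<in>triangles. Phi t v) = scale c v"
proof (rule commuting_scalar)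
  have sub: "t \<subseteq> {1..n}" if "t \<in> triangles" for t using that by (simp add: triangles_def)
  show "(\<Sum>t\<in>triangles. Phi t (u + v)) = (\<Sum>t\<in>triangles. Phi t u) + (\<Sum>t\<in>triangles. Phi t v)" for u v
    by (simp add: Phi_add sub sum.distrib)
  show "(\<Sum>t\<in>triangles. Phi t (scale r v)) = scale r (\<Sum>t\<in>triangles. Phi t v)" for r v
    by (simp add: Phi_scale sub scale_sum_right)
  fix y v assume y: "y \<in> Y"
  have "\<rho> y (\<Sum>t\<in>triangles. Phi t v) = (\<Sum>t\<in>triangles. Phi (y ` t) (\<rho> y v))"
    unfolding rho_sum[OF Y_A[OF y]] using sub by (intro sum.cong refl Phi_equivariant[OF Y_A[OF y]])
  also have "\<dots> = (\<Sum>t\<in>triangles. Phi t (\<rho> y v))"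
    by (rule sum_image_invariant[OF alt_inj[OF Y_A[OF y]] triangles_invariant[OF y]])
  finally show "\<rho> y (\<Sum>t\<in>triangles. Phi t v) = (\<Sum>t\<in>triangles. Phi t (\<rho> y v))" .
qed

lemma cyc_image: "distinct [a, b, c] \<Longrightarrow> cyc a b c ` {a, b, c} = {a, b, c}"
  by (auto simp: cyc_def)

lemma cyc_off: "x \<notin> {a, b, c} \<Longrightarrow> cyc a b c x = x"
  by (simp add: cyc_def)

lemma cyc_first: "cyc a b c a = b"
  by (simp add: cyc_def)

lemma sub_nine: "{a1, b1, c1} \<subseteq> {1..n}" "{a2, b2, c2} \<subseteq> {1..n}" "{a3, b3, c3} \<subseteq> {1..n}"
  and dist_nine: "distinct [a1, b1, c1]" "distinct [a2, b2, c2]" "distinct [a3, b3, c3]"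
  and disj_nine: "{a1, b1, c1} \<inter> {a2, b2, c2} = {}" "{a1, b1, c1} \<inter> {a3, b3, c3} = {}" "{a2, b2, c2} \<inter> {a3, b3, c3} = {}"
  using nine by auto

text \<open>The sum over all triangles is a scalar, so it equals its conjugates. The third difference with
  respect to the rotations of the three sets \<open>{ai, bi, ci}\<close> isolates the triangle \<open>a1 a2 a3\<close>.\<close>

lemma octahedron_nine:
  "Phi {a1, a2, a3} v + Phi {b1, a2, a3} v + Phi {a1, b2, a3} v + Phi {b1, b2, a3} v
    + Phi {a1, a2, b3} v + Phi {b1, a2, b3} v + Phi {a1, b2, b3} v + Phi {b1, b2, b3} v = 0"
proof -
  obtain c where c: "\<And>v. (\<Sum>t\<in>triangles. Phi t v) = scale c v" using triangle_sum_scalar by blast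
  have sub: "t \<subseteq> {1..n}" if "t \<in> triangles" for t using that by (simp add: triangles_def)
  note s = cyc_in_alt[OF dist_nine(1) sub_nine(1)] cyc_in_alt[OF dist_nine(2) sub_nine(2)] cyc_in_alt[OF dist_nine(3) sub_nine(3)]
  show ?thesis
  proof (rule cochain.third_difference[where s = "cyc a1 b1 c1" and s' = "cyc a2 b2 c2" and s'' = "cyc a3 b3 c3"
        and E = triangles and k = "scale c v" and A = "{a1, b1, c1}" and A' = "{a2, b2, c2}" and A'' = "{a3, b3, c3}"])
    fix h
    assume "h \<in> {id, cyc a1 b1 c1, cyc a2 b2 c2, cyc a3 b3 c3} \<union>
      {cyc a1 b1 c1 \<circ> cyc a2 b2 c2, cyc a1 b1 c1 \<circ> cyc a3 b3 c3,
       cyc a2 b2 c2 \<circ> cyc a3 b3 c3, cyc a1 b1 c1 \<circ> cyc a2 b2 c2 \<circ> cyc a3 b3 c3}"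
    then have "h \<in> A"
      by (elim UnE insertE emptyE) (simp_all only: id_closed s comp_closed)
    then show "(\<Sum>e\<in>triangles. Phi (h ` e) v) = scale c v"
      by (rule family_sum_transport[rotated 2]) (fact c sub)+
  next
    have "e \<in> E" if e: "e \<subseteq> {a1, a2, a3}" "card e = 2" for e
    proof -
      obtain x y where "e = {x, y}" "x \<noteq> y" using e(2) by (auto simp: card_2_iff)
      then show ?thesis using e(1) triangle by (auto simp: insert_commute)
    qed
    then show "{a1, a2, a3} \<in> triangles" using nine by (auto simp: triangles_def)
  next
    fix t assume t: "t \<in> triangles" "t \<inter> {a1, b1, c1} \<noteq> {}" "t \<inter> {a2, b2, c2} \<noteq> {}" "t \<inter> {a3, b3, c3} \<noteq> {}"
    then obtain x y z where xyz: "x \<in> t" "y \<in> t" "z \<in> t" "x \<in> {a1, b1, c1}" "y \<in> {a2, b2, c2}" "z \<in> {a3, b3, c3}"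
      by blast
    then have ne: "x \<noteq> y" "x \<noteq> z" "y \<noteq> z" using disj_nine by blast+
    have fin: "finite t" "card t = 3" using t(1) finite_subset[of t "{1..n}"] by (auto simp: triangles_def)
    have tt: "t = {x, y, z}"
      by (rule card_subset_eq[symmetric]) (use fin xyz ne in auto)
    have edge: "{p, q} \<in> E" if "p \<in> t" "q \<in> t" "p \<noteq> q" for p q
      using t(1) that by (auto simp: triangles_def)
    have xy: "x = a1 \<and> y = a2" using non_edges(1)[of x y] xyz edge[of x y] ne by blast
    then have "{a1, z} \<in> E" using edge[of x z] xyz ne by blast
    then have "z = a3" using xyz(6) non_edges(2,3) by blast
    with xy show "t = {a1, a2, a3}" using tt by simp
  qed (simp_all add: cyc_image[OF dist_nine(1)] cyc_image[OF dist_nine(2)] cyc_image[OF dist_nine(3)]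
      cyc_off cyc_first finite_triangles disj_nine del: image_insert insert_disjoint Int_insert_right Int_insert_left)
qed

text \<open>Six distinct points can be moved to any other six, because there are at least two more points.\<close>

lemma octahedral: "cochain.octahedral v"
  unfolding cochain.octahedral_def
proof (intro allI impI)
  fix a a' b b' c c' assume d: "distinct [a, a', b, b', c, c']" "{a, a', b, b', c, c'} \<subseteq> {1..n}"
  have "\<exists>g\<in>A. map g [a1, b1, a2, b2, a3, b3] = [a, a', b, b', c, c']"
    by (rule alt_group_transitive) (use d nine large in auto)
  then obtain g where g: "g \<in> A" "g a1 = a" "g b1 = a'" "g a2 = b" "g b2 = b'" "g a3 = c" "g b3 = c'" by auto
  obtain u where u: "v = \<rho> g u" using rho_surj[OF g(1), of v] by blast
  have im: "Phi {g x, g y, g z} v = \<rho> g (Phi {x, y, z} u)" if "{x, y, z} \<subseteq> {1..n}" for x y z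
    using Phi_equivariant[OF g(1) that, of u] u by simp
  have "Phi {g a1, g a2, g a3} v + Phi {g b1, g a2, g a3} v + Phi {g a1, g b2, g a3} v + Phi {g b1, g b2, g a3} v
    + Phi {g a1, g a2, g b3} v + Phi {g b1, g a2, g b3} v + Phi {g a1, g b2, g b3} v + Phi {g b1, g b2, g b3} v
    = \<rho> g (Phi {a1, a2, a3} u + Phi {b1, a2, a3} u + Phi {a1, b2, a3} u + Phi {b1, b2, a3} u
    + Phi {a1, a2, b3} u + Phi {b1, a2, b3} u + Phi {a1, b2, b3} u + Phi {b1, b2, b3} u)"
    using nine by (simp add: im rho_add[OF g(1)])
  also have "\<dots> = 0" unfolding octahedron_nine by (rule rho_zero[OF g(1)])
  finally show "Phi {a, b, c} v + Phi {a', b, c} v + Phi {a, b', c} v + Phi {a', b', c} v +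
       Phi {a, b, c'} v + Phi {a', b, c'} v + Phi {a, b', c'} v + Phi {a', b', c'} v = 0"
    unfolding g(2-7) .
qed

lemmas tetra_zero = tetra_vanishes[OF octahedral]

end



context irreducible_restriction
begin

definition "even_graph = (SOME E'. (E' = E \<or> E' = pairs n - E) \<and> (\<forall>x\<in>{1..n}. even (degree_in E' x)))"

lemma even_graph: "even_graph = E \<or> even_graph = pairs n - E"
    "\<And>x. x \<in> {1..n} \<Longrightarrow> even (card {e \<in> even_graph. x \<in> e})"
proof -
  obtain E' where "E' = E \<or> E' = pairs n - E" "\<And>x. x \<in> {1..n} \<Longrightarrow> even (degree_in E' x)"
    using even_graph_exists[OF E_pairs parity] by blast
  then have "(E' = E \<or> E' = pairs n - E) \<and> (\<forall>x\<in>{1..n}. even (degree_in E' x))" by blast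
  then have *: "(even_graph = E \<or> even_graph = pairs n - E) \<and> (\<forall>x\<in>{1..n}. even (degree_in even_graph x))"
    unfolding even_graph_def by (rule someI)
  then show "even_graph = E \<or> even_graph = pairs n - E" by (rule conjunct1)
  fix x assume "x \<in> {1..n}"
  then show "even (card {e \<in> even_graph. x \<in> e})" using * unfolding degree_in_def by blast
qed

lemma even_graph_pairs: "even_graph \<subseteq> pairs n"
  using even_graph(1) E_pairs by auto

lemma even_graph_invariant: "y \<in> Y \<Longrightarrow> (`) y ` even_graph = even_graph"
proof -
  assume y: "y \<in> Y"
  have p: "y permutes {1..n}" using y by (intro A_permutes Y_A)
  have "inj_on ((`) y) (pairs n)" by (auto simp: inj_on_def inj_image_eq_iff[OF permutes_inj[OF p]])
  then have "(`) y ` (pairs n - E) = (`) y ` pairs n - (`) y ` E"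
    using E_pairs by (intro inj_on_image_set_diff) auto
  then have "(`) y ` (pairs n - E) = pairs n - E"
    by (simp only: pairs_invariant[OF p] E_invariant[OF y])
  then show ?thesis using even_graph(1) E_invariant[OF y] by auto
qed

text \<open>If the even graph is the complement of \<open>E\<close>, then its sum differs from that of \<open>E\<close> by the sum over all
  pairs, which is invariant. So both sums have the same differences, and those of \<open>E\<close> isolate the edge
  \<open>a1 a2\<close>.\<close>

lemma rectangle_from_sums:
  assumes L: "0 \<in> L" "\<And>x y. x \<in> L \<Longrightarrow> y \<in> L \<Longrightarrow> x + y \<in> (L :: 'v set)"
    and sum: "\<And>h. h \<in> A \<Longrightarrow> (\<Sum>e\<in>even_graph. G (h ` e)) + k \<in> L"
  shows "G {a1, a2} + G {b1, a2} + G {a1, b2} + G {b1, b2} \<in> L"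
proof -
  have finE: "finite E" using E_pairs finite_pairs by (rule finite_subset)
  have "\<exists>k. \<forall>h\<in>A. (\<Sum>e\<in>E. G (h ` e)) + k \<in> L"
  proof (cases "even_graph = E")
    case False
    then have compl: "even_graph = pairs n - E" using even_graph(1) by blast
    have "(\<Sum>e\<in>E. G (h ` e)) + ((\<Sum>e\<in>pairs n. G e) + k) \<in> L" if h: "h \<in> A" for h
    proof -
      have "(\<Sum>e\<in>pairs n. G e) = (\<Sum>e\<in>pairs n. G (h ` e))"
        by (rule sum_image_invariant[OF alt_inj[OF h] pairs_invariant[OF A_permutes[OF h]], symmetric])
      also have "\<dots> = (\<Sum>e\<in>pairs n - E. G (h ` e)) + (\<Sum>e\<in>E. G (h ` e))"
        using E_pairs finite_pairs by (rule sum.subset_diff)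
      finally have "(\<Sum>e\<in>E. G (h ` e)) + ((\<Sum>e\<in>pairs n. G e) + k)
        = (\<Sum>e\<in>E. G (h ` e)) + ((\<Sum>e\<in>pairs n - E. G (h ` e)) + (\<Sum>e\<in>E. G (h ` e)) + k)" by simp
      also have "\<dots> = (\<Sum>e\<in>pairs n - E. G (h ` e)) + k" by (simp only: cochain.cancel)
      finally show ?thesis using sum[OF h] unfolding compl by (simp only:)
    qed
    then show ?thesis by (intro exI ballI)
  next
    case True
    show ?thesis using sum[unfolded True] by (intro exI ballI)
  qed
  then obtain k where k: "\<And>h. h \<in> A \<Longrightarrow> (\<Sum>e\<in>E. G (h ` e)) + k \<in> L" by blast
  note s = cyc_in_alt[OF dist_nine(1) sub_nine(1)] cyc_in_alt[OF dist_nine(2) sub_nine(2)]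
  show ?thesis
  proof (rule cochain.second_difference[where s = "cyc a1 b1 c1" and s' = "cyc a2 b2 c2" and E = E
        and k = k and A = "{a1, b1, c1}" and A' = "{a2, b2, c2}"])
    fix h
    assume "h \<in> {id, cyc a1 b1 c1, cyc a2 b2 c2, cyc a1 b1 c1 \<circ> cyc a2 b2 c2}"
    then have "h \<in> A"
      by (elim insertE emptyE) (simp_all only: id_closed s comp_closed)
    then show "(\<Sum>e\<in>E. G (h ` e)) + k \<in> L" by (rule k)
  next
    fix e assume e: "e \<in> E" "e \<inter> {a1, b1, c1} \<noteq> {}" "e \<inter> {a2, b2, c2} \<noteq> {}"
    then obtain x y where xy: "x \<in> e" "y \<in> e" "x \<in> {a1, b1, c1}" "y \<in> {a2, b2, c2}" by blast
    then have ne: "x \<noteq> y" using disj_nine by blast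
    have "card e = 2" using e(1) E_pairs by (auto simp: pairs_def)
    then have "e = {x, y}" using xy ne by (auto simp: card_2_iff)
    then show "e = {a1, a2}" using non_edges(1)[OF xy(3,4)] e(1) by simp
  next
    fix x y assume "x \<in> L" "y \<in> L"
    then show "x + y \<in> L" by (rule L)
  qed (simp_all add: cyc_image[OF dist_nine(1)] cyc_image[OF dist_nine(2)] L(1) finE triangle(1)
      cyc_off cyc_first disj_nine del: image_insert insert_disjoint Int_insert_right Int_insert_left)
qed

text \<open>The cone over the even graph. It is invariant under \<open>Y\<close> although the base point is not, since the base
  point does not matter.\<close>

definition "cone p v = (\<Sum>e\<in>even_graph. Phi (insert p e) v)"

lemma cone_sub: "p \<in> {1..n} \<Longrightarrow> e \<in> even_graph \<Longrightarrow> insert p e \<subseteq> {1..n}"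
  using even_graph_pairs by (auto simp: pairs_def)

lemma cone_base: "p \<in> {1..n} \<Longrightarrow> q \<in> {1..n} \<Longrightarrow> cone p v = cone q v"
proof -
  assume p: "p \<in> {1..n}" "q \<in> {1..n}"
  have "cone p v + cone q v \<in> {0}"
    unfolding cone_def
  proof (rule cochain.cone_base_change)
    show "even_graph \<subseteq> {e. e \<subseteq> {1..n} \<and> card e = 2}" using even_graph_pairs unfolding pairs_def .
    show "cochain.tetra v a b c d \<in> {0}" if "distinct [a, b, c, d]" "{a, b, c, d} \<subseteq> {1..n}" for a b c d
      unfolding tetra_zero[OF that] by (rule insertI1)
    show "even (card {e \<in> even_graph. x \<in> e})" if "x \<in> {1..n}" for x using that by (rule even_graph(2))
    show "Phi t v = 0" if "card t \<noteq> 3" for t using that by (rule Phi_small)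
    show "p \<in> {1..n}" "q \<in> {1..n}" by (fact p)+
  qed (simp_all only: singleton_iff add_0_left)
  then have "cone p v + cone q v = 0" by (rule singletonD)
  then show ?thesis by (rule cochain.eq_iff_add[THEN iffD2])
qed

lemma cone_equivariant:
  assumes h: "h \<in> A" and p: "p \<in> {1..n}"
  shows "\<rho> h (cone p v) = (\<Sum>e\<in>even_graph. Phi (insert (h p) (h ` e)) (\<rho> h v))"
  unfolding cone_def rho_sum[OF h] image_insert[symmetric]
  by (intro sum.cong refl Phi_equivariant[OF h] cone_sub[OF p])

lemma cone_scalar: "\<exists>c. \<forall>v. cone 1 v = scale c v"
proof (rule commuting_scalar)
  have one: "1 \<in> {1..n}" using large by simp
  note sub = cone_sub[OF one]
  show "cone 1 (u + v) = cone 1 u + cone 1 v" for u v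
    unfolding cone_def using sub by (simp add: Phi_add sum.distrib)
  show "cone 1 (scale r v) = scale r (cone 1 v)" for r v
    unfolding cone_def using sub by (simp add: Phi_scale scale_sum_right)
  fix y v assume y: "y \<in> Y"
  have yA: "y \<in> A" using y by (rule Y_A)
  have "\<rho> y (cone 1 v) = (\<Sum>e\<in>even_graph. Phi (insert (y 1) (y ` e)) (\<rho> y v))"
    by (rule cone_equivariant[OF yA one])
  also have "\<dots> = cone (y 1) (\<rho> y v)"
    unfolding cone_def
    by (rule sum_image_invariant[OF alt_inj[OF yA] even_graph_invariant[OF y], of "\<lambda>e. Phi (insert (y 1) e) (\<rho> y v)"])
  also have "\<dots> = cone 1 (\<rho> y v)" by (rule cone_base[OF alt_image[OF yA one] one])
  finally show "\<rho> y (cone 1 v) = cone 1 (\<rho> y v)" .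
qed

lemma preimage_point: "h \<in> A \<Longrightarrow> p \<in> {1..n} \<Longrightarrow> \<exists>q\<in>{1..n}. h q = p"
  using permutes_image[OF A_permutes, of h] by (metis imageE)

lemma rectangle_nine:
  assumes p: "p \<in> {1..n}"
  shows "Phi {p, a1, a2} v + Phi {p, b1, a2} v + Phi {p, a1, b2} v + Phi {p, b1, b2} v = 0"
proof -
  obtain c where c: "\<And>v. cone 1 v = scale c v" using cone_scalar by blast
  have one: "1 \<in> {1..n}" using large by simp
  have "Phi (insert p {a1, a2}) v + Phi (insert p {b1, a2}) v + Phi (insert p {a1, b2}) v + Phi (insert p {b1, b2}) v \<in> {0}"
  proof (rule rectangle_from_sums[where k = "scale c v" and G = "\<lambda>e. Phi (insert p e) v"])
    fix h assume h: "h \<in> A"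
    obtain q where q: "q \<in> {1..n}" "h q = p" using preimage_point[OF h p] by blast
    obtain u where u: "v = \<rho> h u" using rho_surj[OF h, of v] by blast
    have "(\<Sum>e\<in>even_graph. Phi (insert p (h ` e)) v) = \<rho> h (cone q u)"
      unfolding u q(2)[symmetric] by (rule cone_equivariant[OF h q(1), symmetric])
    also have "\<dots> = scale c v" unfolding cone_base[OF q(1) one] c rho_scale[OF h] u ..
    finally show "(\<Sum>e\<in>even_graph. Phi (insert p (h ` e)) v) + scale c v \<in> {0}" by (simp add: two)
  qed auto
  then show ?thesis by simp
qed

lemma rectangle_all:
  assumes d: "distinct [x, a, b, a', b']" "{x, a, b, a', b'} \<subseteq> {1..n}"
  shows "Phi {x, a, a'} v + Phi {x, b, a'} v + Phi {x, a, b'} v + Phi {x, b, b'} v = 0"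
proof -
  obtain p where p: "p \<in> {1..n}" "p \<notin> set [a1, b1, a2, b2]" using cochain.fresh[of "[a1, b1, a2, b2]"] by auto
  have "\<exists>g\<in>A. map g [p, a1, b1, a2, b2] = [x, a, b, a', b']"
    by (rule alt_group_transitive) (use d nine p large in auto)
  then obtain g where g: "g \<in> A" "g p = x" "g a1 = a" "g b1 = b" "g a2 = a'" "g b2 = b'" by auto
  obtain u where u: "v = \<rho> g u" using rho_surj[OF g(1), of v] by blast
  have im: "Phi {g x, g y, g z} v = \<rho> g (Phi {x, y, z} u)" if "{x, y, z} \<subseteq> {1..n}" for x y z
    using Phi_equivariant[OF g(1) that, of u] u by simp
  have "Phi {g p, g a1, g a2} v + Phi {g p, g b1, g a2} v + Phi {g p, g a1, g b2} v + Phi {g p, g b1, g b2} v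
    = \<rho> g (Phi {p, a1, a2} u + Phi {p, b1, a2} u + Phi {p, a1, b2} u + Phi {p, b1, b2} u)"
    using nine p by (simp add: im rho_add[OF g(1)])
  also have "\<dots> = 0" unfolding rectangle_nine[OF p(1)] by (rule rho_zero[OF g(1)])
  finally show ?thesis unfolding g(2-6) .
qed

lemma Phi_constant:
  assumes "s \<subseteq> {1..n}" "card s = 3" "t \<subseteq> {1..n}" "card t = 3"
  shows "Phi s v = Phi t v"
  using tetra_zero rectangle_all assms by (rule cochain.const_if_rectangles_vanish)

text \<open>Otherwise all three-cycles act trivially, hence the whole group does, and every line is invariant.\<close>

lemma cycles_not_trivial:
  assumes d: "distinct [x, y, z]" "{x, y, z} \<subseteq> {1..n}"
  shows "\<exists>v. \<rho> (cyc x y z) v \<noteq> v"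
proof (rule ccontr)
  assume triv: "\<not> ?thesis"
  have "\<rho> (cyc a b c) v = v" if abc: "distinct [a, b, c]" "{a, b, c} \<subseteq> {1..n}" for a b c v
  proof -
    have "\<exists>g\<in>A. map g [x, y, z] = [a, b, c]"
      by (rule alt_group_transitive) (use d abc large in auto)
    then obtain g where g: "g \<in> A" "g x = a" "g y = b" "g z = c" by auto
    obtain u where u: "v = \<rho> g u" using rho_surj[OF g(1), of v] by blast
    have "\<rho> (cyc a b c) (\<rho> g u) = \<rho> g (\<rho> (cyc x y z) u)"
      by (simp only: rho_comp[OF cyc_in_alt[OF abc] g(1), symmetric] rho_comp[OF g(1) cyc_in_alt[OF d], symmetric]
          cyc_conj[OF alt_inj[OF g(1)]] g(2-4))
    then show ?thesis using triv u by simp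
  qed
  then have fixed: "\<rho> g v = v" if "g \<in> A" for g v using that by (rule trivial_action)
  obtain w :: 'v where w: "w \<noteq> 0" using not_line[of 0] by auto
  have "\<rho> y v \<in> span {w}" if "y \<in> Y" "v \<in> span {w}" for y v
    using fixed[OF Y_A[OF that(1)]] that(2) by simp
  then have "span {w} = {0} \<or> span {w} = UNIV" by (intro Y_irreducible subspace_span)
  moreover have "w \<in> span {w}" by (rule span_base) simp
  ultimately show False using w not_line[of w] by auto
qed

lemma Phi_idempotent:
  assumes d: "distinct [x, y, z]" "{x, y, z} \<subseteq> {1..n}"
  shows "Phi {x, y, z} (Phi {x, y, z} v) = Phi {x, y, z} v"
proof -
  have d': "distinct [x, z, y]" "{x, z, y} \<subseteq> {1..n}" using d by auto
  show ?thesis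
    unfolding Phi_triple[OF d(1)] rho_add[OF cyc_in_alt[OF d]] rho_add[OF cyc_in_alt[OF d']] rho_cyc[OF d] rho_cyc[OF d']
    by (simp only: cochain.cancel)
qed

text \<open>The common value \<open>e\<close> of all \<open>Phi t\<close> is an idempotent that commutes with the group, so its kernel is
  everything or zero. If \<open>e = 0\<close>, then a three-cycle acts like its inverse, hence trivially.
  Otherwise \<open>e (e v + v) = 0\<close> implies \<open>e v = v\<close>.\<close>

lemma spin_relation:
  assumes t: "t \<subseteq> {1..n}" "card t = 3"
  shows "Phi t v = v"
proof -
  have d: "distinct [1, 2, 3 :: nat]" "{1, 2, 3} \<subseteq> {1..n}" using large by auto
  then have c: "card {1, 2, 3 :: nat} = 3" by simp
  let ?e = "Phi {1, 2, 3}"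
  let ?K = "{v. ?e v = 0}"
  have "invariant_subspace ?K"
    unfolding invariant_subspace_def
  proof (intro conjI ballI)
    show "subspace ?K" by (rule subspaceI) (simp_all add: Phi_zero[OF d(2)] Phi_add[OF d(2)] Phi_scale[OF d(2)])
    fix g w assume g: "g \<in> A" and w: "w \<in> ?K"
    have "g ` {1, 2, 3} \<subseteq> g ` {1..n}" using d(2) by (rule image_mono)
    then have im: "g ` {1, 2, 3} \<subseteq> {1..n}" by (simp only: permutes_image[OF A_permutes[OF g]])
    have im': "card (g ` {1, 2, 3}) = 3"
      using card_image[OF permutes_inj_on[OF A_permutes[OF g]]] c by (rule trans)
    have "?e (\<rho> g w) = Phi (g ` {1, 2, 3}) (\<rho> g w)" by (rule Phi_constant[OF d(2) c im im'])
    also have "\<dots> = \<rho> g (?e w)" by (rule Phi_equivariant[OF g d(2), symmetric])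
    also have "\<dots> = 0" using w rho_zero[OF g] by simp
    finally show "\<rho> g w \<in> ?K" by simp
  qed
  then consider "?K = {0}" | "?K = UNIV" using irreducible by blast
  then have "?e v = v"
  proof cases
    case 1
    have "?e (?e v + v) = 0"
      unfolding Phi_add[OF d(2)] Phi_idempotent[OF d] by (rule two)
    then have "?e v + v \<in> {0}" using 1 by blast
    then have "?e v + v = 0" by (rule singletonD)
    then show ?thesis by (rule cochain.eq_iff_add[THEN iffD2])
  next
    case 2
    have "\<rho> (cyc 1 3 2) v = v" for v
    proof -
      have "?e v = 0" using 2 by blast
      then have "\<rho> (cyc 1 2 3) v = \<rho> (cyc 1 3 2) v"
        unfolding Phi_triple[OF d(1)] by (rule cochain.eq_iff_add[THEN iffD2])
      then have "\<rho> (cyc 1 2 3) (\<rho> (cyc 1 2 3) v) = \<rho> (cyc 1 2 3) (\<rho> (cyc 1 3 2) v)" by simp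
      then show ?thesis unfolding rho_cyc[OF d] .
    qed
    moreover have "\<exists>v. \<rho> (cyc 1 3 2) v \<noteq> v" by (rule cycles_not_trivial) (use large in auto)
    ultimately show ?thesis by blast
  qed
  then show ?thesis using Phi_constant[OF t d(2) c, of v] by simp
qed

end


section \<open>The spin case\<close>

context irreducible_restriction
begin

text \<open>Since \<open>Phi {a, b, c}\<close> is the identity, the sum over the Klein four-group equals the sum over its two
  other cosets, which is zero.\<close>

lemma klein_sum_zero:
  assumes d: "distinct [a, b, c, d]" "{a, b, c, d} \<subseteq> {1..n}"
  shows "klein_sum a b c d v = 0"
proof -
  have d': "distinct [a, b, c]" "{a, b, c} \<subseteq> {1..n}" using d by auto
  then have "card {a, b, c} = 3" by auto
  then have "klein_sum a b c d v = Phi {a, b, c} (klein_sum a b c d v)"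
    by (rule spin_relation[OF d'(2), symmetric])
  also have "\<dots> = cochain.tetra v a b c d"
    unfolding tetra_klein[OF d] Phi_triple[OF d'(1)] ..
  also have "\<dots> = 0" by (rule tetra_zero[OF d])
  finally show ?thesis .
qed

text \<open>One of the two three-cycles on \<open>t\<close>. As a three-cycle and its inverse add up to the identity, the other
  choice changes \<open>Psi t v\<close> by \<open>v\<close>, and statements modulo \<open>{0, v}\<close> do not depend on the choice.\<close>

definition orient :: "nat set \<Rightarrow> nat \<Rightarrow> nat"
  where "orient t = (SOME g. g \<in> cycles_on t)"

definition Psi :: "nat set \<Rightarrow> 'v \<Rightarrow> 'v"
  where "Psi t v = (if card t = 3 then \<rho> (orient t) v else 0)"

lemma orient: "card t = 3 \<Longrightarrow> orient t \<in> cycles_on t"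
proof -
  assume "card t = 3"
  then obtain x y z where t: "t = {x, y, z}" "distinct [x, y, z]" by (auto simp: card_3_iff)
  then have "cyc x y z \<in> cycles_on t" by (simp only: cycles_on_triple insert_iff simp_thms)
  then show ?thesis unfolding orient_def by (rule someI[of "\<lambda>g. g \<in> cycles_on t"])
qed

sublocale spin: char_two_cochain "{1..n}" "\<lambda>t. Psi t v" for v
  using two n by unfold_locales auto

lemma line_add: "x \<in> {0, v} \<Longrightarrow> y \<in> {0, v} \<Longrightarrow> x + y \<in> {0, v :: 'v}"
  by (auto simp: two)

lemma Psi_triple:
  assumes d: "distinct [x, y, z]" "{x, y, z} \<subseteq> {1..n}"
  shows "Psi {x, y, z} v + \<rho> (cyc x y z) v \<in> {0, v}"
proof -
  have c: "card {x, y, z} = 3" using d(1) by auto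
  have "\<rho> (cyc x y z) v + \<rho> (cyc x z y) v = v"
    using spin_relation[OF d(2) c, of v] unfolding Phi_triple[OF d(1)] .
  moreover have "orient {x, y, z} \<in> {cyc x y z, cyc x z y}"
    using orient[OF c] unfolding cycles_on_triple[OF d(1)] .
  then have "orient {x, y, z} = cyc x y z \<or> orient {x, y, z} = cyc x z y" by simp
  ultimately show ?thesis
    unfolding Psi_def using c by (auto simp: two add.commute)
qed

lemma Psi_linear:
  assumes "t \<subseteq> {1..n}"
  shows Psi_add: "Psi t (u + v) = Psi t u + Psi t v" and Psi_scale: "Psi t (scale c v) = scale c (Psi t v)"
proof -
  have "orient t \<in> A" if "card t = 3" using orient[OF that] cycles_on_alt[OF assms] by (rule subsetD[rotated])
  then show "Psi t (u + v) = Psi t u + Psi t v" "Psi t (scale c v) = scale c (Psi t v)"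
    by (simp_all add: Psi_def rho_add rho_scale)
qed

text \<open>Up to orientation the four faces are represented by the four three-cycles in one coset of the Klein
  four-group, and their sum is zero.\<close>

lemma Psi_tetra:
  assumes d: "distinct [a, b, c, d]" "{a, b, c, d} \<subseteq> {1..n}"
  shows "spin.tetra v a b c d \<in> {0, v}"
proof -
  have "cyc a b c \<in> A" by (rule cyc_in_alt) (use d in auto)
  then have "0 = \<rho> (cyc a b c) v + \<rho> (cyc a c d) v + \<rho> (cyc b d c) v + \<rho> (cyc a d b) v"
    unfolding cyc_klein_sum[OF d, symmetric] klein_sum_zero[OF d] by (rule rho_zero[symmetric])
  then have "spin.tetra v a b c d = spin.tetra v a b c d
      + (\<rho> (cyc a b c) v + \<rho> (cyc a c d) v + \<rho> (cyc b d c) v + \<rho> (cyc a d b) v)" by simp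
  also have "\<dots> = Psi {a, b, c} v + \<rho> (cyc a b c) v + (Psi {a, c, d} v + \<rho> (cyc a c d) v)
      + (Psi {b, d, c} v + \<rho> (cyc b d c) v) + (Psi {a, d, b} v + \<rho> (cyc a d b) v)"
    unfolding spin.tetra_def by (simp add: ac_simps insert_commute)
  also have "\<dots> \<in> {0, v}"
    by (intro line_add Psi_triple) (use d in auto)
  finally show ?thesis .
qed

lemma rho_line: "h \<in> A \<Longrightarrow> x \<in> {0, v} \<Longrightarrow> \<rho> h x \<in> {0, \<rho> h v}"
  by (auto simp: rho_zero)

lemma Psi_equivariant:
  assumes h: "h \<in> A" and t: "t \<subseteq> {1..n}"
  shows "\<rho> h (Psi t v) + Psi (h ` t) (\<rho> h v) \<in> {0, \<rho> h v}"
proof (cases "card t = 3")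
  case True
  then obtain x y z where xyz: "t = {x, y, z}" "distinct [x, y, z]" by (auto simp: card_3_iff)
  have sub: "{x, y, z} \<subseteq> {1..n}" using t xyz(1) by simp
  have d: "distinct [h x, h y, h z]" using xyz(2) alt_inj[OF h] by (auto dest: injD)
  have hsub: "{h x, h y, h z} \<subseteq> {1..n}" using sub alt_image[OF h] by blast
  have "\<rho> h (\<rho> (cyc x y z) v) = \<rho> (cyc (h x) (h y) (h z)) (\<rho> h v)"
    by (simp only: rho_comp[OF h cyc_in_alt[OF xyz(2) sub], symmetric] rho_comp[OF cyc_in_alt[OF d hsub] h, symmetric]
        cyc_conj[OF alt_inj[OF h]])
  then have "\<rho> h (Psi t v) + \<rho> (cyc (h x) (h y) (h z)) (\<rho> h v) \<in> {0, \<rho> h v}"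
    using rho_line[OF h Psi_triple[OF xyz(2) sub, of v]] by (simp only: rho_add[OF h] xyz(1))
  then have "(\<rho> h (Psi t v) + \<rho> (cyc (h x) (h y) (h z)) (\<rho> h v))
      + (Psi {h x, h y, h z} (\<rho> h v) + \<rho> (cyc (h x) (h y) (h z)) (\<rho> h v)) \<in> {0, \<rho> h v}"
    using Psi_triple[OF d hsub] by (rule line_add)
  then show ?thesis unfolding xyz(1) image_insert image_empty by (simp only: cochain.cancel add_0_left add_0_right)
next
  case False
  moreover have "card (h ` t) = card t" by (rule card_image[OF permutes_inj_on[OF A_permutes[OF h]]])
  ultimately show ?thesis by (simp add: Psi_def rho_zero[OF h])
qed

definition "spin_cone p v = (\<Sum>e\<in>even_graph. Psi (insert p e) v)"

lemma spin_cone_base: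
  assumes p: "p \<in> {1..n}" "q \<in> {1..n}"
  shows "spin_cone p v + spin_cone q v \<in> {0, v}"
  unfolding spin_cone_def
proof (rule spin.cone_base_change)
  show "even_graph \<subseteq> {e. e \<subseteq> {1..n} \<and> card e = 2}" using even_graph_pairs unfolding pairs_def .
  show "spin.tetra v a b c d \<in> {0, v}" if "distinct [a, b, c, d]" "{a, b, c, d} \<subseteq> {1..n}" for a b c d
    by (rule Psi_tetra[OF that])
  show "even (card {e \<in> even_graph. x \<in> e})" if "x \<in> {1..n}" for x using that by (rule even_graph(2))
  show "Psi t v = 0" if "card t \<noteq> 3" for t using that by (simp add: Psi_def)
  show "x + y \<in> {0, v}" if "x \<in> {0, v}" "y \<in> {0, v}" for x y using that by (rule line_add)
qed (fact p insertI1)+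

lemma spin_cone_equivariant:
  assumes h: "h \<in> A" and p: "p \<in> {1..n}"
  shows "\<rho> h (spin_cone p v) + (\<Sum>e\<in>even_graph. Psi (insert (h p) (h ` e)) (\<rho> h v)) \<in> {0, \<rho> h v}"
  unfolding spin_cone_def rho_sum[OF h] sum.distrib[symmetric] image_insert[symmetric]
proof (rule cochain.sum_closed)
  show "x + y \<in> {0, \<rho> h v}" if "x \<in> {0, \<rho> h v}" "y \<in> {0, \<rho> h v}" for x y using that by (rule line_add)
  show "\<rho> h (Psi (insert p e) v) + Psi (h ` insert p e) (\<rho> h v) \<in> {0, \<rho> h v}" if "e \<in> even_graph" for e
    using h cone_sub[OF p that] by (rule Psi_equivariant)
qed (rule insertI1)

lemma spin_cone_linear:
  assumes p: "p \<in> {1..n}"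
  shows spin_cone_add: "spin_cone p (u + v) = spin_cone p u + spin_cone p v"
    and spin_cone_scale: "spin_cone p (scale r v) = scale r (spin_cone p v)"
  unfolding spin_cone_def using cone_sub[OF p]
  by (simp_all add: Psi_add Psi_scale sum.distrib scale_sum_right)

text \<open>Conjugation by \<open>y\<close> changes the cone by \<open>0\<close> or \<open>1\<close>. In the second case, three conjugations change it by
  \<open>3 = 1\<close>, although the cube of \<open>y\<close> is the identity.\<close>

lemma spin_cone_commutes:
  assumes y: "y \<in> Y" and p: "p \<in> {1..n}"
  shows "\<rho> y (spin_cone p v) = spin_cone p (\<rho> y v)"
proof -
  have yA: "y \<in> A" using y by (rule Y_A)
  let ?D = "\<lambda>v. \<rho> y (spin_cone p v) + spin_cone p (\<rho> y v)"
  have D: "?D v \<in> {0, \<rho> y v}" for v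
  proof -
    have eq: "(\<Sum>e\<in>even_graph. Psi (insert (y p) (y ` e)) (\<rho> y v)) = spin_cone (y p) (\<rho> y v)"
      unfolding spin_cone_def
      by (rule sum_image_invariant[OF alt_inj[OF yA] even_graph_invariant[OF y], of "\<lambda>e. Psi (insert (y p) e) (\<rho> y v)"])
    have "\<rho> y (spin_cone p v) + spin_cone (y p) (\<rho> y v) + (spin_cone (y p) (\<rho> y v) + spin_cone p (\<rho> y v)) \<in> {0, \<rho> y v}"
      using spin_cone_equivariant[OF yA p, of v] unfolding eq
      by (rule line_add) (rule spin_cone_base[OF alt_image[OF yA p] p])
    then show ?thesis by (simp only: cochain.cancel add_0_left add_0_right)
  qed
  have "(\<forall>v. ?D v = 0) \<or> (\<forall>v. ?D v = \<rho> y v)"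
  proof (rule dichotomy)
    show "?D (u + v) = ?D u + ?D v" for u v
      by (simp only: rho_add[OF yA] spin_cone_add[OF p] ac_simps)
    show "\<rho> y (u + v) = \<rho> y u + \<rho> y v" for u v by (rule rho_add[OF yA])
    show "v = 0" if "\<rho> y v = 0" for v using rho_inj[OF yA, of v 0] that rho_zero[OF yA] by simp
    show "?D v = 0 \<or> ?D v = \<rho> y v" for v using D[of v] by simp
  qed
  moreover have False if D1: "\<forall>v. ?D v = \<rho> y v"
  proof -
    have cube: "\<rho> y (\<rho> y (\<rho> y v)) = v" for v
      using Y_order[OF y] by (metis rho_comp[OF yA yA] rho_comp[OF comp_closed[OF yA yA] yA] rho_id)
    obtain v :: 'v where v: "v \<noteq> 0" using not_line[of 0] by auto
    let ?Z = "spin_cone p" and ?r = "\<rho> y"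
    have 1: "?r (?r (?r (?Z v))) + ?r (?r (?Z (?r v))) = ?r (?r (?r v))"
      using D1[rule_format, of v] by (simp only: rho_add[OF yA, symmetric])
    have 2: "?r (?r (?Z (?r v))) + ?r (?Z (?r (?r v))) = ?r (?r (?r v))"
      using D1[rule_format, of "?r v"] by (simp only: rho_add[OF yA, symmetric])
    have 3: "?r (?Z (?r (?r v))) + ?Z (?r (?r (?r v))) = ?r (?r (?r v))"
      using D1[rule_format, of "?r (?r v)"] .
    have "v = v + v + v" by (simp add: two)
    also have "\<dots> = (?Z v + ?r (?r (?Z (?r v)))) + (?r (?r (?Z (?r v))) + ?r (?Z (?r (?r v)))) + (?r (?Z (?r (?r v))) + ?Z v)"
      using 1 2 3 unfolding cube by (simp only:)
    also have "\<dots> = 0" by (simp only: cochain.cancel add_0_left add_0_right)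
    finally show False using v by simp
  qed
  ultimately have "?D v = 0" by blast
  then show ?thesis by (rule cochain.eq_iff_add[THEN iffD2])
qed

lemma spin_rectangle:
  assumes p: "p \<in> {1..n}"
  shows "Psi {p, a1, a2} v + Psi {p, b1, a2} v + Psi {p, a1, b2} v + Psi {p, b1, b2} v \<in> {0, v}"
proof -
  have "\<exists>c. \<forall>v. spin_cone p v = scale c v"
    by (rule commuting_scalar[OF spin_cone_add[OF p] spin_cone_scale[OF p] spin_cone_commutes[OF _ p]])
  then obtain c where c: "\<And>v. spin_cone p v = scale c v" by blast
  show ?thesis
  proof (rule rectangle_from_sums[where k = "scale c v" and G = "\<lambda>e. Psi (insert p e) v" and L = "{0, v}"])
    fix h assume h: "h \<in> A"
    obtain q where q: "q \<in> {1..n}" "h q = p" using preimage_point[OF h p] by blast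
    obtain u where u: "v = \<rho> h u" using rho_surj[OF h, of v] by blast
    let ?S = "\<Sum>e\<in>even_graph. Psi (insert p (h ` e)) v"
    have 1: "\<rho> h (spin_cone q u) + ?S \<in> {0, v}"
      using spin_cone_equivariant[OF h q(1), of u] unfolding q(2) u .
    have 2: "\<rho> h (spin_cone q u) + scale c v \<in> {0, v}"
      using rho_line[OF h spin_cone_base[OF q(1) p, of u]] unfolding rho_add[OF h] c rho_scale[OF h] u .
    have "\<rho> h (spin_cone q u) + ?S + (\<rho> h (spin_cone q u) + scale c v) \<in> {0, v}"
      using 1 2 by (rule line_add)
    then show "?S + scale c v \<in> {0, v}" by (simp only: cochain.cancel add_0_left add_0_right)
  next
    show "x + y \<in> {0, v}" if "x \<in> {0, v}" "y \<in> {0, v}" for x y using that by (rule line_add)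
  qed (rule insertI1)
qed

text \<open>The cocycle relations for \<open>p a1 b1 a2\<close> and \<open>p a1 b1 b2\<close> turn the rectangle into the two triples
  \<open>a1 b1 a2\<close> and \<open>a1 b1 b2\<close>.\<close>

lemma spin_pair:
  "\<rho> (cyc a1 b1 a2) v + \<rho> (cyc a1 b1 b2) v \<in> {0, v}"
proof -
  obtain p where p: "p \<in> {1..n}" "p \<notin> set [a1, b1, a2, b2]" using cochain.fresh[of "[a1, b1, a2, b2]"] by auto
  have t1: "spin.tetra v p a1 b1 a2 \<in> {0, v}" by (rule Psi_tetra) (use nine p in auto)
  have t2: "spin.tetra v p a1 b1 b2 \<in> {0, v}" by (rule Psi_tetra) (use nine p in auto)
  have c1: "Psi {a1, b1, a2} v + \<rho> (cyc a1 b1 a2) v \<in> {0, v}" by (rule Psi_triple) (use nine in auto)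
  have c2: "Psi {a1, b1, b2} v + \<rho> (cyc a1 b1 b2) v \<in> {0, v}" by (rule Psi_triple) (use nine in auto)
  have "(Psi {p, a1, a2} v + Psi {p, b1, a2} v + Psi {p, a1, b2} v + Psi {p, b1, b2} v)
    + (spin.tetra v p a1 b1 a2 + spin.tetra v p a1 b1 b2)
    + ((Psi {a1, b1, a2} v + \<rho> (cyc a1 b1 a2) v) + (Psi {a1, b1, b2} v + \<rho> (cyc a1 b1 b2) v)) \<in> {0, v}"
    by (rule line_add[OF line_add[OF spin_rectangle[OF p(1)] line_add[OF t1 t2]] line_add[OF c1 c2]])
  then show ?thesis by (simp only: spin.tetra_def cochain.cancel add_0_left add_0_right)
qed

text \<open>A product of two double transpositions which share a transposition is a three-cycle.\<close>

lemma klein_not_trivial: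
  assumes d: "distinct [a, b, c, d]" "{a, b, c, d} \<subseteq> {1..n}"
  shows "\<exists>v. \<rho> (klein a b c d) v \<noteq> v"
proof (rule ccontr)
  assume triv: "\<not> ?thesis"
  have all: "\<rho> (klein w x y z) v = v" if d': "distinct [w, x, y, z]" "{w, x, y, z} \<subseteq> {1..n}" for w x y z v
  proof -
    have "\<exists>g\<in>A. map g [a, b, c, d] = [w, x, y, z]"
      by (rule alt_group_transitive) (use d d' large in auto)
    then obtain g where g: "g \<in> A" "g a = w" "g b = x" "g c = y" "g d = z" by auto
    obtain u where u: "v = \<rho> g u" using rho_surj[OF g(1), of v] by blast
    have "\<rho> (klein w x y z) (\<rho> g u) = \<rho> g (\<rho> (klein a b c d) u)"
      by (simp only: rho_comp[OF klein_in_alt[OF d'] g(1), symmetric] rho_comp[OF g(1) klein_in_alt[OF d], symmetric]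
          klein_conj[OF alt_inj[OF g(1)]] g(2-5))
    then show ?thesis using triv u by simp
  qed
  obtain e where e: "e \<in> {1..n}" "e \<notin> set [a, b, c, d]" using cochain.fresh[of "[a, b, c, d]"] by auto
  have d5: "distinct [a, b, c, d, e]" using d e by auto
  have de: "distinct [a, b, c, e]" "{a, b, c, e} \<subseteq> {1..n}" using d e by auto
  have "\<rho> (cyc d c e) v = v" for v
    unfolding klein_klein[OF d5, symmetric] rho_comp[OF klein_in_alt[OF d] klein_in_alt[OF de]] all[OF d] all[OF de] ..
  moreover have "\<exists>v. \<rho> (cyc d c e) v \<noteq> v" by (rule cycles_not_trivial) (use d e in auto)
  ultimately show False by blast
qed

text \<open>If the two three-cycles \<open>g = cyc a1 b1 a2\<close> and \<open>h = cyc a1 b1 b2\<close> act alike, then the product of the inverse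
  of \<open>g\<close> with \<open>h\<close>, a three-cycle, acts trivially. If they add up to the identity, then \<open>h\<close> acts like the inverse
  of \<open>g\<close>, and the product of \<open>g\<close> and \<open>h\<close>, a double transposition, acts trivially.\<close>

theorem inconsistent: False
proof -
  let ?g = "cyc a1 b1 a2" and ?h = "cyc a1 b1 b2"
  have d1: "distinct [a1, b1, a2]" "{a1, b1, a2} \<subseteq> {1..n}" and d1': "distinct [a1, a2, b1]" "{a1, a2, b1} \<subseteq> {1..n}"
    and d2: "distinct [a1, b1, b2]" "{a1, b1, b2} \<subseteq> {1..n}"
    using nine by auto
  note gA = cyc_in_alt[OF d1] and hA = cyc_in_alt[OF d2] and g'A = cyc_in_alt[OF d1']
  have "(\<forall>v. \<rho> ?g v + \<rho> ?h v = 0) \<or> (\<forall>v. \<rho> ?g v + \<rho> ?h v = v)"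
  proof (rule dichotomy)
    show "\<rho> ?g (u + v) + \<rho> ?h (u + v) = (\<rho> ?g u + \<rho> ?h u) + (\<rho> ?g v + \<rho> ?h v)" for u v
      by (simp only: rho_add[OF gA] rho_add[OF hA] ac_simps)
    show "\<rho> ?g v + \<rho> ?h v = 0 \<or> \<rho> ?g v + \<rho> ?h v = v" for v using spin_pair[of v] by simp
  qed (rule refl)
  then show False
  proof
    assume eq: "\<forall>v. \<rho> ?g v + \<rho> ?h v = 0"
    have comp: "cyc a1 a2 b1 \<circ> ?h = cyc b1 b2 a2" using nine by (auto simp: cyc_def fun_eq_iff)
    have "\<rho> (cyc b1 b2 a2) v = v" for v
    proof -
      have "\<rho> ?h v = \<rho> ?g v" using eq cochain.eq_iff_add[of "\<rho> ?g v" "\<rho> ?h v"] by simp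
      then have "\<rho> (cyc b1 b2 a2) v = \<rho> (cyc a1 a2 b1) (\<rho> ?g v)"
        unfolding comp[symmetric] rho_comp[OF g'A hA] by simp
      then show ?thesis unfolding rho_cyc(2)[OF d1'] .
    qed
    moreover have "\<exists>v. \<rho> (cyc b1 b2 a2) v \<noteq> v" by (rule cycles_not_trivial) (use nine in auto)
    ultimately show False by blast
  next
    assume eq: "\<forall>v. \<rho> ?g v + \<rho> ?h v = v"
    have comp: "?g \<circ> ?h = klein a1 a2 b1 b2"
      using nine by (auto simp: cyc_def fun_eq_iff klein_def transpose_def)
    have "\<rho> (klein a1 a2 b1 b2) v = v" for v
    proof -
      have "card {a1, b1, a2} = 3" using d1(1) by auto
      then have "\<rho> ?g v + \<rho> (cyc a1 a2 b1) v = v"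
        using spin_relation[OF d1(2), of v] unfolding Phi_triple[OF d1(1)] by simp
      then have "\<rho> ?h v = \<rho> (cyc a1 a2 b1) v" using eq by (metis add_left_cancel)
      then have "\<rho> (klein a1 a2 b1 b2) v = \<rho> ?g (\<rho> (cyc a1 a2 b1) v)"
        unfolding comp[symmetric] rho_comp[OF gA hA] by simp
      then show ?thesis unfolding rho_cyc(2)[OF d1] .
    qed
    moreover have "\<exists>v. \<rho> (klein a1 a2 b1 b2) v \<noteq> v" by (rule klein_not_trivial) (use nine in auto)
    ultimately show False by blast
  qed
qed

end


section \<open>From permutation actions to reducible restrictions\<close>

lemma orbit_graph_degree:
  assumes fin: "finite \<Omega>" and into: "\<And>z. z \<in> \<Omega> \<Longrightarrow> h z \<in> \<Omega>" and inj: "inj_on h \<Omega>"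
    and adj: "\<And>x z. x \<in> \<Omega> \<Longrightarrow> z \<in> \<Omega> \<Longrightarrow> adj (h x) (h z) = adj x z" and x: "x \<in> \<Omega>"
  shows "card {z \<in> \<Omega>. z \<noteq> h x \<and> adj (h x) z} = card {z \<in> \<Omega>. z \<noteq> x \<and> adj x z}"
proof -
  have surj: "h ` \<Omega> = \<Omega>" using fin inj into by (intro endo_inj_surj) auto
  have "{z \<in> \<Omega>. z \<noteq> h x \<and> adj (h x) z} = h ` {z \<in> \<Omega>. z \<noteq> x \<and> adj x z}"
  proof (intro subset_antisym subsetI)
    fix w assume w: "w \<in> {z \<in> \<Omega>. z \<noteq> h x \<and> adj (h x) z}"
    then obtain z where "z \<in> \<Omega>" "w = h z" using surj by blast
    then show "w \<in> h ` {z \<in> \<Omega>. z \<noteq> x \<and> adj x z}" using w adj[OF x] by auto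
  next
    fix w assume "w \<in> h ` {z \<in> \<Omega>. z \<noteq> x \<and> adj x z}"
    then show "w \<in> {z \<in> \<Omega>. z \<noteq> h x \<and> adj (h x) z}" using into adj[OF x] inj x by (auto dest: inj_onD)
  qed
  moreover have "inj_on h {z \<in> \<Omega>. z \<noteq> x \<and> adj x z}" using inj by (rule inj_on_subset) auto
  ultimately show ?thesis by (simp add: card_image)
qed

lemma three_cycle_cube:
  assumes "c \<in> three_cycles m"
  shows "c \<circ> c \<circ> c = id"
proof -
  obtain x y z where d: "distinct [x, y, z]" and c: "c = cyc x y z" using assms by (rule three_cycle_is_cyc)
  then show ?thesis by (auto simp: cyc_def fun_eq_iff)
qed

text \<open>The triangle \<open>a1 a2 a3\<close> is the only one among the triples \<open>x1 x2 x3\<close> with \<open>xi\<close> in \<open>{ai, bi, ci}\<close>, and there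
  is only one edge between \<open>{a1, b1, c1}\<close> and \<open>{a2, b2, c2}\<close>.\<close>

definition detached_triangle :: "'x set \<Rightarrow> ('x \<Rightarrow> 'x \<Rightarrow> bool) \<Rightarrow> bool"
  where "detached_triangle \<Omega> adj \<longleftrightarrow> (\<exists>a1 b1 c1 a2 b2 c2 a3 b3 c3.
    distinct [a1, b1, c1, a2, b2, c2, a3, b3, c3] \<and> {a1, b1, c1, a2, b2, c2, a3, b3, c3} \<subseteq> \<Omega>
    \<and> adj a1 a2 \<and> adj a1 a3 \<and> adj a2 a3
    \<and> \<not> adj a1 b2 \<and> \<not> adj a1 c2 \<and> \<not> adj b1 a2 \<and> \<not> adj b1 b2 \<and> \<not> adj b1 c2
    \<and> \<not> adj c1 a2 \<and> \<not> adj c1 b2 \<and> \<not> adj c1 c2 \<and> \<not> adj a1 b3 \<and> \<not> adj a1 c3)"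

text \<open>The labelling turns the graph on \<open>\<Omega>\<close> into a graph on \<open>{1..n}\<close> that the embedded group preserves. That group
  is generated by the images of the three-cycles, which have order three, and all degrees
  agree because the symmetric group acts transitively. If the restriction were irreducible, the
  contradictory situation of the previous sections would arise.\<close>

lemma restriction_reducible_if_graph:
  fixes scale :: "'f::alg_closed_field \<Rightarrow> 'v::ab_group_add \<Rightarrow> 'v"
    and \<Omega> :: "'x set" and adj :: "'x \<Rightarrow> 'x \<Rightarrow> bool"
  assumes char: "CHAR('f) = 2" and n: "11 \<le> n"
    and rep: "group_rep (alt_group n) scale \<rho>"
    and dim: "1 < vector_space.dim scale UNIV \<or> (\<nexists>B. finite B \<and> module.span scale B = UNIV)"
    and into: "\<And>p x. p permutes {1..m} \<Longrightarrow> x \<in> \<Omega> \<Longrightarrow> act p x \<in> \<Omega>"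
    and id: "\<And>x. act id x = x" and comp: "\<And>p q x. act (p \<circ> q) x = act p (act q x)"
    and trans: "\<And>x y. x \<in> \<Omega> \<Longrightarrow> y \<in> \<Omega> \<Longrightarrow> \<exists>p. p permutes {1..m} \<and> act p x = y"
    and f: "bij_betw f \<Omega> {1..n}"
    and X: "X = embedded_alt m \<Omega> (\<lambda>g. \<lambda>x\<in>\<Omega>. act g x) f"
    and sym: "\<And>x y. x \<in> \<Omega> \<Longrightarrow> y \<in> \<Omega> \<Longrightarrow> adj x y \<Longrightarrow> adj y x"
    and adj_act: "\<And>p x y. p permutes {1..m} \<Longrightarrow> x \<in> \<Omega> \<Longrightarrow> y \<in> \<Omega> \<Longrightarrow> adj (act p x) (act p y) = adj x y"
    and config: "detached_triangle \<Omega> adj"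
  shows "group_rep.reducible ((alt_group n)\<lparr>carrier := X\<rparr>) scale \<rho>"
proof (rule ccontr)
  assume irred: "\<not> ?thesis"
  obtain a1 b1 c1 a2 b2 c2 a3 b3 c3
    where nine: "distinct [a1, b1, c1, a2, b2, c2, a3, b3, c3]" "{a1, b1, c1, a2, b2, c2, a3, b3, c3} \<subseteq> \<Omega>"
    and triangle: "adj a1 a2" "adj a1 a3" "adj a2 a3"
    and far: "\<not> adj a1 b2" "\<not> adj a1 c2" "\<not> adj b1 a2" "\<not> adj b1 b2" "\<not> adj b1 c2"
      "\<not> adj c1 a2" "\<not> adj c1 b2" "\<not> adj c1 c2" "\<not> adj a1 b3" "\<not> adj a1 c3"
    using config unfolding detached_triangle_def by (elim exE conjE)
  interpret group_rep "alt_group n" scale \<rho> by (rule rep)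
  interpret Gm: group "alt_group m" by (rule alt_group_is_group)
  let ?\<phi> = "\<lambda>g. \<lambda>x\<in>\<Omega>. act g x"
  let ?t = "\<lambda>g. relabel \<Omega> f (?\<phi> g)"
  have action: "group_action (alt_group m) \<Omega> ?\<phi>" using into id comp by (rule group_actionI_alt)
  have sub: "subgroup X (alt_group n)" unfolding X using action f by (rule subgroup_embedded_alt)
  have perm: "g permutes {1..m}" if "g \<in> carrier (alt_group m)" for g using that by (simp add: alt_group_carrier)
  have injf: "inj_on f \<Omega>" and imf: "f ` \<Omega> = {1..n}" using f by (auto simp: bij_betw_def)
  have fin: "finite \<Omega>" using f bij_betw_finite by blast
  have act_inj: "inj_on (act p) \<Omega>" if p: "p permutes {1..m}" for p
  proof (rule inj_on_inverseI)
    show "act (inv' p) (act p x) = x" for x unfolding comp[symmetric] permutes_inv_o(2)[OF p] by (rule id)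
  qed
  have t_f: "?t g (f x) = f (act g x)" if "x \<in> \<Omega>" for g x
    using that injf by (simp add: relabel_def)
  have t_out: "?t g i = i" if "i \<notin> {1..n}" for g i
    using that unfolding imf[symmetric] by (simp add: relabel_def)
  have t_in: "?t g \<in> X" if "g \<in> carrier (alt_group m)" for g
    unfolding X embedded_alt_def using that by (rule imageI)
  have t_alt: "?t g \<in> carrier (alt_group n)" if "g \<in> carrier (alt_group m)" for g
    using t_in[OF that] subgroup.subset[OF sub] by blast
  have t_comp: "?t (g \<circ> h) = ?t g \<circ> ?t h" if "h \<in> carrier (alt_group m)" for g h
  proof
    fix i
    show "?t (g \<circ> h) i = (?t g \<circ> ?t h) i"
    proof (cases "i \<in> {1..n}")
      case True
      then obtain x where x: "x \<in> \<Omega>" "i = f x" using imf by blast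
      have hx: "act h x \<in> \<Omega>" using perm[OF that] x(1) by (rule into)
      have "?t (g \<circ> h) (f x) = f (act g (act h x))" using t_f[OF x(1), of "g \<circ> h"] unfolding comp .
      also have "\<dots> = ?t g (?t h (f x))" unfolding t_f[OF hx] t_f[OF x(1)] ..
      finally show ?thesis unfolding x(2) comp_apply .
    qed (simp only: t_out o_apply not_False_eq_True)
  qed
  have t_id: "?t id = id"
  proof
    fix i show "?t id i = id i"
    proof (cases "i \<in> {1..n}")
      case True
      then obtain x where x: "x \<in> \<Omega>" "i = f x" using imf by blast
      then show ?thesis using t_f[OF x(1), of id] unfolding id by simp
    qed (simp only: t_out id_apply not_False_eq_True)
  qed
  have rho_comp: "\<rho> (g \<circ> h) v = \<rho> g (\<rho> h v)" if "g \<in> carrier (alt_group n)" "h \<in> carrier (alt_group n)" for g h v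
    using composition_rule[of v g h] that by (simp add: alt_group_mult)
  let ?Y = "?t ` three_cycles m"
  define E where "E = (\<lambda>(x, y). {f x, f y}) ` {(x, y). x \<in> \<Omega> \<and> y \<in> \<Omega> \<and> x \<noteq> y \<and> adj x y}"
  have E_iff: "{f x, f y} \<in> E \<longleftrightarrow> adj x y" if "x \<in> \<Omega>" "y \<in> \<Omega>" "x \<noteq> y" for x y
  proof
    assume "{f x, f y} \<in> E"
    then obtain x' y' where xy: "x' \<in> \<Omega>" "y' \<in> \<Omega>" "x' \<noteq> y'" "adj x' y'" "{f x, f y} = {f x', f y'}"
      unfolding E_def by auto
    then have "x = x' \<and> y = y' \<or> x = y' \<and> y = x'"
      using that injf by (auto simp: doubleton_eq_iff dest: inj_onD)
    then show "adj x y" using xy sym by blast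
  next
    assume "adj x y"
    then show "{f x, f y} \<in> E" unfolding E_def using that by (intro image_eqI[of _ _ "(x, y)"]) auto
  qed
  have E_pairs: "E \<subseteq> pairs n"
  proof
    fix e assume "e \<in> E"
    then obtain x y where xy: "x \<in> \<Omega>" "y \<in> \<Omega>" "x \<noteq> y" "e = {f x, f y}" unfolding E_def by auto
    then have "f x \<noteq> f y" using injf by (auto dest: inj_onD)
    moreover have "f x \<in> {1..n}" "f y \<in> {1..n}" using xy imf by blast+
    ultimately show "e \<in> pairs n" unfolding pairs_def xy(4) by simp
  qed
  have deg: "degree_in E (f x) = card {z \<in> \<Omega>. z \<noteq> x \<and> adj x z}" if x: "x \<in> \<Omega>" for x
  proof -
    have "{e \<in> E. f x \<in> e} = (\<lambda>z. {f x, f z}) ` {z \<in> \<Omega>. z \<noteq> x \<and> adj x z}"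
    proof (intro subset_antisym subsetI)
      fix e assume e: "e \<in> {e \<in> E. f x \<in> e}"
      then obtain u w where uw: "u \<in> \<Omega>" "w \<in> \<Omega>" "u \<noteq> w" "adj u w" "e = {f u, f w}" unfolding E_def by auto
      then have "x = u \<or> x = w" using e x injf by (auto dest: inj_onD)
      then show "e \<in> (\<lambda>z. {f x, f z}) ` {z \<in> \<Omega>. z \<noteq> x \<and> adj x z}"
      proof
        assume "x = u"
        then show ?thesis using uw by (intro image_eqI[of _ _ w]) auto
      next
        assume "x = w"
        then show ?thesis using uw sym by (intro image_eqI[of _ _ u]) auto
      qed
    next
      fix e assume "e \<in> (\<lambda>z. {f x, f z}) ` {z \<in> \<Omega>. z \<noteq> x \<and> adj x z}"
      then show "e \<in> {e \<in> E. f x \<in> e}" using E_iff x by auto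
    qed
    moreover have "inj_on (\<lambda>z. {f x, f z}) {z \<in> \<Omega>. z \<noteq> x \<and> adj x z}"
      using injf x by (auto simp: inj_on_def doubleton_eq_iff)
    ultimately show ?thesis by (simp add: degree_in_def card_image)
  qed
  have "irreducible_restriction n scale \<rho> ?Y E (f a1) (f b1) (f c1) (f a2) (f b2) (f c2) (f a3) (f b3) (f c3)"
  proof (rule irreducible_restriction.intro[OF rep], rule irreducible_restriction_axioms.intro)
    show "11 \<le> n" "E \<subseteq> pairs n" by (fact n E_pairs)+
    show "v + v = 0" for v :: 'v
    proof -
      have "(1 :: 'f) + 1 = of_nat CHAR('f)" unfolding char by simp
      also have "\<dots> = 0" by (rule of_nat_CHAR)
      finally have "scale (1 + 1) v = 0" by simp
      then show ?thesis unfolding scale_left_distrib scale_one .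
    qed
    show "?Y \<subseteq> carrier (alt_group n)"
      by (intro image_subsetI t_alt subsetD[OF three_cycles_incl])
    show "y \<circ> y \<circ> y = id" if y: "y \<in> ?Y" for y
    proof -
      obtain c where c2: "y = ?t c" and c1: "c \<in> three_cycles m" using y by (rule imageE)
      note c = c1 c2
      have cA: "c \<in> carrier (alt_group m)" using c(1) three_cycles_incl by (rule subsetD[rotated])
      have "y \<circ> y \<circ> y = ?t (c \<circ> c \<circ> c)" unfolding c(2) t_comp[OF cA] ..
      then show ?thesis unfolding three_cycle_cube[OF c(1)] t_id .
    qed
    show "W = {0} \<or> W = UNIV" if W: "subspace W" "\<And>y w. y \<in> ?Y \<Longrightarrow> w \<in> W \<Longrightarrow> \<rho> y w \<in> W" for W
    proof -
      have "g \<in> carrier (alt_group m) \<and> (\<forall>w\<in>W. \<rho> (?t g) w \<in> W)"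
        if "g \<in> generate (alt_group m) (three_cycles m)" for g
        using that
      proof induction
        case one
        have "\<rho> id w = w" for w using id_eq_one by (simp add: alt_group_one fun_eq_iff)
        then show ?case using Gm.one_closed unfolding alt_group_one t_id by (intro conjI ballI) (simp_all only:)
      next
        case (incl c)
        then have "c \<in> carrier (alt_group m)" using three_cycles_incl by (rule subsetD[rotated])
        moreover have "\<rho> (?t c) w \<in> W" if "w \<in> W" for w
          using incl that by (intro W(2) imageI)
        ultimately show ?case by (intro conjI ballI)
      next
        case (inv c)
        have c: "c \<in> carrier (alt_group m)" using inv three_cycles_incl by (rule subsetD[rotated])
        then have cc: "c \<circ> c \<in> carrier (alt_group m)" using Gm.m_closed[OF c c] by (simp only: alt_group_mult)
        have ic: "inv\<^bsub>alt_group m\<^esub> c = c \<circ> c"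
          by (rule Gm.inv_equality[OF _ c cc]) (simp only: alt_group_mult alt_group_one three_cycle_cube[OF inv])
        have "\<rho> (?t (c \<circ> c)) w \<in> W" if "w \<in> W" for w
          unfolding t_comp[OF c] rho_comp[OF t_alt[OF c] t_alt[OF c]] using that inv by (intro W(2) imageI)
        then show ?case unfolding ic using cc by (intro conjI ballI)
      next
        case (eng g h)
        note g = conjunct1[OF eng.IH(1)] and h = conjunct1[OF eng.IH(2)]
        have "g \<circ> h \<in> carrier (alt_group m)" using Gm.m_closed[OF g h] by (simp only: alt_group_mult)
        moreover have "\<rho> (?t (g \<circ> h)) w \<in> W" if "w \<in> W" for w
          unfolding t_comp[OF h] rho_comp[OF t_alt[OF g] t_alt[OF h]] 
          by (rule bspec[OF conjunct2[OF eng.IH(1)] bspec[OF conjunct2[OF eng.IH(2)] that]])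
        ultimately show ?case unfolding alt_group_mult by (intro conjI ballI)
      qed
      then have "\<rho> x w \<in> W" if "x \<in> X" "w \<in> W" for x w
        using that unfolding X embedded_alt_def alt_group_carrier_as_three_cycles[of m] by (elim imageE) simp
      then show ?thesis
        using irred W(1) group_rep.reducible_def[OF restriction[OF sub]]
          group_rep.invariant_subspace_def[OF restriction[OF sub]] by auto
    qed
    show "span {v} \<noteq> UNIV" for v
    proof
      assume "span {v} = UNIV"
      then have "dim UNIV \<le> card {v}" by (intro dim_le_card) auto
      then show False using dim \<open>span {v} = UNIV\<close> by auto
    qed
    show "(`) y ` E = E" if y: "y \<in> ?Y" for y
    proof -
      obtain c where c2: "y = ?t c" and c1: "c \<in> three_cycles m" using y by (rule imageE)
      note c = c1 c2
      have cA: "c \<in> carrier (alt_group m)" using c(1) three_cycles_incl by (rule subsetD[rotated])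
      note p = perm[OF cA]
      have "inj y" using t_alt[OF cA] c(2) by (auto simp: alt_group_carrier permutes_inj)
      then have "card ((`) y ` E) = card E"
        by (intro card_image) (auto simp: inj_on_def inj_image_eq_iff)
      moreover have "(`) y ` E \<subseteq> E"
      proof
        fix e assume "e \<in> (`) y ` E"
        then obtain u w where uw: "u \<in> \<Omega>" "w \<in> \<Omega>" "u \<noteq> w" "adj u w" "e = y ` {f u, f w}" unfolding E_def by auto
        then have "e = {f (act c u), f (act c w)}" using c(2) by (simp add: t_f)
        moreover have "act c u \<noteq> act c w" using uw act_inj[OF p] by (auto dest: inj_onD)
        ultimately show "e \<in> E" using uw adj_act[OF p] into[OF p] by (simp add: E_iff)
      qed
      ultimately show ?thesis by (intro card_subset_eq[OF finite_subset[OF E_pairs finite_pairs]])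
    qed
    show "even (degree_in E i) = even (degree_in E j)" if i: "i \<in> {1..n}" and j: "j \<in> {1..n}" for i j
    proof -
      obtain x where x: "i = f x" "x \<in> \<Omega>" using i unfolding imf[symmetric] by (rule imageE)
      obtain y where y: "j = f y" "y \<in> \<Omega>" using j unfolding imf[symmetric] by (rule imageE)
      note xy = x(2,1) y(2,1)
      obtain p where p: "p permutes {1..m}" "act p x = y" using trans[OF x(2) y(2)] by blast
      have "card {z \<in> \<Omega>. z \<noteq> act p x \<and> adj (act p x) z} = card {z \<in> \<Omega>. z \<noteq> x \<and> adj x z}"
        using fin into[OF p(1)] act_inj[OF p(1)] adj_act[OF p(1)] xy(1) by (rule orbit_graph_degree)
      then show ?thesis using xy p by (simp add: deg)
    qed
    have "distinct (map f [a1, b1, c1, a2, b2, c2, a3, b3, c3])"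
      unfolding distinct_map
    proof
      show "inj_on f (set [a1, b1, c1, a2, b2, c2, a3, b3, c3])"
        by (rule inj_on_subset[OF injf]) (use nine(2) in simp)
    qed (rule nine(1))
    then show "distinct [f a1, f b1, f c1, f a2, f b2, f c2, f a3, f b3, f c3]" by simp
    show "{f a1, f b1, f c1, f a2, f b2, f c2, f a3, f b3, f c3} \<subseteq> {1..n}"
      using nine(2) unfolding imf[symmetric] by auto
    show "{f a1, f a2} \<in> E" "{f a1, f a3} \<in> E" "{f a2, f a3} \<in> E" "{f a1, f b3} \<notin> E" "{f a1, f c3} \<notin> E"
      using nine triangle far by (auto simp: E_iff)
    show "i = f a1 \<and> j = f a2" if "i \<in> {f a1, f b1, f c1}" "j \<in> {f a2, f b2, f c2}" "{i, j} \<in> E" for i j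
      using that nine far by (auto simp: E_iff)
  qed
  then show False by (rule irreducible_restriction.inconsistent)
qed


section \<open>The action on subsets\<close>

lemma permutes_family:
  assumes fin: "finite U" and A: "disjoint_family_on A I" "(\<Union>i\<in>I. A i) = U"
    and B: "disjoint_family_on B I" "(\<Union>i\<in>I. B i) = U" and card: "\<And>i. i \<in> I \<Longrightarrow> card (A i) = card (B i)"
  shows "\<exists>p. p permutes U \<and> (\<forall>i\<in>I. p ` A i = B i)"
proof -
  have "\<exists>h. bij_betw h (A i) (B i)" if "i \<in> I" for i
  proof (rule finite_same_card_bij)
    show "finite (A i)" by (rule finite_subset[OF _ fin]) (use A(2) that in blast)
    show "finite (B i)" by (rule finite_subset[OF _ fin]) (use B(2) that in blast)
  qed (rule card[OF that])
  then obtain h where h: "\<And>i. i \<in> I \<Longrightarrow> bij_betw (h i) (A i) (B i)" by metis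
  define p where "p x = (if x \<in> U then h (THE i. i \<in> I \<and> x \<in> A i) x else x)" for x
  have p: "p x = h i x" if "i \<in> I" "x \<in> A i" for i x
  proof -
    have "(THE i. i \<in> I \<and> x \<in> A i) = i"
      using that A(1) by (intro the_equality) (auto simp: disjoint_family_on_def)
    then show ?thesis using that A(2) by (auto simp: p_def)
  qed
  have bij: "bij_betw p (A i) (B i)" if "i \<in> I" for i
    using h[OF that] by (rule bij_betw_cong[THEN iffD1, rotated]) (simp add: p[OF that])
  have "bij_betw p (\<Union>i\<in>I. A i) (\<Union>i\<in>I. B i)"
    using B(1) bij by (rule bij_betw_UNION_disjoint)
  then have "p permutes U"
    unfolding A(2) B(2) by (rule bij_imp_permutes) (simp add: p_def)
  then show ?thesis using bij by (auto simp: bij_betw_def)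
qed

lemma permutes_subset:
  assumes "finite U" "S \<subseteq> U" "T \<subseteq> U" "card S = card T"
  shows "\<exists>p. p permutes U \<and> p ` S = T"
proof -
  have c: "card (U - S) = card (U - T)" using assms by (simp add: card_Diff_subset finite_subset)
  have "\<exists>p. p permutes U \<and> (\<forall>i\<in>UNIV. p ` (if i then S else U - S) = (if i then T else U - T))"
    by (rule permutes_family) (use assms c in \<open>auto simp: disjoint_family_on_def UNIV_bool\<close>)
  then show ?thesis by (metis UNIV_I)
qed

lemma card_union_gt:
  assumes "finite T" "card S = k" "finite S" "u \<in> T - S" "v \<in> T - S" "u \<noteq> v"
  shows "card (S \<union> T) \<noteq> Suc k"
proof -
  have "card (insert u (insert v S)) \<le> card (S \<union> T)" using assms by (intro card_mono) auto
  then show ?thesis using assms by simp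
qed

text \<open>Two \<open>k\<close>-subsets are adjacent if they differ in one element. The triangle consists of three subsets of
  \<open>{1..k + 1}\<close>. A subset with at least two elements outside of \<open>{1..k + 1}\<close> is not adjacent to any of
  them; the other six vertices are of this kind. They arise from \<open>C = {k + 2..2 * k}\<close> by adding one
  element or by exchanging one element for two others. For \<open>k = 2\<close> this \<open>C\<close> has only one element, and
  pairs are chosen by hand.\<close>

lemma k_subsets_detached_triangle:
  assumes k: "2 \<le> k" "2 * k < m" and m: "11 \<le> m"
  shows "detached_triangle (k_subsets m k) (\<lambda>S T. card (S \<union> T) = Suc k)"
proof (cases "k = 2")
  case True
  show ?thesis
    unfolding detached_triangle_def True
    by (rule exI[of _ "{2, 3}"], rule exI[of _ "{4, 5}"], rule exI[of _ "{4, 6}"],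
        rule exI[of _ "{1, 3}"], rule exI[of _ "{7, 8}"], rule exI[of _ "{7, 9}"],
        rule exI[of _ "{1, 2}"], rule exI[of _ "{8, 9}"], rule exI[of _ "{8, 10}"])
      (use m in \<open>simp add: k_subsets_def doubleton_eq_iff card_insert_if\<close>)
next
  case False
  then have k3: "3 \<le> k" using k by simp
  \<comment> \<open>The elements \<open>1, \<dots>, 4\<close> lie in \<open>{1..k + 1}\<close>, and \<open>C\<close> has at least the two elements \<open>k + 2\<close> and \<open>k + 3\<close>.\<close>
  define C where "C = {k + 2..2 * k}"
  let ?U = "{1..k + 1}"
  define a1 a2 a3 where a: "a1 = ?U - {1}" "a2 = ?U - {2}" "a3 = ?U - {3}"
  define b1 c1 b3 c3 where b: "b1 = insert 1 C" "c1 = insert 2 C" "b3 = insert 3 C" "c3 = insert 4 C"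
  define b2 c2 where b2: "b2 = insert 3 (insert (2 * k + 1) (C - {k + 2}))"
    "c2 = insert 3 (insert (2 * k + 1) (C - {k + 3}))"
  note defs = a b b2 C_def
  have fin: "finite a1" "finite a2" "finite a3" "finite b1" "finite c1" "finite b2" "finite c2" "finite b3" "finite c3"
    by (simp_all add: defs)
  have card: "card a1 = k" "card a2 = k" "card a3 = k" "card b1 = k" "card c1 = k" "card b2 = k" "card c2 = k"
    "card b3 = k" "card c3 = k"
    using k3 by (simp_all add: defs card_insert_if)
  have sub: "{a1, b1, c1, a2, b2, c2, a3, b3, c3} \<subseteq> k_subsets m k"
    using k3 k m card by (auto simp: k_subsets_def defs)
  \<comment> \<open>These points tell the nine sets apart.\<close>
  let ?sig = "\<lambda>S. (1 \<in> S, 2 \<in> S, 3 \<in> S, 4 \<in> S, k + 2 \<in> S, k + 3 \<in> S, 2 * k + 1 \<in> S)"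
  have "distinct (map ?sig [a1, b1, c1, a2, b2, c2, a3, b3, c3])"
    using k3 by (simp add: defs)
  then have dist: "distinct [a1, b1, c1, a2, b2, c2, a3, b3, c3]" unfolding distinct_map by (rule conjunct1)
  have un: "a1 \<union> a2 = ?U" "a1 \<union> a3 = ?U" "a2 \<union> a3 = ?U" using k3 by (auto simp: defs)
  have far: "card (a1 \<union> b2) \<noteq> Suc k" "card (a1 \<union> c2) \<noteq> Suc k" "card (b1 \<union> a2) \<noteq> Suc k" "card (b1 \<union> b2) \<noteq> Suc k"
    "card (b1 \<union> c2) \<noteq> Suc k" "card (c1 \<union> a2) \<noteq> Suc k" "card (c1 \<union> b2) \<noteq> Suc k" "card (c1 \<union> c2) \<noteq> Suc k"
    "card (a1 \<union> b3) \<noteq> Suc k" "card (a1 \<union> c3) \<noteq> Suc k"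
    subgoal by (rule card_union_gt[OF _ card(1), of _ "k + 3" "2 * k + 1"]) (use k3 fin in \<open>auto simp: defs\<close>)
    subgoal by (rule card_union_gt[OF _ card(1), of _ "k + 2" "2 * k + 1"]) (use k3 fin in \<open>auto simp: defs\<close>)
    subgoal by (rule card_union_gt[OF _ card(4), of _ "3" "4"]) (use k3 fin in \<open>auto simp: defs\<close>)
    subgoal by (rule card_union_gt[OF _ card(4), of _ "3" "2 * k + 1"]) (use k3 fin in \<open>auto simp: defs\<close>)
    subgoal by (rule card_union_gt[OF _ card(4), of _ "3" "2 * k + 1"]) (use k3 fin in \<open>auto simp: defs\<close>)
    subgoal by (rule card_union_gt[OF _ card(5), of _ "1" "3"]) (use k3 fin in \<open>auto simp: defs\<close>)
    subgoal by (rule card_union_gt[OF _ card(5), of _ "3" "2 * k + 1"]) (use k3 fin in \<open>auto simp: defs\<close>)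
    subgoal by (rule card_union_gt[OF _ card(5), of _ "3" "2 * k + 1"]) (use k3 fin in \<open>auto simp: defs\<close>)
    subgoal by (rule card_union_gt[OF _ card(1), of _ "k + 2" "k + 3"]) (use k3 fin in \<open>auto simp: defs\<close>)
    subgoal by (rule card_union_gt[OF _ card(1), of _ "k + 2" "k + 3"]) (use k3 fin in \<open>auto simp: defs\<close>)
    done
  show ?thesis
    unfolding detached_triangle_def
    by (rule exI[of _ a1], rule exI[of _ b1], rule exI[of _ c1], rule exI[of _ a2], rule exI[of _ b2],
        rule exI[of _ c2], rule exI[of _ a3], rule exI[of _ b3], rule exI[of _ c3])
      (intro conjI dist sub far; simp add: un)
qed


section \<open>The action on partitions into two blocks\<close>

lemma block_partitions_transitive:
  assumes P: "P \<in> block_partitions a b" and Q: "Q \<in> block_partitions a b"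
  shows "\<exists>p. p permutes {1..a * b} \<and> (`) p ` P = Q"
proof -
  have parts: "partition_on {1..a * b} P" "partition_on {1..a * b} Q" and c: "card P = card Q"
    and blocks: "\<And>B. B \<in> P \<Longrightarrow> card B = a" "\<And>B. B \<in> Q \<Longrightarrow> card B = a"
    using P Q by (auto simp: block_partitions_def)
  have "finite P" "finite Q" using parts by (auto intro: finite_elements[rotated])
  then obtain \<pi> where \<pi>: "bij_betw \<pi> P Q" using finite_same_card_bij c by blast
  have "\<exists>p. p permutes {1..a * b} \<and> (\<forall>B\<in>P. p ` B = \<pi> B)"
  proof (rule permutes_family)
    show "disjoint_family_on (\<lambda>B. B) P" using parts(1) by (auto simp: disjoint_family_on_def partition_on_def disjoint_def)
    show "(\<Union>B\<in>P. B) = {1..a * b}" using parts(1) by (simp add: partition_on_def)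
    show "disjoint_family_on \<pi> P"
      unfolding disjoint_family_on_def
    proof (intro ballI impI)
      fix B B' assume B: "B \<in> P" "B' \<in> P" "B \<noteq> B'"
      then have "\<pi> B \<noteq> \<pi> B'" "\<pi> B \<in> Q" "\<pi> B' \<in> Q" using \<pi> by (auto simp: bij_betw_def dest: inj_onD)
      then show "\<pi> B \<inter> \<pi> B' = {}" using parts(2) by (auto simp: partition_on_def disjoint_def)
    qed
    show "(\<Union>B\<in>P. \<pi> B) = {1..a * b}" using parts(2) \<pi> by (simp add: partition_on_def bij_betw_def)
    show "card B = card (\<pi> B)" if "B \<in> P" for B using that blocks \<pi> by (auto simp: bij_betw_def)
  qed simp
  then obtain p where p: "p permutes {1..a * b}" "\<And>B. B \<in> P \<Longrightarrow> p ` B = \<pi> B" by blast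
  then have "(`) p ` P = Q" using \<pi> by (auto simp: bij_betw_def)
  then show ?thesis using p(1) by blast
qed

definition halves :: "nat \<Rightarrow> nat set \<Rightarrow> nat set set"
  where "halves a S = {S, {1..2 * a} - S}"

text \<open>For partitions into two blocks of size \<open>a \<ge> 2\<close> this means that one arises from the other by exchanging two
  points.\<close>

definition singular :: "nat set set \<Rightarrow> nat set set \<Rightarrow> bool"
  where "singular P Q \<longleftrightarrow> (\<exists>B\<in>P. \<exists>B'\<in>Q. card (B \<inter> B') = 1)"

lemma halves_partition:
  assumes S: "S \<subseteq> {1..2 * a}" "card S = a" and a: "0 < a"
  shows "halves a S \<in> block_partitions a 2"
proof -
  let ?T = "{1..2 * a} - S"
  have c: "card ?T = a" using S by (simp add: card_Diff_subset finite_subset)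
  have "S \<noteq> {}" "?T \<noteq> {}" using S(2) c a by (metis card.empty less_irrefl)+
  moreover from this have "S \<noteq> ?T" by blast
  ultimately show ?thesis
    using S c by (auto simp: block_partitions_def halves_def partition_on_def disjoint_def mult.commute)
qed

lemma singular_halves:
  assumes S: "S \<subseteq> {1..2 * a}" "card S = a" and T: "T \<subseteq> {1..2 * a}" "card T = a"
  shows "singular (halves a S) (halves a T) \<longleftrightarrow> card (S \<inter> T) = 1 \<or> a - card (S \<inter> T) = 1"
proof -
  let ?U = "{1..2 * a}"
  have fin: "finite S" "finite T" using S T by (auto intro: finite_subset[of _ ?U])
  have "card (S \<inter> (?U - T)) = a - card (S \<inter> T)"
  proof -
    have "S \<inter> (?U - T) = S - S \<inter> T" using S by blast
    then show ?thesis using S(2) fin by (simp add: card_Diff_subset)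
  qed
  moreover have "card ((?U - S) \<inter> T) = a - card (S \<inter> T)"
  proof -
    have "(?U - S) \<inter> T = T - S \<inter> T" using T by blast
    then show ?thesis using T(2) fin by (simp add: card_Diff_subset)
  qed
  moreover have "card ((?U - S) \<inter> (?U - T)) = card (S \<inter> T)"
  proof -
    have "(?U - S) \<inter> (?U - T) = ?U - (S \<union> T)" by blast
    moreover have "card (S \<union> T) + card (S \<inter> T) = 2 * a" using card_Un_Int[OF fin] S T by simp
    ultimately show ?thesis using S T fin by (simp add: card_Diff_subset)
  qed
  ultimately show ?thesis by (auto simp: singular_def halves_def)
qed

text \<open>All nine halves are unions of \<open>{13..a + 6}\<close> with a set of six among the first twelve points. Two such
  halves are adjacent if the small sets have five common points, and they are not if the small sets have
  between two and four. All small sets contain the point \<open>4\<close>, so that different sets give different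
  partitions and not complementary halves of the same one.\<close>

lemma halves_detached_triangle:
  assumes a: "6 \<le> a"
  shows "detached_triangle (block_partitions a 2) singular"
proof -
  let ?F = "{13..a + 6}"
  let ?h = "\<lambda>K. halves a (K \<union> ?F)"
  let ?ok = "\<lambda>K. K \<subseteq> {1..12} \<and> card K = 6 \<and> 4 \<in> K"
  have disj: "K \<inter> ?F = {}" if "K \<subseteq> {1..12}" for K using that by force
  have card: "card (K \<union> ?F) = card K + (a - 6)" if "K \<subseteq> {1..12}" for K
    using that disj[OF that] by (subst card_Un_disjoint) (auto intro: finite_subset)
  have half: "K \<union> ?F \<subseteq> {1..2 * a}" "card (K \<union> ?F) = a" if "?ok K" for K
    using that card[of K] a by auto
  have mem: "?h K \<in> block_partitions a 2" if "?ok K" for K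
    using half[OF that] a by (intro halves_partition) auto
  have adj: "singular (?h K) (?h L) \<longleftrightarrow> card (K \<inter> L) + (a - 6) = 1 \<or> card (K \<inter> L) = 5"
    if K: "?ok K" and L: "?ok L" for K L
  proof -
    have "(K \<union> ?F) \<inter> (L \<union> ?F) = (K \<inter> L) \<union> ?F" by blast
    then have "card ((K \<union> ?F) \<inter> (L \<union> ?F)) = card (K \<inter> L) + (a - 6)"
      using card[of "K \<inter> L"] K by auto
    moreover have "card (K \<inter> L) \<le> 6" using K by (metis card_mono finite_atLeastAtMost finite_subset inf_le1)
    ultimately show ?thesis
      unfolding singular_halves[OF half[OF K] half[OF L]] using a by auto
  qed
  have eq: "K = L" if "?h K = ?h L" and K: "?ok K" and L: "?ok L" for K L
  proof -
    have "K \<union> ?F = L \<union> ?F"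
      using that by (auto simp: halves_def doubleton_eq_iff)
    then have "(K \<union> ?F) \<inter> {1..12} = (L \<union> ?F) \<inter> {1..12}" by simp
    moreover have "?F \<inter> {1..12} = {}" by auto
    ultimately show ?thesis using K L by (auto simp: Int_Un_distrib2 Int_absorb2)
  qed
  let ?a1 = "{1, 2, 3, 4, 5, 6} :: nat set" and ?a2 = "{1, 2, 3, 4, 5, 7} :: nat set" and ?a3 = "{1, 2, 3, 4, 5, 8} :: nat set"
  let ?b1 = "{1, 4, 5, 8, 9, 10} :: nat set" and ?c1 = "{1, 4, 6, 8, 9, 10} :: nat set"
  let ?b2 = "{3, 4, 5, 6, 11, 12} :: nat set" and ?c2 = "{2, 4, 5, 6, 11, 12} :: nat set"
  let ?b3 = "{1, 3, 4, 8, 9, 10} :: nat set" and ?c3 = "{1, 2, 4, 8, 9, 10} :: nat set"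
  have ok: "?ok ?a1" "?ok ?b1" "?ok ?c1" "?ok ?a2" "?ok ?b2" "?ok ?c2" "?ok ?a3" "?ok ?b3" "?ok ?c3"
    by simp_all
  let ?Ks = "[?a1, ?b1, ?c1, ?a2, ?b2, ?c2, ?a3, ?b3, ?c3]"
  let ?sig = "\<lambda>K::nat set. (1 \<in> K, 2 \<in> K, 3 \<in> K, 5 \<in> K, 6 \<in> K, 7 \<in> K, 8 \<in> K)"
  have "distinct (map ?sig ?Ks)" by simp
  then have "distinct ?Ks" unfolding distinct_map by (rule conjunct1)
  moreover have "?ok K" if "K \<in> set ?Ks" for K using that ok by auto
  then have "inj_on ?h (set ?Ks)" using eq by (intro inj_onI) blast
  ultimately have dist: "distinct (map ?h ?Ks)" unfolding distinct_map by (rule conjI)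
  have tri: "singular (?h ?a1) (?h ?a2)" "singular (?h ?a1) (?h ?a3)" "singular (?h ?a2) (?h ?a3)"
    unfolding adj[OF ok(1,4)] adj[OF ok(1,7)] adj[OF ok(4,7)] by simp_all
  have far: "\<not> singular (?h ?a1) (?h ?b2)" "\<not> singular (?h ?a1) (?h ?c2)" "\<not> singular (?h ?b1) (?h ?a2)"
    "\<not> singular (?h ?b1) (?h ?b2)" "\<not> singular (?h ?b1) (?h ?c2)" "\<not> singular (?h ?c1) (?h ?a2)"
    "\<not> singular (?h ?c1) (?h ?b2)" "\<not> singular (?h ?c1) (?h ?c2)" "\<not> singular (?h ?a1) (?h ?b3)" "\<not> singular (?h ?a1) (?h ?c3)"
    unfolding adj[OF ok(1,5)] adj[OF ok(1,6)] adj[OF ok(2,4)] adj[OF ok(2,5)] adj[OF ok(2,6)] adj[OF ok(3,4)]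
      adj[OF ok(3,5)] adj[OF ok(3,6)] adj[OF ok(1,8)] adj[OF ok(1,9)]
    by simp_all
  show ?thesis
    unfolding detached_triangle_def
    by (rule exI[of _ "?h ?a1"], rule exI[of _ "?h ?b1"], rule exI[of _ "?h ?c1"], rule exI[of _ "?h ?a2"],
        rule exI[of _ "?h ?b2"], rule exI[of _ "?h ?c2"], rule exI[of _ "?h ?a3"], rule exI[of _ "?h ?b3"],
        rule exI[of _ "?h ?c3"])
      (intro conjI tri far dist[unfolded list.map] insert_subsetI empty_subsetI mem ok)
qed


section \<open>The action on partitions into at least three blocks\<close>

text \<open>A perfect matching \<open>B, C, D\<close> of the points \<open>1, \<dots>, 6\<close> is extended to a partition of \<open>{1..a * b}\<close> by enlarging
  its edges to blocks of size \<open>a\<close> in a fixed way and by adding the fixed blocks \<open>tails a b\<close>.\<close>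

definition heads :: "nat \<Rightarrow> nat set \<Rightarrow> nat set \<Rightarrow> nat set \<Rightarrow> nat set set"
  where "heads a B C D = {B \<union> {7..a + 4}, C \<union> {a + 5..2 * a + 2}, D \<union> {2 * a + 3..3 * a}}"

definition tails :: "nat \<Rightarrow> nat \<Rightarrow> nat set set"
  where "tails a b = (\<lambda>j. {j * a + 1..j * a + a}) ` {3..<b}"

definition matching :: "nat set \<Rightarrow> nat set \<Rightarrow> nat set \<Rightarrow> bool"
  where "matching B C D \<longleftrightarrow> B \<union> C \<union> D = {1..6} \<and> B \<inter> C = {} \<and> B \<inter> D = {} \<and> C \<inter> D = {}
    \<and> card B = 2 \<and> card C = 2 \<and> card D = 2"

lemma tails_union: "3 \<le> b \<Longrightarrow> \<Union> (tails a b) = {3 * a + 1..a * b}"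
proof (induction b rule: nat_induct_at_least)
  case (Suc b)
  have "tails a (Suc b) = insert {b * a + 1..b * a + a} (tails a b)"
    using Suc.hyps by (simp add: tails_def atLeastLessThanSuc)
  moreover have "3 * a \<le> b * a" using Suc.hyps by (rule mult_le_mono1)
  moreover have "{r + 1..r + a} \<union> {l + 1..r} = {l + 1..r + a}" if "l \<le> r" for l r :: nat
    using that by auto
  ultimately have "\<Union> (tails a (Suc b)) = {3 * a + 1..b * a + a}"
    using Suc.IH by (simp add: mult.commute[of a])
  then show ?case by (simp add: mult.commute[of a] add.commute)
qed (simp add: tails_def mult.commute)

lemma tails_disjoint: "i < j \<Longrightarrow> {i * a + 1..i * a + a} \<inter> {j * a + 1..j * a + a} = {}" for i j a :: nat
proof -
  assume "i < j"
  then have "Suc i * a \<le> j * a" by (intro mult_le_mono1) simp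
  then show ?thesis by auto
qed

lemma tails_inj: "0 < a \<Longrightarrow> inj_on (\<lambda>j. {j * a + 1..j * a + a}) {3..<b}" for a b :: nat
proof (rule inj_onI)
  fix i j :: nat assume "0 < a" "{i * a + 1..i * a + a} = {j * a + 1..j * a + a}"
  moreover from this have "i * a + 1 \<in> {j * a + 1..j * a + a}" by auto
  ultimately show "i = j" using tails_disjoint[of i j a] tails_disjoint[of j i a]
    by (cases i j rule: linorder_cases) auto
qed

lemma card_tails: "0 < a \<Longrightarrow> card (tails a b) = b - 3"
  unfolding tails_def by (simp add: card_image[OF tails_inj])

lemma head_trace:
  assumes "matching B C D" "H \<in> heads a B C D"
  shows "H \<inter> {1..6} \<in> {B, C, D}" "H \<inter> {1..6} \<noteq> {}"
proof -
  have sub: "B \<inter> {1..6} = B" "C \<inter> {1..6} = C" "D \<inter> {1..6} = D" and ne: "B \<noteq> {}" "C \<noteq> {}" "D \<noteq> {}"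
    using assms(1) by (auto simp: matching_def)
  have emp: "{7..a + 4} \<inter> {1..6} = {}" "{a + 5..2 * a + 2} \<inter> {1..6} = {}" "{2 * a + 3..3 * a} \<inter> {1..6} = {}" if "2 \<le> a"
    using that by auto
  have emp': "{7..a + 4} = {}" "{a + 5..2 * a + 2} = {}" "{2 * a + 3..3 * a} = {}" if "\<not> 2 \<le> a"
    using that by auto
  have "H \<inter> {1..6} = B \<or> H \<inter> {1..6} = C \<or> H \<inter> {1..6} = D"
    using assms(2) sub emp emp' unfolding heads_def by (cases "2 \<le> a") (auto simp: Int_Un_distrib2)
  then show "H \<inter> {1..6} \<in> {B, C, D}" "H \<inter> {1..6} \<noteq> {}" using ne by auto
qed

lemma tail_trace: "2 \<le> a \<Longrightarrow> H \<in> tails a b \<Longrightarrow> H \<inter> {1..6} = {}"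
proof -
  assume a: "2 \<le> a" "H \<in> tails a b"
  then obtain j where j: "3 \<le> j" "H = {j * a + 1..j * a + a}" by (auto simp: tails_def)
  have "3 * 2 \<le> j * a" using j(1) a(1) by (rule mult_le_mono)
  then show ?thesis unfolding j(2) by auto
qed

lemma heads_tails_disjoint:
  assumes "matching B C D" "2 \<le> a"
  shows "heads a B C D \<inter> tails a b = {}"
proof (rule equals0I)
  fix H assume "H \<in> heads a B C D \<inter> tails a b"
  then show False using head_trace(2)[OF assms(1), of H a] tail_trace[OF assms(2), of H b] by simp
qed

lemma matching_partition:
  assumes M: "matching B C D" and a: "2 \<le> a" and b: "3 \<le> b"
  shows "heads a B C D \<union> tails a b \<in> block_partitions a b"
proof -
  let ?H1 = "B \<union> {7..a + 4}" and ?H2 = "C \<union> {a + 5..2 * a + 2}" and ?H3 = "D \<union> {2 * a + 3..3 * a}"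
  have sub: "B \<subseteq> {1..6}" "C \<subseteq> {1..6}" "D \<subseteq> {1..6}" and un: "B \<union> C \<union> D = {1..6}"
    and dj: "B \<inter> C = {}" "B \<inter> D = {}" "C \<inter> D = {}" and two: "card B = 2" "card C = 2" "card D = 2"
    using M by (auto simp: matching_def)
  have fin: "finite B" "finite C" "finite D" using sub by (auto intro: finite_subset)
  have low: "K \<inter> {l..u} = {}" "{l..u} \<inter> K = {}" if "K \<subseteq> {1..6}" "7 \<le> l" for K and l u :: nat
    using that by force+
  have e: "B \<inter> {7..a + 4} = {}" "C \<inter> {a + 5..2 * a + 2} = {}" "D \<inter> {2 * a + 3..3 * a} = {}"
    by (rule low; use sub a in simp)+
  have cards: "card ?H1 = a" "card ?H2 = a" "card ?H3 = a"
    using fin e two a by (simp_all add: card_Un_disjoint)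
  have disj: "?H1 \<inter> ?H2 = {}" "?H1 \<inter> ?H3 = {}" "?H2 \<inter> ?H3 = {}"
    using dj low sub a by (simp_all add: Int_Un_distrib Int_Un_distrib2)
  have ne: "?H1 \<noteq> {}" "?H2 \<noteq> {}" "?H3 \<noteq> {}" using two by auto
  have Uh: "\<Union> (heads a B C D) = {1..3 * a}"
  proof -
    have "\<Union> (heads a B C D) = (B \<union> C \<union> D) \<union> ({7..a + 4} \<union> {a + 5..2 * a + 2} \<union> {2 * a + 3..3 * a})"
      by (auto simp: heads_def)
    also have "\<dots> = {1..3 * a}" unfolding un using a by auto
    finally show ?thesis .
  qed
  have Ut: "\<Union> (tails a b) = {3 * a + 1..a * b}" using b by (rule tails_union)
  have le: "3 * a \<le> a * b" using b by simp
  have ch: "card (heads a B C D) = 3"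
  proof -
    have "?H1 \<noteq> ?H2" "?H1 \<noteq> ?H3" "?H2 \<noteq> ?H3" using disj ne by (metis Int_absorb)+
    then show ?thesis by (simp add: heads_def)
  qed
  have dis: "K \<inter> L = {}" if K: "K \<in> heads a B C D \<union> tails a b" and L: "L \<in> heads a B C D \<union> tails a b" and "K \<noteq> L" for K L
  proof -
    consider "K \<in> heads a B C D" "L \<in> heads a B C D" | "K \<in> tails a b" "L \<in> tails a b"
      | "K \<in> heads a B C D" "L \<in> tails a b" | "K \<in> tails a b" "L \<in> heads a B C D"
      using K L by blast
    then show ?thesis
    proof cases
      case 1
      then show ?thesis using disj \<open>K \<noteq> L\<close> unfolding heads_def by blast
    next
      case 2
      then obtain i j where ij: "K = {i * a + 1..i * a + a}" "L = {j * a + 1..j * a + a}" by (auto simp: tails_def)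
      then have "i \<noteq> j" using \<open>K \<noteq> L\<close> by blast
      then show ?thesis using tails_disjoint[of i j a] tails_disjoint[of j i a] ij by (auto simp: neq_iff)
    next
      case 3
      then have "K \<subseteq> {1..3 * a}" "L \<subseteq> {3 * a + 1..a * b}" using Uh Ut by blast+
      then show ?thesis by fastforce
    next
      case 4
      then have "L \<subseteq> {1..3 * a}" "K \<subseteq> {3 * a + 1..a * b}" using Uh Ut by blast+
      then show ?thesis by fastforce
    qed
  qed
  have dht: "heads a B C D \<inter> tails a b = {}" using M a by (rule heads_tails_disjoint)
  have "card (heads a B C D \<union> tails a b) = b"
    using dht ch card_tails[of a b] a b by (subst card_Un_disjoint) (simp_all add: heads_def tails_def)
  moreover have "card K = a" if "K \<in> heads a B C D \<union> tails a b" for K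
    using that cards by (auto simp: heads_def tails_def)
  moreover have "partition_on {1..a * b} (heads a B C D \<union> tails a b)"
  proof (rule partition_onI)
    have "{1..l} \<union> {l + 1..r} = {1..r}" if "l \<le> r" for l r :: nat using that by auto
    then show "\<Union> (heads a B C D \<union> tails a b) = {1..a * b}" unfolding Union_Un_distrib Uh Ut using le .
    show "{} \<notin> heads a B C D \<union> tails a b" using ne a by (auto simp: heads_def tails_def)
    show "disjnt K L" if "K \<in> heads a B C D \<union> tails a b" "L \<in> heads a B C D \<union> tails a b" "K \<noteq> L" for K L
      using dis[OF that] by (simp add: disjnt_def)
  qed
  ultimately show ?thesis by (simp add: block_partitions_def)
qed

text \<open>Intersection with \<open>{1..6}\<close> recovers the matching from the enlarged edges. So the partitions of two
  matchings share no enlarged edge if the matchings share no edge, and exactly one if they share an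
  edge in the first position only.\<close>

lemma meet_matchings:
  assumes M: "matching B C D" "matching B' C' D'" and a: "2 \<le> a"
  shows "{B, C, D} \<inter> {B', C', D'} = {} \<Longrightarrow>
      (heads a B C D \<union> tails a b) \<inter> (heads a B' C' D' \<union> tails a b) = tails a b"
    and "B = B' \<Longrightarrow> {C, D} \<inter> {C', D'} = {} \<Longrightarrow>
      (heads a B C D \<union> tails a b) \<inter> (heads a B' C' D' \<union> tails a b) = insert (B \<union> {7..a + 4}) (tails a b)"
    and "heads a B C D \<union> tails a b = heads a B' C' D' \<union> tails a b \<Longrightarrow> {B, C, D} = {B', C', D'}"
proof -
  note ht = heads_tails_disjoint[OF M(1) a, of b] heads_tails_disjoint[OF M(2) a, of b]
  show "(heads a B C D \<union> tails a b) \<inter> (heads a B' C' D' \<union> tails a b) = tails a b"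
    if "{B, C, D} \<inter> {B', C', D'} = {}"
  proof -
    have "heads a B C D \<inter> heads a B' C' D' = {}"
    proof (rule equals0I)
      fix H assume H: "H \<in> heads a B C D \<inter> heads a B' C' D'"
      have "H \<inter> {1..6} \<in> {B, C, D} \<inter> {B', C', D'}"
        by (rule IntI[OF head_trace(1)[OF M(1) IntD1[OF H]] head_trace(1)[OF M(2) IntD2[OF H]]])
      then show False unfolding that by (rule emptyE)
    qed
    then show ?thesis using ht by (simp add: Int_Un_distrib Int_Un_distrib2 Int_commute)
  qed
  show "(heads a B C D \<union> tails a b) \<inter> (heads a B' C' D' \<union> tails a b) = insert (B \<union> {7..a + 4}) (tails a b)"
    if BB: "B = B'" and CD: "{C, D} \<inter> {C', D'} = {}"
  proof -
    have tr: "(B \<union> {7..a + 4}) \<inter> {1..6} = B" "(B' \<union> {7..a + 4}) \<inter> {1..6} = B'"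
      "(C \<union> {a + 5..2 * a + 2}) \<inter> {1..6} = C" "(C' \<union> {a + 5..2 * a + 2}) \<inter> {1..6} = C'"
      "(D \<union> {2 * a + 3..3 * a}) \<inter> {1..6} = D" "(D' \<union> {2 * a + 3..3 * a}) \<inter> {1..6} = D'"
      using M a by (auto simp: matching_def)
    have only: "H = B \<union> {7..a + 4}" if H: "H \<in> heads a B C D" "H \<in> heads a B' C' D'" for H
    proof (rule ccontr)
      assume n: "H \<noteq> B \<union> {7..a + 4}"
      have "H \<inter> {1..6} \<in> {C, D}"
        using H(1) n tr unfolding heads_def by (elim insertE emptyE) simp_all
      moreover have "H \<inter> {1..6} \<in> {C', D'}"
        using H(2) n tr unfolding heads_def BB by (elim insertE emptyE) simp_all
      ultimately have "H \<inter> {1..6} \<in> {C, D} \<inter> {C', D'}" by (rule IntI)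
      then show False unfolding CD by (rule emptyE)
    qed
    have "heads a B C D \<inter> heads a B' C' D' = {B \<union> {7..a + 4}}"
    proof (rule subset_antisym)
      show "heads a B C D \<inter> heads a B' C' D' \<subseteq> {B \<union> {7..a + 4}}"
        by (rule subsetI) (simp only: singleton_iff only[OF IntD1 IntD2])
      show "{B \<union> {7..a + 4}} \<subseteq> heads a B C D \<inter> heads a B' C' D'"
        unfolding heads_def BB by simp
    qed
    then show ?thesis using ht by (simp add: Int_Un_distrib Int_Un_distrib2 Int_commute)
  qed
  have tr: "(\<lambda>H. H \<inter> {1..6}) ` (heads a B C D \<union> tails a b) - {{}} = {B, C, D}" if M: "matching B C D" for B C D
  proof -
    have "(B \<union> {7..a + 4}) \<inter> {1..6} = B" "(C \<union> {a + 5..2 * a + 2}) \<inter> {1..6} = C" "(D \<union> {2 * a + 3..3 * a}) \<inter> {1..6} = D"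
      "B \<noteq> {}" "C \<noteq> {}" "D \<noteq> {}"
      using M a by (auto simp: matching_def)
    then have "(\<lambda>H. H \<inter> {1..6}) ` heads a B C D = {B, C, D}" "{} \<notin> {B, C, D}" by (simp_all add: heads_def)
    moreover have "(\<lambda>H. H \<inter> {1..6}) ` tails a b \<subseteq> {{}}"
      by (rule image_subsetI) (simp only: tail_trace[OF a] singletonI)
    moreover have "X \<union> Z - {{}} = X" if "{} \<notin> X" "Z \<subseteq> {{}}" for X Z :: "nat set set" using that by blast
    ultimately show ?thesis unfolding image_Un by (simp only:)
  qed
  show "{B, C, D} = {B', C', D'}" if "heads a B C D \<union> tails a b = heads a B' C' D' \<union> tails a b"
    using tr[OF M(1)] tr[OF M(2)] that by simp
qed

text \<open>The three matchings that contain the edge \<open>{1, 2}\<close> form the triangle. The other six matchings are chosen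
  such that those which must not be adjacent have no edge in common.\<close>

lemma matchings_detached_triangle:
  assumes a: "2 \<le> a" and b: "3 \<le> b"
  shows "detached_triangle (block_partitions a b) (\<lambda>P Q. card (P \<inter> Q) = b - 2)"
proof -
  let ?p = "\<lambda>(B, C, D). heads a B C D \<union> tails a b"
  let ?adj = "\<lambda>P Q. card (P \<inter> Q) = b - 2"
  let ?ok = "\<lambda>(B, C, D). matching B C D"
  have near: "?adj (?p (B, C, D)) (?p (B, C', D'))"
    if "?ok (B, C, D)" "?ok (B, C', D')" "{C, D} \<inter> {C', D'} = {}" for B C D C' D'
  proof -
    have "B \<union> {7..a + 4} \<in> heads a B C D" by (simp add: heads_def)
    then have "B \<union> {7..a + 4} \<notin> tails a b" using heads_tails_disjoint[of B C D a b] that(1) a by auto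
    then have "card (insert (B \<union> {7..a + 4}) (tails a b)) = Suc (b - 3)"
      using card_tails[of a b] a by (simp add: tails_def)
    then show ?thesis using meet_matchings(2)[of B C D B C' D' a b] that a b by simp
  qed
  have far: "\<not> ?adj (?p (B, C, D)) (?p (B', C', D'))"
    if "?ok (B, C, D)" "?ok (B', C', D')" "{B, C, D} \<inter> {B', C', D'} = {}" for B C D B' C' D'
    using meet_matchings(1)[of B C D B' C' D' a b] that a b card_tails[of a b] by simp
  let ?a1 = "({1, 2}, {3, 4}, {5, 6}) :: nat set \<times> nat set \<times> nat set"
  let ?a2 = "({1, 2}, {3, 5}, {4, 6}) :: nat set \<times> nat set \<times> nat set"
  let ?a3 = "({1, 2}, {3, 6}, {4, 5}) :: nat set \<times> nat set \<times> nat set"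
  let ?b1 = "({1, 3}, {2, 4}, {5, 6}) :: nat set \<times> nat set \<times> nat set"
  let ?c1 = "({1, 3}, {2, 6}, {4, 5}) :: nat set \<times> nat set \<times> nat set"
  let ?b2 = "({1, 4}, {2, 5}, {3, 6}) :: nat set \<times> nat set \<times> nat set"
  let ?c2 = "({1, 5}, {2, 3}, {4, 6}) :: nat set \<times> nat set \<times> nat set"
  let ?b3 = "({1, 3}, {2, 5}, {4, 6}) :: nat set \<times> nat set \<times> nat set"
  let ?c3 = "({1, 4}, {2, 6}, {3, 5}) :: nat set \<times> nat set \<times> nat set"
  have six: "{1..6} = {1, 2, 3, 4, 5, 6 :: nat}" by auto
  have ok: "?ok ?a1" "?ok ?b1" "?ok ?c1" "?ok ?a2" "?ok ?b2" "?ok ?c2" "?ok ?a3" "?ok ?b3" "?ok ?c3"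
    by (simp_all add: matching_def six insert_commute)
  let ?Ms = "[?a1, ?b1, ?c1, ?a2, ?b2, ?c2, ?a3, ?b3, ?c3]"
  let ?set = "\<lambda>(B, C, D). {B, C, D} :: nat set set"
  let ?sig = "\<lambda>M :: nat set set. ({1, 2} \<in> M, {1, 3} \<in> M, {1, 4} \<in> M, {5, 6} \<in> M, {4, 6} \<in> M, {4, 5} \<in> M, {2, 5} \<in> M)"
  have "distinct (map (?sig \<circ> ?set) ?Ms)" by (simp add: doubleton_eq_iff)
  then have dist: "distinct ?Ms" and inj: "inj_on (?sig \<circ> ?set) (set ?Ms)" unfolding distinct_map by (rule conjunct1, rule conjunct2)
  have all_ok: "?ok M" if "M \<in> set ?Ms" for M using that ok by auto
  have "inj_on ?p (set ?Ms)"
  proof (rule inj_onI)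
    fix M N assume M: "M \<in> set ?Ms" and N: "N \<in> set ?Ms" and eq: "?p M = ?p N"
    have "?set M = ?set N"
      using meet_matchings(3)[of "fst M" "fst (snd M)" "snd (snd M)" "fst N" "fst (snd N)" "snd (snd N)" a b] all_ok[OF M] all_ok[OF N] eq a
      by (simp add: case_prod_beta)
    then have "(?sig \<circ> ?set) M = (?sig \<circ> ?set) N" by (simp only: o_apply)
    then show "M = N" using inj M N by (blast dest: inj_onD)
  qed
  with dist have distp: "distinct (map ?p ?Ms)" unfolding distinct_map by (rule conjI)
  have mem: "?p M \<in> block_partitions a b" if "?ok M" for M
    using that matching_partition[OF _ a b] by (auto simp: case_prod_beta)
  show ?thesis
    unfolding detached_triangle_def
    by (rule exI[of _ "?p ?a1"], rule exI[of _ "?p ?b1"], rule exI[of _ "?p ?c1"], rule exI[of _ "?p ?a2"],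
        rule exI[of _ "?p ?b2"], rule exI[of _ "?p ?c2"], rule exI[of _ "?p ?a3"], rule exI[of _ "?p ?b3"],
        rule exI[of _ "?p ?c3"])
      (intro conjI distp[unfolded list.map] insert_subsetI empty_subsetI mem ok near far; simp add: doubleton_eq_iff)
qed


section \<open>Reducibility of the restrictions\<close>

lemma k_subsets_image: "p permutes {1..m} \<Longrightarrow> S \<in> k_subsets m k \<Longrightarrow> p ` S \<in> k_subsets m k"
proof -
  assume p: "p permutes {1..m}" and S: "S \<in> k_subsets m k"
  have "p ` S \<subseteq> p ` {1..m}" using S by (intro image_mono) (simp add: k_subsets_def)
  then show ?thesis
    using S by (simp add: k_subsets_def permutes_image[OF p] card_image[OF permutes_inj_on[OF p]])
qed

lemma block_partitions_image:
  assumes p: "p permutes {1..a * b}" and P: "P \<in> block_partitions a b"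
  shows "(`) p ` P \<in> block_partitions a b"
proof -
  have inj: "inj p" using p by (rule permutes_inj)
  have "card ((`) p ` P) = card P"
    by (rule card_image) (simp add: inj_on_def inj_image_eq_iff[OF inj])
  moreover have "card (p ` B) = card B" for B
    by (rule card_image[OF permutes_inj_on[OF p]])
  moreover have "partition_on (p ` {1..a * b}) ((`) p ` P)"
    using P inj
    by (auto simp: block_partitions_def partition_on_def disjoint_def inj_image_eq_iff
        simp flip: image_Union image_Int)
  ultimately show ?thesis
    using P by (simp add: block_partitions_def permutes_image[OF p])
qed

text \<open>Both actions preserve a graph with a detached triangle. A partition into two blocks has blocks of size at
  least six, since \<open>m\<close> is at least eleven.\<close>

theorem theorem7p12:
  fixes scale :: "'f::alg_closed_field \<Rightarrow> 'v::ab_group_add \<Rightarrow> 'v"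
    and \<rho> :: "(nat \<Rightarrow> nat) \<Rightarrow> 'v \<Rightarrow> 'v"
    and m n :: nat
    and X :: "(nat \<Rightarrow> nat) set"
  assumes "CHAR('f) = 2"
    and "11 \<le> m" and "m < n"
    and "(\<exists>a b f. 2 \<le> a \<and> 2 \<le> b \<and> m = a * b
            \<and> bij_betw f (block_partitions a b) {1..n}
            \<and> X = embedded_alt m (block_partitions a b) (partition_action a b) f)
       \<or> (\<exists>k f. 2 \<le> k \<and> real k < real m / 2
            \<and> bij_betw f (k_subsets m k) {1..n}
            \<and> X = embedded_alt m (k_subsets m k) (subset_action m k) f)"
    and "group_rep (alt_group n) scale \<rho>"
    and "1 < vector_space.dim scale UNIV
       \<or> (\<nexists>B. finite B \<and> module.span scale B = UNIV)"
  shows "group_rep.reducible ((alt_group n)\<lparr>carrier := X\<rparr>) scale \<rho>"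
proof -
  have n: "11 \<le> n" using assms(2,3) by simp
  note common = assms(1) n assms(5,6)
  from assms(4) show ?thesis
  proof (elim disjE exE conjE)
    fix k f
    assume k: "2 \<le> k" "real k < real m / 2" and f: "bij_betw f (k_subsets m k) {1..n}"
      and X: "X = embedded_alt m (k_subsets m k) (subset_action m k) f"
    have k': "2 * k < m" using k(2) by linarith
    show ?thesis
    proof (rule restriction_reducible_if_graph[OF common _ _ _ _ f, where act = "(`)" and m = m
          and adj = "\<lambda>S T. card (S \<union> T) = Suc k"])
      show "p ` S \<in> k_subsets m k" if "p permutes {1..m}" "S \<in> k_subsets m k" for p S
        using that by (rule k_subsets_image)
      show "\<exists>p. p permutes {1..m} \<and> p ` S = T" if "S \<in> k_subsets m k" "T \<in> k_subsets m k" for S T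
        using that by (intro permutes_subset) (simp_all add: k_subsets_def)
      show "X = embedded_alt m (k_subsets m k) (\<lambda>g. \<lambda>x\<in>k_subsets m k. g ` x) f"
        unfolding X subset_action_def ..
      show "(card (p ` S \<union> p ` T) = Suc k) = (card (S \<union> T) = Suc k)" if "p permutes {1..m}" for p S T
        unfolding image_Un[symmetric] card_image[OF permutes_inj_on[OF that]] ..
      show "detached_triangle (k_subsets m k) (\<lambda>S T. card (S \<union> T) = Suc k)"
        using k(1) k' assms(2) by (rule k_subsets_detached_triangle)
    qed (simp_all add: Un_commute image_image)
  next
    fix a b f
    assume ab: "2 \<le> a" "2 \<le> b" "m = a * b" and f: "bij_betw f (block_partitions a b) {1..n}"
      and X: "X = embedded_alt m (block_partitions a b) (partition_action a b) f"
    have reducible: ?thesis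
      if sym: "\<And>P Q. adj P Q \<Longrightarrow> adj Q P"
        and adj: "\<And>p P Q. inj p \<Longrightarrow> adj ((`) p ` P) ((`) p ` Q) = adj P Q"
        and triangle: "detached_triangle (block_partitions a b) adj" for adj
    proof (rule restriction_reducible_if_graph[OF common _ _ _ _ f, where act = "\<lambda>p P. (`) p ` P" and m = m and adj = adj])
      show "(`) p ` P \<in> block_partitions a b" if "p permutes {1..m}" "P \<in> block_partitions a b" for p P
        using that unfolding ab(3) by (rule block_partitions_image)
      show "\<exists>p. p permutes {1..m} \<and> (`) p ` P = Q" if "P \<in> block_partitions a b" "Q \<in> block_partitions a b" for P Q
        using that unfolding ab(3) by (rule block_partitions_transitive)
      show "X = embedded_alt m (block_partitions a b) (\<lambda>g. \<lambda>x\<in>block_partitions a b. (`) g ` x) f"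
        unfolding X partition_action_def ..
      show "adj ((`) p ` P) ((`) p ` Q) = adj P Q" if "p permutes {1..m}" for p P Q
        using permutes_inj[OF that] by (rule adj)
    qed (simp_all add: image_comp sym triangle)
    show ?thesis
    proof (cases "b = 2")
      case True
      then have a: "6 \<le> a" using ab assms(2) by simp
      show ?thesis
      proof (rule reducible)
        show "singular Q P" if "singular P Q" for P Q using that unfolding singular_def by (metis Int_commute)
        show "singular ((`) p ` P) ((`) p ` Q) = singular P Q" if "inj p" for p P Q
          using card_image[OF inj_on_subset[OF that]] by (simp add: singular_def image_Int[OF that, symmetric])
        show "detached_triangle (block_partitions a b) singular"
          unfolding True using a by (rule halves_detached_triangle)
      qed
    next
      case False
      then have b: "3 \<le> b" using ab(2) by simp
      show ?thesis
      proof (rule reducible)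
        show "card (Q \<inter> P) = b - 2" if "card (P \<inter> Q) = b - 2" for P Q :: "nat set set"
          using that by (simp add: Int_commute)
        show "(card ((`) p ` P \<inter> (`) p ` Q) = b - 2) = (card (P \<inter> Q) = b - 2)" if "inj p" for p and P Q :: "nat set set"
        proof -
          have inj: "inj ((`) p)" using that by (simp add: inj_on_def inj_image_eq_iff)
          show ?thesis
            unfolding image_Int[OF inj, symmetric] card_image[OF inj_on_subset[OF inj subset_UNIV]] ..
        qed
        show "detached_triangle (block_partitions a b) (\<lambda>P Q. card (P \<inter> Q) = b - 2)"
          using ab(1) b by (rule matchings_detached_triangle)
      qed
    qed
  qed
qed

end
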